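(* Let $(M,g)$ be an oriented Riemannian $3$-manifold (not necessarily compact) and let $f\in C^\infty(M)$ be a real-valued function. Then the Cotton tensor is conformally covariant, in the sense that $$\mathfrak{Cott}(e^{2f}g)=e^{-f}\,\mathfrak{Cott}(g)$$ as bilinear forms on $TM$, and the Cotton form, viewed as a $T^*M$-valued $2$-form, is conformally invariant: $$\mathfrak{cott}(e^{2f}g)=\mathfrak{cott}(g).$$
   Context: For a Riemannian metric $g$ on $M$: $\nabla$ is its Levi-Civita connection, $R_{X,Y}=[\nabla_X,\nabla_Y]-\nabla_{[X,Y]}$ the curvature, $\mathfrak{Ric}(U,V)=\mathrm{tr}[X\mapsto R_{X,U}V]$ the Ricci tensor, $\mathfrak{scal}=\mathrm{tr}_g\mathfrak{Ric}$. The Schouten tensor is the bilinear form $\mathfrak{Sch}:=\mathfrak{Ric}-\frac{\mathfrak{scal}}{4}g$. The Cotton form is $\mathfrak{cott}(g):=d^\nabla\mathfrak{Sch}$, i.e. (identifying vectors and $1$-forms in the value slot by $g$) the $T^*M$-valued $2$-form $\mathfrak{cott}(X,Y)(Z)=(\nabla_X\mathfrak{Sch})(Y,Z)-(\nabla_Y\mathfrak{Sch})(X,Z)$. The Cotton tensor is the bilinear form $\mathfrak{Cott}(g):=*\,d^\nabla\mathfrak{Sch}$, with the Hodge star $*$ of $g$ acting on the $2$-form part: for an oriented $g$-orthonormal frame $S_1,S_2,S_3$ and $(i,j,k)$ a cyclic permutation of $(1,2,3)$, $*(S^j\wedge S^k)=S^i$, so $\mathfrak{Cott}(S_i,Z)=\mathfrak{cott}(S_j,S_k)(Z)$.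 *)

theory Defs
  imports "HOL-Analysis.Analysis" "HOL-Library.Function_Algebras"
begin

section \<open>Pointwise real vector space structure on functions\<close>

text \<open>Tangent vectors are functionals on functions; the pointwise vector space structure makes the
  library notions \<open>span\<close>, \<open>independent\<close>, \<open>representation\<close> available for them.\<close>

instantiation "fun" :: (type, real_vector) real_vector
begin

definition scaleR_fun :: "real \<Rightarrow> ('a \<Rightarrow> 'b) \<Rightarrow> 'a \<Rightarrow> 'b"
  where "scaleR_fun c f = (\<lambda>x. c *\<^sub>R f x)"

instance
  by standard (auto simp: scaleR_fun_def plus_fun_def algebra_simps)

end

section \<open>Smooth functions on open subsets of three-space\<close>

definition partial_deriv :: "3 \<Rightarrow> (real^3 \<Rightarrow> real) \<Rightarrow> real^3 \<Rightarrow> real"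
  where "partial_deriv i f x = frechet_derivative f (at x) (axis i 1)"

text \<open>Only meant for open \<open>U\<close>.\<close>

primrec Ck_on :: "nat \<Rightarrow> (real^3) set \<Rightarrow> (real^3 \<Rightarrow> real) \<Rightarrow> bool"
  where
    "Ck_on 0 U f \<longleftrightarrow> continuous_on U f"
  | "Ck_on (Suc k) U f \<longleftrightarrow>
       (\<forall>x\<in>U. f differentiable (at x)) \<and> (\<forall>i. Ck_on k U (partial_deriv i f))"

definition smooth_on :: "(real^3) set \<Rightarrow> (real^3 \<Rightarrow> real) \<Rightarrow> bool"
  where "smooth_on U f \<longleftrightarrow> (\<forall>k. Ck_on k U f)"

section \<open>Oriented smooth three-manifolds\<close>

text \<open>A chart is a pair of a domain and a coordinate map.  The manifold is the whole type.\<close>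

type_synonym 'a chart = "'a set \<times> ('a \<Rightarrow> real^3)"

definition is_chart :: "'a::topological_space chart \<Rightarrow> bool"
  where "is_chart = (\<lambda>(U, \<phi>). open U \<and> open (\<phi> ` U) \<and> inj_on \<phi> U \<and>
           homeomorphism U (\<phi> ` U) \<phi> (inv_into U \<phi>))"

definition transition :: "'a chart \<Rightarrow> 'a chart \<Rightarrow> real^3 \<Rightarrow> real^3"
  where "transition c d = snd d \<circ> inv_into (fst c) (snd c)"

definition smooth_atlas :: "'a::topological_space chart set \<Rightarrow> bool"
  where "smooth_atlas A \<longleftrightarrow>
    (\<forall>c\<in>A. is_chart c) \<and> (\<Union>c\<in>A. fst c) = UNIV \<and>
    (\<forall>c\<in>A. \<forall>d\<in>A. \<forall>i. smooth_on (snd c ` (fst c \<inter> fst d)) (\<lambda>x. transition c d x $ i))"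

text \<open>An orientation is given by an atlas all of whose transition maps have positive Jacobian.\<close>

definition oriented_atlas :: "'a::topological_space chart set \<Rightarrow> bool"
  where "oriented_atlas A \<longleftrightarrow> smooth_atlas A \<and>
    (\<forall>c\<in>A. \<forall>d\<in>A. \<forall>x \<in> snd c ` (fst c \<inter> fst d).
       det (matrix (frechet_derivative (transition c d) (at x))) > 0)"

text \<open>Smoothness on an open set \<open>W\<close> of the manifold, and on some neighbourhood of a point.\<close>

definition smooth_fun_on :: "'a::topological_space chart set \<Rightarrow> 'a set \<Rightarrow> ('a \<Rightarrow> real) \<Rightarrow> bool"
  where "smooth_fun_on A W h \<longleftrightarrow> (\<forall>(U, \<phi>)\<in>A. smooth_on (\<phi> ` (U \<inter> W)) (h \<circ> inv_into U \<phi>))"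

definition smooth_at :: "'a::topological_space chart set \<Rightarrow> 'a \<Rightarrow> ('a \<Rightarrow> real) \<Rightarrow> bool"
  where "smooth_at A p h \<longleftrightarrow> (\<exists>W. open W \<and> p \<in> W \<and> smooth_fun_on A W h)"

section \<open>Tangent vectors and vector fields\<close>

text \<open>A tangent vector at \<open>p\<close> is a derivation at \<open>p\<close> of the functions that are smooth near \<open>p\<close>.
  Setting it to zero on all other functions makes it a unique object.  That it depends on germs
  only follows from the Leibniz rule: a function vanishing near \<open>p\<close> is its own product with
  the indicator function of a set away from \<open>p\<close>, and that indicator is smooth near \<open>p\<close>.\<close>

type_synonym 'a tvec = "('a \<Rightarrow> real) \<Rightarrow> real"

definition tangent_space :: "'a::topological_space chart set \<Rightarrow> 'a \<Rightarrow> 'a tvec set"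
  where "tangent_space A p = {v.
    (\<forall>h. \<not> smooth_at A p h \<longrightarrow> v h = 0) \<and>
    (\<forall>h k. smooth_at A p h \<and> smooth_at A p k \<longrightarrow>
        v (\<lambda>q. h q + k q) = v h + v k \<and>
        v (\<lambda>q. h q * k q) = v h * k p + h p * v k) \<and>
    (\<forall>c h. smooth_at A p h \<longrightarrow> v (\<lambda>q. c * h q) = c * v h)}"

type_synonym 'a vfield = "'a \<Rightarrow> 'a tvec"

text \<open>Vector fields defined and smooth on some neighbourhood of \<open>p\<close>.\<close>

definition vfield_at :: "'a::topological_space chart set \<Rightarrow> 'a \<Rightarrow> 'a vfield \<Rightarrow> bool"
  where "vfield_at A p X \<longleftrightarrow> (\<exists>W. open W \<and> p \<in> W \<and>
    (\<forall>q\<in>W. X q \<in> tangent_space A q \<and>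
       (\<forall>h. smooth_at A q h \<longrightarrow> smooth_at A q (\<lambda>r. X r h))))"

definition extends_vec :: "'a::topological_space chart set \<Rightarrow> 'a \<Rightarrow> 'a vfield \<Rightarrow> 'a tvec \<Rightarrow> bool"
  where "extends_vec A p X x \<longleftrightarrow> vfield_at A p X \<and> X p = x"

definition lie_bracket :: "'a::topological_space chart set \<Rightarrow> 'a vfield \<Rightarrow> 'a vfield \<Rightarrow> 'a vfield"
  where "lie_bracket A X Y p =
    (\<lambda>h. if smooth_at A p h then X p (\<lambda>q. Y q h) - Y p (\<lambda>q. X q h) else 0)"

section \<open>Riemannian metrics and the Levi-Civita connection\<close>

text \<open>Bilinear forms on the tangent bundle; only the values on tangent vectors matter.\<close>

type_synonym 'a bform = "'a \<Rightarrow> 'a tvec \<Rightarrow> 'a tvec \<Rightarrow> real"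

definition riemannian_metric :: "'a::topological_space chart set \<Rightarrow> 'a bform \<Rightarrow> bool"
  where "riemannian_metric A g \<longleftrightarrow>
    (\<forall>p. \<forall>u\<in>tangent_space A p. \<forall>v\<in>tangent_space A p.
       g p u v = g p v u \<and>
       (\<forall>w\<in>tangent_space A p. g p (u + v) w = g p u w + g p v w) \<and>
       (\<forall>c. g p (c *\<^sub>R u) v = c * g p u v) \<and>
       (u \<noteq> 0 \<longrightarrow> g p u u > 0)) \<and>
    (\<forall>p X Y. vfield_at A p X \<and> vfield_at A p Y \<longrightarrow> smooth_at A p (\<lambda>q. g q (X q) (Y q)))"

text \<open>A connection sends a point \<open>p\<close>, a tangent vector \<open>v\<close> at \<open>p\<close> and a vector field \<open>Y\<close> near \<open>p\<close>
  to the covariant derivative of \<open>Y\<close> in the direction \<open>v\<close>.\<close>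

type_synonym 'a conn = "'a \<Rightarrow> 'a tvec \<Rightarrow> 'a vfield \<Rightarrow> 'a tvec"

definition is_connection :: "'a::topological_space chart set \<Rightarrow> 'a conn \<Rightarrow> bool"
  where "is_connection A D \<longleftrightarrow>
    (\<forall>p Y. vfield_at A p Y \<longrightarrow>
       (\<forall>u\<in>tangent_space A p.
          D p u Y \<in> tangent_space A p \<and>
          (\<forall>v\<in>tangent_space A p. D p (u + v) Y = D p u Y + D p v Y) \<and>
          (\<forall>c. D p (c *\<^sub>R u) Y = c *\<^sub>R D p u Y) \<and>
          (\<forall>Z. vfield_at A p Z \<longrightarrow> D p u (\<lambda>q. Y q + Z q) = D p u Y + D p u Z) \<and>
          (\<forall>h. smooth_at A p h \<longrightarrow> D p u (\<lambda>q. h q *\<^sub>R Y q) = u h *\<^sub>R Y p + h p *\<^sub>R D p u Y)) \<and>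
       (\<forall>X. vfield_at A p X \<longrightarrow> vfield_at A p (\<lambda>q. D q (X q) Y)))"

definition is_levi_civita :: "'a::topological_space chart set \<Rightarrow> 'a bform \<Rightarrow> 'a conn \<Rightarrow> bool"
  where "is_levi_civita A g D \<longleftrightarrow> is_connection A D \<and>
    (\<forall>p X Y. vfield_at A p X \<and> vfield_at A p Y \<longrightarrow>
       D p (X p) Y - D p (Y p) X = lie_bracket A X Y p) \<and>
    (\<forall>p Y Z. \<forall>v\<in>tangent_space A p. vfield_at A p Y \<and> vfield_at A p Z \<longrightarrow>
       v (\<lambda>q. g q (Y q) (Z q)) = g p (D p v Y) (Z p) + g p (Y p) (D p v Z))"

text \<open>The connection is unique on tangent vectors and local vector fields; the choice only
  concerns irrelevant values on other arguments, hence \<open>SOME\<close> rather than \<open>THE\<close>.\<close>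

definition levi_civita :: "'a::topological_space chart set \<Rightarrow> 'a bform \<Rightarrow> 'a conn"
  where "levi_civita A g = (SOME D. is_levi_civita A g D)"

section \<open>Curvature\<close>

definition curvature_fields ::
    "'a::topological_space chart set \<Rightarrow> 'a bform \<Rightarrow> 'a vfield \<Rightarrow> 'a vfield \<Rightarrow> 'a vfield \<Rightarrow> 'a vfield"
  where "curvature_fields A g X Y Z p =
    (let D = levi_civita A g in
       D p (X p) (\<lambda>q. D q (Y q) Z) - D p (Y p) (\<lambda>q. D q (X q) Z) - D p (lie_bracket A X Y p) Z)"

text \<open>The value at a point is the common value for all local extensions of the arguments.\<close>

definition curvature ::
    "'a::topological_space chart set \<Rightarrow> 'a bform \<Rightarrow> 'a \<Rightarrow> 'a tvec \<Rightarrow> 'a tvec \<Rightarrow> 'a tvec \<Rightarrow> 'a tvec"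
  where "curvature A g p x y z = (THE w. \<forall>X Y Z.
    extends_vec A p X x \<and> extends_vec A p Y y \<and> extends_vec A p Z z \<longrightarrow>
      w = curvature_fields A g X Y Z p)"

text \<open>The trace of a linear endomorphism of a finite-dimensional subspace, computed in any basis.\<close>

definition trace_on :: "'v::real_vector set \<Rightarrow> ('v \<Rightarrow> 'v) \<Rightarrow> real"
  where "trace_on S T = (THE t. \<forall>B. independent B \<and> span B = S \<longrightarrow>
    t = (\<Sum>b\<in>B. representation B (T b) b))"

definition orthonormal_frame ::
    "'a::topological_space chart set \<Rightarrow> 'a bform \<Rightarrow> 'a \<Rightarrow> (3 \<Rightarrow> 'a tvec) \<Rightarrow> bool"
  where "orthonormal_frame A g p S \<longleftrightarrow> (\<forall>i. S i \<in> tangent_space A p) \<and>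
    (\<forall>i j. g p (S i) (S j) = (if i = j then 1 else 0))"

definition metric_trace ::
    "'a::topological_space chart set \<Rightarrow> 'a bform \<Rightarrow> 'a bform \<Rightarrow> 'a \<Rightarrow> real"
  where "metric_trace A g b p = (THE t. \<forall>S. orthonormal_frame A g p S \<longrightarrow>
    t = (\<Sum>i\<in>UNIV. b p (S i) (S i)))"

definition ricci :: "'a::topological_space chart set \<Rightarrow> 'a bform \<Rightarrow> 'a bform"
  where "ricci A g p u v = trace_on (tangent_space A p) (\<lambda>x. curvature A g p x u v)"

definition scal :: "'a::topological_space chart set \<Rightarrow> 'a bform \<Rightarrow> 'a \<Rightarrow> real"
  where "scal A g p = metric_trace A g (ricci A g) p"

definition schouten :: "'a::topological_space chart set \<Rightarrow> 'a bform \<Rightarrow> 'a bform"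
  where "schouten A g p u v = ricci A g p u v - scal A g p / 4 * g p u v"

section \<open>Cotton form and Cotton tensor\<close>

text \<open>\<open>cov_deriv_form A g b p x y z\<close> is the value on \<open>(y, z)\<close> of the covariant derivative of the
  bilinear form \<open>b\<close> in the direction \<open>x\<close>.\<close>

definition cov_deriv_form ::
    "'a::topological_space chart set \<Rightarrow> 'a bform \<Rightarrow> 'a bform \<Rightarrow>
     'a \<Rightarrow> 'a tvec \<Rightarrow> 'a tvec \<Rightarrow> 'a tvec \<Rightarrow> real"
  where "cov_deriv_form A g b p x y z = (THE r. \<forall>Y Z.
    extends_vec A p Y y \<and> extends_vec A p Z z \<longrightarrow>
      r = x (\<lambda>q. b q (Y q) (Z q))
          - b p (levi_civita A g p x Y) z - b p y (levi_civita A g p x Z))"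

definition cotton_form ::
    "'a::topological_space chart set \<Rightarrow> 'a bform \<Rightarrow> 'a \<Rightarrow> 'a tvec \<Rightarrow> 'a tvec \<Rightarrow> 'a tvec \<Rightarrow> real"
  where "cotton_form A g p x y z =
    cov_deriv_form A g (schouten A g) p x y z - cov_deriv_form A g (schouten A g) p y x z"

text \<open>A frame is positively oriented if its component matrix in the charts of the oriented atlas
  has positive determinant; \<open>S i\<close> applied to the coordinate function \<open>j\<close> is the component.\<close>

definition positively_oriented ::
    "'a::topological_space chart set \<Rightarrow> 'a \<Rightarrow> (3 \<Rightarrow> 'a tvec) \<Rightarrow> bool"
  where "positively_oriented A p S \<longleftrightarrow> (\<forall>(U, \<phi>)\<in>A. p \<in> U \<longrightarrow>
    det (\<chi> i j. S i (\<lambda>q. \<phi> q $ j)) > 0)"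

text \<open>Hodge star of a two-form \<open>\<omega>\<close> on the tangent space at \<open>p\<close>.  Addition in the index type \<open>3\<close> is
  modulo three, so \<open>(i, i + 1, i + 2)\<close> runs through the cyclic permutations; the one-form dual
  to \<open>S i\<close> is \<open>\<lambda>u. g p u (S i)\<close>, and the star sends \<open>S^(i+1) \<and> S^(i+2)\<close> to \<open>S^i\<close>.\<close>

definition hodge_star ::
    "'a::topological_space chart set \<Rightarrow> 'a bform \<Rightarrow> 'a \<Rightarrow> ('a tvec \<Rightarrow> 'a tvec \<Rightarrow> real) \<Rightarrow> 'a tvec \<Rightarrow> real"
  where "hodge_star A g p \<omega> u = (THE r. \<forall>S.
    orthonormal_frame A g p S \<and> positively_oriented A p S \<longrightarrow>
      r = (\<Sum>i\<in>UNIV. \<omega> (S (i + 1)) (S (i + 2)) * g p u (S i)))"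

definition cotton_tensor :: "'a::topological_space chart set \<Rightarrow> 'a bform \<Rightarrow> 'a bform"
  where "cotton_tensor A g p u z = hodge_star A g p (\<lambda>x y. cotton_form A g p x y z) u"

definition conformal_metric :: "('a \<Rightarrow> real) \<Rightarrow> 'a bform \<Rightarrow> 'a bform"
  where "conformal_metric f g p u v = exp (2 * f p) * g p u v"

end

theory Submission
  imports Defs
begin

text \<open>
  Write \<open>g'\<close> for \<open>e^(2f) g\<close>, \<open>F\<close> for the \<open>g\<close>-gradient of \<open>f\<close>, \<open>H\<close> for the Hessian of \<open>f\<close> and \<open>P\<close> for the
  Schouten tensor of \<open>g\<close>.  The Koszul formula for \<open>g'\<close> is the one for \<open>g\<close> up to first derivatives of
  \<open>f\<close>, whence \<open>D'\<^sub>X Y = D\<^sub>X Y + (X f) Y + (Y f) X - g(X, Y) F\<close> (\<open>D_conformal\<close>).  Inserting this into the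
  curvature, \<open>R'\<close> and \<open>R\<close> differ by the Kulkarni--Nomizu product of \<open>g\<close> with
  \<open>- H + df df - |df|^2 g / 2\<close>.  In dimension three the curvature has no Weyl part: it is the
  Kulkarni--Nomizu product of the metric with the Schouten tensor (\<open>curvature_kn\<close>), and this property
  characterises the Schouten tensor (\<open>schouten_unique\<close>).  Therefore the Schouten tensor of \<open>g'\<close> is
  \<open>P - H + df df - |df|^2 g / 2\<close> (\<open>schouten_conformal\<close>).

  Skew-symmetrising the \<open>D'\<close>-derivative of this tensor, the second derivatives of \<open>F\<close> combine to the
  curvature term \<open>R(x, y) F\<close>, which is again expressed by \<open>P\<close>; it cancels the terms in which \<open>D' - D\<close> acts
  on \<open>P\<close>, and the terms with \<open>H\<close> and those cubic in \<open>df\<close> cancel among themselves.  What is left is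
  the Cotton form of \<open>g\<close> (\<open>cotton_form_conformal\<close>).  The Cotton tensor then only sees the Hodge star:
  \<open>g'\<close>-orthonormal frames are \<open>e^(-f)\<close> times \<open>g\<close>-orthonormal ones, and the factors \<open>e^(-2f)\<close> from the
  two-form, \<open>e^(-f)\<close> from the dual one-form and \<open>e^(2f)\<close> from \<open>g'\<close> multiply to \<open>e^(-f)\<close>
  (\<open>cotton_tensor_conformal\<close>).

  The computations with second derivatives are done at one point \<open>p\<close> with fields whose \<open>D\<close>-derivatives vanish at \<open>p\<close>
  (\<open>ex_parallel_extension\<close>).  This is legitimate because every operator involved is linear over the
  smooth functions, so that its value depends on the fields at \<open>p\<close> only (\<open>tensorial_pointwise\<close>).  The
  latter needs smooth local orthonormal frames (\<open>ex_local_frame\<close>), which also compute all traces, and the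
  fact that derivations at a point form a space of dimension three (\<open>tangent_coord_expansion\<close>, from
  Hadamard's lemma).  The Levi-Civita connection is constructed from the Koszul formula
  (\<open>koszul_connection_levi_civita\<close>).
\<close>

section \<open>Differential calculus on open subsets of three-space\<close>

lemma partial_deriv_eq:
  "(f has_derivative f') (at x) \<Longrightarrow> partial_deriv i f x = f' (axis i 1)"
  unfolding partial_deriv_def by (metis frechet_derivative_at)

lemma has_derivative_partial:
  assumes "f differentiable (at x)"
  shows "(f has_derivative (\<lambda>v. \<Sum>j\<in>UNIV. v $ j * partial_deriv j f x)) (at x)"
proof -
  let ?f' = "frechet_derivative f (at x)"
  have d: "(f has_derivative ?f') (at x)" using assms by (simp add: frechet_derivative_works)
  have lin: "linear ?f'" using assms by (rule linear_frechet_derivative)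
  have "?f' v = (\<Sum>j\<in>UNIV. v $ j * partial_deriv j f x)" for v
  proof -
    have "?f' v = ?f' (\<Sum>j\<in>UNIV. (v $ j) *\<^sub>R axis j 1)"
      using basis_expansion[of v] by (simp add: scalar_mult_eq_scaleR)
    also have "\<dots> = (\<Sum>j\<in>UNIV. v $ j * partial_deriv j f x)"
      by (simp add: linear_sum[OF lin] linear_scale[OF lin] partial_deriv_def)
    finally show ?thesis .
  qed
  then have "?f' = (\<lambda>v. \<Sum>j\<in>UNIV. v $ j * partial_deriv j f x)" by (rule ext)
  with d show ?thesis by simp
qed

lemma partial_deriv_cong:
  assumes "open U" "x \<in> U" "\<And>y. y \<in> U \<Longrightarrow> f y = g y"
  shows "partial_deriv i f x = partial_deriv i g x"
proof -
  have "(f has_derivative D) (at x) \<longleftrightarrow> (g has_derivative D) (at x)" for D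
    using assms has_derivative_transform_within_open[of f D x UNIV U g]
      has_derivative_transform_within_open[of g D x UNIV U f] by fastforce
  then show ?thesis unfolding partial_deriv_def frechet_derivative_def by simp
qed

lemma Ck_on_continuous: "Ck_on k U f \<Longrightarrow> continuous_on U f"
  by (cases k) (auto intro: continuous_at_imp_continuous_on differentiable_imp_continuous_within)

lemma Ck_on_Suc_mono: "Ck_on (Suc k) U f \<Longrightarrow> Ck_on k U f"
proof (induction k arbitrary: f)
  case 0
  then show ?case using Ck_on_continuous by fastforce
next
  case (Suc k)
  then show ?case by (metis Ck_on.simps(2))
qed

lemma Ck_on_subset: "Ck_on k U f \<Longrightarrow> V \<subseteq> U \<Longrightarrow> Ck_on k V f"
  by (induction k arbitrary: f) (auto intro: continuous_on_subset)

lemma Ck_on_cong: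
  assumes "open U" "\<And>x. x \<in> U \<Longrightarrow> f x = g x" "Ck_on k U f"
  shows "Ck_on k U g"
  using assms(2,3)
proof (induction k arbitrary: f g)
  case 0
  then show ?case using continuous_on_cong[of U U f g] by simp
next
  case (Suc k)
  have "g differentiable (at x)" if x: "x \<in> U" for x
  proof -
    have "(f has_derivative frechet_derivative f (at x)) (at x)"
      using Suc.prems(2) x by (simp flip: frechet_derivative_works)
    then have "(g has_derivative frechet_derivative f (at x)) (at x)"
      by (rule has_derivative_transform_within_open[OF _ assms(1) x Suc.prems(1)])
    then show ?thesis by (rule differentiableI)
  qed
  moreover have "Ck_on k U (partial_deriv i g)" for i
  proof (rule Suc.IH)
    show "partial_deriv i f x = partial_deriv i g x" if "x \<in> U" for x
      by (rule partial_deriv_cong[OF assms(1) that Suc.prems(1)])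
    show "Ck_on k U (partial_deriv i f)" using Suc.prems(2) by simp
  qed
  ultimately show ?case by simp
qed

lemma Ck_on_const: "Ck_on k U (\<lambda>x. c)"
proof (induction k arbitrary: c)
  case (Suc k)
  have "partial_deriv i (\<lambda>x. c) = (\<lambda>x. 0)" for i
    by (rule ext) (auto simp: partial_deriv_def)
  then show ?case using Suc by simp
qed simp

lemma Ck_on_add:
  assumes "open U" "Ck_on k U f" "Ck_on k U g"
  shows "Ck_on k U (\<lambda>x. f x + g x)"
  using assms(2,3)
proof (induction k arbitrary: f g)
  case 0
  then show ?case by (auto intro: continuous_intros)
next
  case (Suc k)
  have p: "partial_deriv i f x + partial_deriv i g x = partial_deriv i (\<lambda>x. f x + g x) x"
    if "x \<in> U" for x i
  proof -
    have "((\<lambda>x. f x + g x) has_derivative (\<lambda>v. frechet_derivative f (at x) v + frechet_derivative g (at x) v)) (at x)"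
      using that Suc.prems by (intro has_derivative_add) (simp_all flip: frechet_derivative_works)
    from partial_deriv_eq[OF this, of i] show ?thesis by (simp add: partial_deriv_def)
  qed
  have "Ck_on k U (partial_deriv i (\<lambda>x. f x + g x))" for i
    by (rule Ck_on_cong[OF assms(1) p]) (use Suc in auto)
  then show ?case using Suc.prems by auto
qed

lemma Ck_on_mult:
  assumes "open U" "Ck_on k U f" "Ck_on k U g"
  shows "Ck_on k U (\<lambda>x. f x * g x)"
  using assms(2,3)
proof (induction k arbitrary: f g)
  case 0
  then show ?case by (auto intro: continuous_intros)
next
  case (Suc k)
  have p: "f x * partial_deriv i g x + partial_deriv i f x * g x = partial_deriv i (\<lambda>x. f x * g x) x"
    if "x \<in> U" for x i
  proof -
    have "((\<lambda>x. f x * g x) has_derivative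
        (\<lambda>v. f x * frechet_derivative g (at x) v + frechet_derivative f (at x) v * g x)) (at x)"
      using that Suc.prems by (intro has_derivative_mult) (simp_all flip: frechet_derivative_works)
    from partial_deriv_eq[OF this, of i] show ?thesis by (simp add: partial_deriv_def)
  qed
  have "Ck_on k U (partial_deriv i (\<lambda>x. f x * g x))" for i
  proof (rule Ck_on_cong[OF assms(1) p])
    show "Ck_on k U (\<lambda>x. f x * partial_deriv i g x + partial_deriv i f x * g x)"
      using Suc.prems by (intro Ck_on_add[OF assms(1)] Suc.IH) (auto intro: Ck_on_Suc_mono simp del: Ck_on.simps simp: Ck_on.simps(2))
  qed
  then show ?case using Suc.prems by auto
qed

lemma Ck_on_sum:
  assumes "open U" "finite I" "\<And>i. i \<in> I \<Longrightarrow> Ck_on k U (f i)"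
  shows "Ck_on k U (\<lambda>x. \<Sum>i\<in>I. f i x)"
  using assms(2,3) by (induction I rule: finite_induct) (auto intro: Ck_on_const Ck_on_add[OF assms(1)])

lemma has_derivative_vecI:
  fixes F :: "real^3 \<Rightarrow> real^3"
  assumes "\<And>j. ((\<lambda>x. F x $ j) has_derivative (\<lambda>v. D v $ j)) (at x)"
  shows "(F has_derivative D) (at x)"
proof (subst has_derivative_componentwise_within, intro ballI)
  fix b :: "real^3" assume "b \<in> Basis"
  then obtain j where "b = axis j 1" by (auto simp: Basis_vec_def)
  then show "((\<lambda>x. F x \<bullet> b) has_derivative (\<lambda>v. D v \<bullet> b)) (at x)"
    using assms[of j] by (simp add: inner_axis)
qed

lemma Ck_on_compose:
  assumes U: "open U" and sub: "F ` U \<subseteq> V"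
    and F: "\<And>j. Ck_on k U (\<lambda>x. F x $ j)" and f: "Ck_on k V f"
  shows "Ck_on k U (f \<circ> F)"
  using F f
proof (induction k arbitrary: f)
  case 0
  have "continuous_on U (\<lambda>x. \<chi> j. F x $ j)" using 0 by (intro continuous_on_vec_lambda) auto
  then have "continuous_on U F" by simp
  moreover have "continuous_on (F ` U) f" using 0(2) sub continuous_on_subset by auto
  ultimately show ?case unfolding Ck_on.simps by (rule continuous_on_compose)
next
  case (Suc k)
  let ?G = "\<lambda>x v. \<chi> j. \<Sum>l\<in>UNIV. v $ l * partial_deriv l (\<lambda>x. F x $ j) x"
  have dF: "(F has_derivative ?G x) (at x)" if "x \<in> U" for x
    by (rule has_derivative_vecI) (use that Suc.prems has_derivative_partial in simp)
  have df: "(f has_derivative (\<lambda>v. \<Sum>j\<in>UNIV. v $ j * partial_deriv j f (F x))) (at (F x))" if "x \<in> U" for x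
    using that Suc.prems sub by (intro has_derivative_partial) auto
  note dc = diff_chain_at[OF dF df]
  have p: "(\<Sum>j\<in>UNIV. partial_deriv i (\<lambda>x. F x $ j) x * (partial_deriv j f \<circ> F) x) = partial_deriv i (f \<circ> F) x"
    if "x \<in> U" for x i
    unfolding partial_deriv_eq[OF dc[OF that that]] by (simp add: axis_def if_distrib[of "\<lambda>a. a * _"] cong: if_cong)
  have "Ck_on k U (partial_deriv i (f \<circ> F))" for i
  proof (rule Ck_on_cong[OF U p])
    show "Ck_on k U (\<lambda>x. \<Sum>j\<in>UNIV. partial_deriv i (\<lambda>x. F x $ j) x * (partial_deriv j f \<circ> F) x)"
    proof (intro Ck_on_sum Ck_on_mult U)
      show "Ck_on k U (partial_deriv j f \<circ> F)" for j
        using Suc.prems by (intro Suc.IH) (auto intro: Ck_on_Suc_mono simp del: Ck_on.simps simp: Ck_on.simps(2))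
    qed (use Suc.prems in auto)
  qed
  then show ?case using dc unfolding Ck_on.simps differentiable_def by auto
qed

lemma Ck_on_exp:
  assumes "open U" "Ck_on k U f"
  shows "Ck_on k U (\<lambda>x. exp (f x))"
  using assms(2)
proof (induction k)
  case 0
  then show ?case by (auto intro: continuous_intros)
next
  case (Suc k)
  have d: "((\<lambda>x. exp (f x)) has_derivative (\<lambda>v. exp (f x) * frechet_derivative f (at x) v)) (at x)"
    if "x \<in> U" for x
    using that Suc.prems has_derivative_exp[of f "frechet_derivative f (at x)" x UNIV]
    by (simp add: frechet_derivative_works mult.commute)
  have p: "exp (f x) * partial_deriv i f x = partial_deriv i (\<lambda>x. exp (f x)) x" if "x \<in> U" for x i
    unfolding partial_deriv_eq[OF d[OF that]] by (simp add: partial_deriv_def)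
  have "Ck_on k U (partial_deriv i (\<lambda>x. exp (f x)))" for i
    by (rule Ck_on_cong[OF assms(1) p])
      (use Suc Ck_on_Suc_mono[OF Suc.prems] in \<open>auto intro!: Ck_on_mult assms(1)\<close>)
  then show ?case using d by (auto simp: differentiable_def)
qed

text \<open>Allowing every exponent \<open>a\<close> closes the class of functions under differentiation, which the induction needs.\<close>

lemma Ck_on_powr:
  fixes f :: "real^3 \<Rightarrow> real"
  assumes "open U" "Ck_on k U f" "\<And>x. x \<in> U \<Longrightarrow> f x > 0"
  shows "Ck_on k U (\<lambda>x. f x powr a)"
  using assms(2)
proof (induction k arbitrary: a)
  case 0
  then show ?case using assms(3) by (force intro: continuous_on_powr)
next
  case (Suc k)
  have d: "((\<lambda>x. f x powr a) has_derivative (\<lambda>v. a * f x powr (a - 1) * frechet_derivative f (at x) v)) (at x)"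
    if "x \<in> U" for x
  proof -
    have "(f has_derivative frechet_derivative f (at x)) (at x)"
      using that Suc.prems by (auto simp: frechet_derivative_works)
    from has_derivative_powr[OF this has_derivative_const assms(3)[OF that], of a]
    show ?thesis using assms(3)[OF that] by (simp add: powr_diff mult_ac)
  qed
  have p: "a * f x powr (a - 1) * partial_deriv i f x = partial_deriv i (\<lambda>x. f x powr a) x" if "x \<in> U" for x i
    unfolding partial_deriv_eq[OF d[OF that]] by (simp add: partial_deriv_def)
  have "Ck_on k U (partial_deriv i (\<lambda>x. f x powr a))" for i
    by (rule Ck_on_cong[OF assms(1) p])
      (use Suc Ck_on_Suc_mono[OF Suc.prems] in \<open>auto intro!: Ck_on_mult Ck_on_const assms(1)\<close>)
  then show ?case using d by (auto simp: differentiable_def)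
qed

lemma smooth_on_partial_deriv: "smooth_on U f \<Longrightarrow> smooth_on U (partial_deriv i f)"
  unfolding smooth_on_def by (metis Ck_on.simps(2))

lemma smooth_on_differentiable: "smooth_on U f \<Longrightarrow> x \<in> U \<Longrightarrow> f differentiable (at x)"
  unfolding smooth_on_def by (metis Ck_on.simps(2))

lemma smooth_on_continuous: "smooth_on U f \<Longrightarrow> continuous_on U f"
  unfolding smooth_on_def by (metis Ck_on.simps(1))

lemma segment_in_ball:
  fixes a x :: "real^3"
  assumes "x \<in> ball a r" "t \<in> {0..1}"
  shows "a + t *\<^sub>R (x - a) \<in> ball a r"
proof -
  have "norm (t *\<^sub>R (x - a)) \<le> norm (x - a)" using assms(2) by (simp add: mult_left_le_one_le)
  then show ?thesis using assms(1) by (simp add: dist_norm norm_minus_commute)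
qed

lemma continuous_on_radial:
  fixes a :: "real^3"
  assumes "continuous_on (ball a r) F"
  shows "continuous_on (ball a r \<times> cbox 0 1) (\<lambda>(x, t::real). t ^ m * F (a + t *\<^sub>R (x - a)))"
  unfolding split_beta
  by (intro continuous_intros continuous_on_compose2[OF assms]) (use segment_in_ball in auto)

text \<open>Differentiating under the integral sign produces one more factor \<open>t\<close>, hence the weight \<open>t ^ m\<close> for
  arbitrary \<open>m\<close> in the induction.\<close>

lemma Ck_on_radial_average:
  fixes a :: "real^3"
  assumes "smooth_on (ball a r) F"
  shows "Ck_on k (ball a r) (\<lambda>x. integral (cbox 0 1) (\<lambda>t::real. t ^ m * F (a + t *\<^sub>R (x - a))))"
  using assms
proof (induction k arbitrary: F m)
  case 0
  then show ?case
    using integral_continuous_on_param[OF continuous_on_radial[OF smooth_on_continuous[OF 0], of m]] by simp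
next
  case (Suc k)
  let ?B = "ball a r"
  define E where "E j = blinfun_inner_left (axis j 1 :: real^3)" for j
  define G where "G x t = (\<Sum>j\<in>UNIV. (t ^ Suc m * partial_deriv j F (a + t *\<^sub>R (x - a))) *\<^sub>R E j)" for x and t :: real
  have G: "blinfun_apply (G x t) v = (\<Sum>j\<in>UNIV. t ^ Suc m * partial_deriv j F (a + t *\<^sub>R (x - a)) * v $ j)" for x t v
    by (simp add: G_def E_def blinfun.sum_left blinfun.scaleR_left inner_axis inner_commute)
  note cont = continuous_on_radial[OF smooth_on_continuous]
  have contG: "continuous_on (?B \<times> cbox 0 1) (\<lambda>(x, t). G x t)"
    unfolding G_def split_beta
    by (intro continuous_on_sum continuous_on_scaleR continuous_on_const
        cont[OF smooth_on_partial_deriv[OF Suc.prems], of "Suc m", unfolded split_beta])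
  have fx: "((\<lambda>x. t ^ m * F (a + t *\<^sub>R (x - a))) has_derivative blinfun_apply (G x t)) (at x within ?B)"
    if "x \<in> ?B" "t \<in> cbox 0 1" for x t
  proof -
    have "a + t *\<^sub>R (x - a) \<in> ?B" using segment_in_ball that by auto
    then have dF: "(F has_derivative (\<lambda>v. \<Sum>j\<in>UNIV. v $ j * partial_deriv j F (a + t *\<^sub>R (x - a)))) (at (a + t *\<^sub>R (x - a)))"
      by (intro has_derivative_partial smooth_on_differentiable[OF Suc.prems])
    have "((\<lambda>x. a + t *\<^sub>R (x - a)) has_derivative (\<lambda>v. t *\<^sub>R v)) (at x)"
      by (auto intro!: derivative_eq_intros)
    from diff_chain_at[OF this dF]
    have "((\<lambda>x. F (a + t *\<^sub>R (x - a))) has_derivative (\<lambda>v. \<Sum>j\<in>UNIV. t * v $ j * partial_deriv j F (a + t *\<^sub>R (x - a)))) (at x)"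
      by (simp add: o_def)
    from has_derivative_mult_right[OF this, of "t ^ m"]
    have "((\<lambda>x. t ^ m * F (a + t *\<^sub>R (x - a))) has_derivative blinfun_apply (G x t)) (at x)"
      by (simp add: G[abs_def] sum_distrib_left mult_ac)
    then show ?thesis by (rule has_derivative_at_withinI)
  qed
  have int: "(\<lambda>t. h x t) integrable_on cbox (0::real) 1"
    if "continuous_on (?B \<times> cbox 0 1) (\<lambda>(x, t). h x t)" "x \<in> ?B" for h :: "real^3 \<Rightarrow> real \<Rightarrow> 'z::banach" and x
  proof (rule integrable_continuous)
    have "continuous_on (cbox 0 1) ((\<lambda>(x, t). h x t) \<circ> Pair x)"
      by (rule continuous_on_compose) (use that in \<open>auto intro!: continuous_intros intro: continuous_on_subset\<close>)
    then show "continuous_on (cbox 0 1) (h x)" by (simp add: o_def)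
  qed
  let ?I = "\<lambda>x. integral (cbox 0 1) (\<lambda>t::real. t ^ m * F (a + t *\<^sub>R (x - a)))"
  have d: "(?I has_derivative integral (cbox 0 1) (G x)) (at x)" if "x \<in> ?B" for x
  proof -
    have "(?I has_derivative integral (cbox 0 1) (G x)) (at x within ?B)"
      by (rule leibniz_rule[OF fx int[OF cont[OF Suc.prems]] contG]) (use that in auto)
    then show ?thesis unfolding at_within_open[OF that open_ball] .
  qed
  have p: "integral (cbox 0 1) (\<lambda>t. t ^ Suc m * partial_deriv i F (a + t *\<^sub>R (x - a))) = partial_deriv i ?I x"
    if "x \<in> ?B" for x i
    unfolding partial_deriv_eq[OF d[OF that]] blinfun_apply_integral[OF int[OF contG that]] G
    by (simp add: axis_def if_distrib[of "\<lambda>z. _ * z"] cong: if_cong)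
  have "Ck_on k ?B (partial_deriv i ?I)" for i
    by (rule Ck_on_cong[OF open_ball p Suc.IH[OF smooth_on_partial_deriv[OF Suc.prems], of "Suc m" i]])
  then show ?case unfolding Ck_on.simps using differentiableI[OF d] by blast
qed

text \<open>Integrate the derivative of \<open>F\<close> along the segment from \<open>a\<close> to \<open>x\<close>; the coefficients are radial averages
  of the partial derivatives.\<close>

lemma hadamard:
  fixes a :: "real^3"
  assumes "smooth_on (ball a r) F"
  obtains G where "\<And>j. smooth_on (ball a r) (G j)" "\<And>j. G j a = partial_deriv j F a"
    "\<And>x. x \<in> ball a r \<Longrightarrow> F x = F a + (\<Sum>j\<in>UNIV. (x $ j - a $ j) * G j x)"
proof
  define G where "G j x = integral (cbox 0 1) (\<lambda>t::real. t ^ 0 * partial_deriv j F (a + t *\<^sub>R (x - a)))" for j x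
  show "smooth_on (ball a r) (G j)" for j
    unfolding G_def smooth_on_def using Ck_on_radial_average[OF smooth_on_partial_deriv[OF assms]] by blast
  show "G j a = partial_deriv j F a" for j by (simp add: G_def)
  show "F x = F a + (\<Sum>j\<in>UNIV. (x $ j - a $ j) * G j x)" if x: "x \<in> ball a r" for x
  proof -
    have int: "(\<lambda>t. partial_deriv j F (a + t *\<^sub>R (x - a))) integrable_on {0..1}" for j
      by (intro integrable_continuous_real
          continuous_on_compose2[OF smooth_on_continuous[OF smooth_on_partial_deriv[OF assms]]] continuous_intros)
        (use segment_in_ball x in auto)
    have "((\<lambda>t. F (a + t *\<^sub>R (x - a))) has_vector_derivative
        (\<Sum>j\<in>UNIV. (x $ j - a $ j) * partial_deriv j F (a + t *\<^sub>R (x - a)))) (at t within {0..1})"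
      if t: "t \<in> {0..1}" for t
    proof -
      have dF: "(F has_derivative (\<lambda>v. \<Sum>j\<in>UNIV. v $ j * partial_deriv j F (a + t *\<^sub>R (x - a)))) (at (a + t *\<^sub>R (x - a)))"
        by (intro has_derivative_partial smooth_on_differentiable[OF assms] segment_in_ball x t)
      have "((\<lambda>t. a + t *\<^sub>R (x - a)) has_derivative (\<lambda>s. s *\<^sub>R (x - a))) (at t)"
        by (auto intro!: derivative_eq_intros)
      from diff_chain_at[OF this dF] show ?thesis
        by - (rule has_vector_derivative_at_within,
          simp only: o_def has_vector_derivative_def sum_distrib_left mult.assoc vector_scaleR_component
            vector_minus_component real_scaleR_def)
    qed
    from fundamental_theorem_of_calculus[OF _ this]
    have "((\<lambda>t. \<Sum>j\<in>UNIV. (x $ j - a $ j) * partial_deriv j F (a + t *\<^sub>R (x - a))) has_integral F x - F a) {0..1}"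
      by simp
    then have "F x - F a = integral {0..1} (\<lambda>t. \<Sum>j\<in>UNIV. (x $ j - a $ j) * partial_deriv j F (a + t *\<^sub>R (x - a)))"
      by (simp add: integral_unique)
    also have "\<dots> = (\<Sum>j\<in>UNIV. (x $ j - a $ j) * G j x)"
      by (subst integral_sum) (use int in \<open>auto simp: G_def intro: integrable_on_mult_right\<close>)
    finally show ?thesis by simp
  qed
qed

section \<open>Smooth functions, tangent vectors and vector fields\<close>

lemma scaleR_fun_apply [simp]: "(c *\<^sub>R f) x = c *\<^sub>R f x"
  by (simp add: scaleR_fun_def)

lemma smooth_on_cong:
  assumes "open U" "smooth_on U f" "\<And>x. x \<in> U \<Longrightarrow> f x = g x"
  shows "smooth_on U g"
  using assms Ck_on_cong[of U f g] unfolding smooth_on_def by blast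

lemma smooth_on_powr:
  assumes "open U" "smooth_on U f" "\<And>x. x \<in> U \<Longrightarrow> f x > 0"
  shows "smooth_on U (\<lambda>x. f x powr a)"
  using assms Ck_on_powr[of U _ f a] unfolding smooth_on_def by blast

lemma sum_fun_apply: "(\<Sum>i\<in>I. f i) x = (\<Sum>i\<in>I. f i x)"
  by (induction I rule: infinite_finite_induct) auto

locale smooth_manifold =
  fixes A :: "'a::topological_space chart set"
  assumes atlas: "smooth_atlas A"
begin

lemma chartD:
  assumes "(U, \<phi>) \<in> A"
  shows "open U" "open (\<phi> ` U)" "inj_on \<phi> U" "homeomorphism U (\<phi> ` U) \<phi> (inv_into U \<phi>)"
proof -
  have "is_chart (U, \<phi>)" using atlas assms unfolding smooth_atlas_def by blast
  then show "open U" "open (\<phi> ` U)" "inj_on \<phi> U" "homeomorphism U (\<phi> ` U) \<phi> (inv_into U \<phi>)"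
    by (simp_all add: is_chart_def)
qed

lemma ex_chart: obtains U \<phi> where "(U, \<phi>) \<in> A" "p \<in> U"
proof -
  have "p \<in> (\<Union>c\<in>A. fst c)" using atlas by (simp add: smooth_atlas_def)
  then show ?thesis using that by fastforce
qed

lemma open_chart_image:
  assumes "(U, \<phi>) \<in> A" "open W"
  shows "open (\<phi> ` (U \<inter> W))"
proof -
  have "openin (top_of_set (\<phi> ` U)) (\<phi> ` (U \<inter> W))"
    by (rule homeomorphism_imp_open_map[OF chartD(4)[OF assms(1)]])
      (use assms(2) in \<open>auto simp: openin_open_Int\<close>)
  then show ?thesis using chartD(2)[OF assms(1)] openin_open_eq by blast
qed

lemma smooth_transition:
  assumes "(U, \<phi>) \<in> A" "(V, \<psi>) \<in> A"
  shows "smooth_on (\<phi> ` (U \<inter> V)) (\<lambda>x. transition (U, \<phi>) (V, \<psi>) x $ i)"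
proof -
  have "\<forall>c\<in>A. \<forall>d\<in>A. \<forall>i. smooth_on (snd c ` (fst c \<inter> fst d)) (\<lambda>x. transition c d x $ i)"
    using atlas unfolding smooth_atlas_def by blast
  from this[rule_format, OF assms, of i] show ?thesis by simp
qed

lemma smooth_fun_on_chart:
  "smooth_fun_on A W h \<Longrightarrow> (U, \<phi>) \<in> A \<Longrightarrow> smooth_on (\<phi> ` (U \<inter> W)) (h \<circ> inv_into U \<phi>)"
  unfolding smooth_fun_on_def by blast

lemma smooth_fun_onI:
  "(\<And>U \<phi>. (U, \<phi>) \<in> A \<Longrightarrow> smooth_on (\<phi> ` (U \<inter> W)) (h \<circ> inv_into U \<phi>)) \<Longrightarrow> smooth_fun_on A W h"
  unfolding smooth_fun_on_def by blast

lemma smooth_fun_on_subset: "smooth_fun_on A W h \<Longrightarrow> V \<subseteq> W \<Longrightarrow> smooth_fun_on A V h"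
  unfolding smooth_fun_on_def smooth_on_def by (fast elim: Ck_on_subset)

lemma smooth_at_eventually:
  assumes "smooth_at A p h"
  shows "\<forall>\<^sub>F q in nhds p. smooth_at A q h"
  using assms unfolding smooth_at_def eventually_nhds by blast

lemma smooth_at_lift2:
  assumes "smooth_at A p h" "smooth_at A p k"
    and "\<And>n O' a b. open O' \<Longrightarrow> Ck_on n O' a \<Longrightarrow> Ck_on n O' b \<Longrightarrow> Ck_on n O' (\<lambda>x. F (a x) (b x))"
  shows "smooth_at A p (\<lambda>q. F (h q) (k q))"
proof -
  obtain V W where V: "open V" "p \<in> V" "smooth_fun_on A V h" and W: "open W" "p \<in> W" "smooth_fun_on A W k"
    using assms(1,2) unfolding smooth_at_def by auto
  have "smooth_fun_on A (V \<inter> W) (\<lambda>q. F (h q) (k q))"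
  proof (rule smooth_fun_onI)
    fix U \<phi> assume c: "(U, \<phi>) \<in> A"
    have "open (\<phi> ` (U \<inter> (V \<inter> W)))" using V W by (intro open_chart_image c) auto
    then show "smooth_on (\<phi> ` (U \<inter> (V \<inter> W))) ((\<lambda>q. F (h q) (k q)) \<circ> inv_into U \<phi>)"
      using smooth_fun_on_chart[OF smooth_fun_on_subset[OF V(3)] c, of "V \<inter> W"]
        smooth_fun_on_chart[OF smooth_fun_on_subset[OF W(3)] c, of "V \<inter> W"] assms(3)
      unfolding smooth_on_def o_def by blast
  qed
  then show ?thesis using V W unfolding smooth_at_def by (meson IntI open_Int)
qed

lemma smooth_at_add: "smooth_at A p h \<Longrightarrow> smooth_at A p k \<Longrightarrow> smooth_at A p (\<lambda>q. h q + k q)"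
  using smooth_at_lift2[of p h k "(+)"] Ck_on_add by blast

lemma smooth_at_mult: "smooth_at A p h \<Longrightarrow> smooth_at A p k \<Longrightarrow> smooth_at A p (\<lambda>q. h q * k q)"
  using smooth_at_lift2[of p h k "(*)"] Ck_on_mult by blast

lemma smooth_at_exp: "smooth_at A p h \<Longrightarrow> smooth_at A p (\<lambda>q. exp (h q))"
  using smooth_at_lift2[of p h h "\<lambda>a b. exp a"] Ck_on_exp by blast

lemma smooth_at_const: "smooth_at A p (\<lambda>q. c)"
  unfolding smooth_at_def smooth_fun_on_def smooth_on_def o_def using Ck_on_const open_UNIV by blast

lemma smooth_at_cmult: "smooth_at A p h \<Longrightarrow> smooth_at A p (\<lambda>q. c * h q)"
  by (intro smooth_at_mult smooth_at_const)

lemma smooth_at_minus: "smooth_at A p h \<Longrightarrow> smooth_at A p (\<lambda>q. - h q)"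
  using smooth_at_cmult[of p h "-1"] by simp

lemma smooth_at_diff: "smooth_at A p h \<Longrightarrow> smooth_at A p k \<Longrightarrow> smooth_at A p (\<lambda>q. h q - k q)"
  using smooth_at_add[OF _ smooth_at_minus] by simp

lemma smooth_at_sum: "(\<And>i. i \<in> I \<Longrightarrow> smooth_at A p (h i)) \<Longrightarrow> smooth_at A p (\<lambda>q. \<Sum>i\<in>I. h i q)"
  by (induction I rule: infinite_finite_induct) (auto intro: smooth_at_const smooth_at_add)

lemma smooth_at_cong:
  assumes "\<forall>\<^sub>F q in nhds p. h q = k q" "smooth_at A p h"
  shows "smooth_at A p k"
proof -
  obtain V where V: "open V" "p \<in> V" "\<And>q. q \<in> V \<Longrightarrow> h q = k q"
    using assms(1) unfolding eventually_nhds by blast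
  obtain W where W: "open W" "p \<in> W" "smooth_fun_on A W h"
    using assms(2) unfolding smooth_at_def by auto
  have "smooth_fun_on A (V \<inter> W) k"
  proof (rule smooth_fun_onI)
    fix U \<phi> assume c: "(U, \<phi>) \<in> A"
    have o: "open (\<phi> ` (U \<inter> (V \<inter> W)))" using V W by (intro open_chart_image c) auto
    show "smooth_on (\<phi> ` (U \<inter> (V \<inter> W))) (k \<circ> inv_into U \<phi>)"
    proof (rule smooth_on_cong[OF o])
      show "smooth_on (\<phi> ` (U \<inter> (V \<inter> W))) (h \<circ> inv_into U \<phi>)"
        by (rule smooth_fun_on_chart[OF smooth_fun_on_subset[OF W(3)] c]) auto
      show "(h \<circ> inv_into U \<phi>) x = (k \<circ> inv_into U \<phi>) x" if "x \<in> \<phi> ` (U \<inter> (V \<inter> W))" for x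
        using that V(3) chartD(3)[OF c] by (auto simp: inv_into_f_f)
    qed
  qed
  then show ?thesis using V W unfolding smooth_at_def by (meson IntI open_Int)
qed

lemma smooth_at_powr:
  assumes "smooth_at A p h" "\<forall>\<^sub>F q in nhds p. h q > 0"
  shows "smooth_at A p (\<lambda>q. h q powr a)"
proof -
  obtain V where V: "open V" "p \<in> V" "\<And>q. q \<in> V \<Longrightarrow> h q > 0"
    using assms(2) unfolding eventually_nhds by blast
  obtain W where W: "open W" "p \<in> W" "smooth_fun_on A W h"
    using assms(1) unfolding smooth_at_def by auto
  have "smooth_fun_on A (V \<inter> W) (\<lambda>q. h q powr a)"
  proof (rule smooth_fun_onI)
    fix U \<phi> assume c: "(U, \<phi>) \<in> A"
    have o: "open (\<phi> ` (U \<inter> (V \<inter> W)))" using V W by (intro open_chart_image c) auto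
    have "smooth_on (\<phi> ` (U \<inter> (V \<inter> W))) (\<lambda>x. (h \<circ> inv_into U \<phi>) x powr a)"
    proof (rule smooth_on_powr[OF o])
      show "smooth_on (\<phi> ` (U \<inter> (V \<inter> W))) (h \<circ> inv_into U \<phi>)"
        by (rule smooth_fun_on_chart[OF smooth_fun_on_subset[OF W(3)] c]) auto
      show "(h \<circ> inv_into U \<phi>) x > 0" if "x \<in> \<phi> ` (U \<inter> (V \<inter> W))" for x
        using that V(3) chartD(3)[OF c] by (auto simp: inv_into_f_f)
    qed
    then show "smooth_on (\<phi> ` (U \<inter> (V \<inter> W))) ((\<lambda>q. h q powr a) \<circ> inv_into U \<phi>)"
      by (simp add: o_def)
  qed
  then show ?thesis using V W unfolding smooth_at_def by (meson IntI open_Int)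
qed

text \<open>Smoothness may be tested in a single chart, since the transition maps are smooth.\<close>

lemma smooth_atI_chart:
  assumes c: "(U, \<phi>) \<in> A" and p: "p \<in> U"
    and O': "open O'" "\<phi> p \<in> O'" and sm: "smooth_on O' (h \<circ> inv_into U \<phi>)"
  shows "smooth_at A p h"
proof -
  define W where "W = U \<inter> \<phi> -` O'"
  have W: "open W" "p \<in> W"
    using continuous_open_preimage[OF homeomorphism_cont1[OF chartD(4)[OF c]] chartD(1)[OF c] O'(1)] p O'(2)
    by (auto simp: W_def)
  have "smooth_fun_on A W h"
  proof (rule smooth_fun_onI)
    fix V \<psi> assume d: "(V, \<psi>) \<in> A"
    let ?N = "\<psi> ` (V \<inter> W)" and ?t = "transition (V, \<psi>) (U, \<phi>)"
    have N: "open ?N" by (rule open_chart_image[OF d W(1)])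
    have t: "?t (\<psi> q) = \<phi> q" if "q \<in> V" for q
      using that chartD(3)[OF d] by (simp add: transition_def inv_into_f_f)
    have eq: "((h \<circ> inv_into U \<phi>) \<circ> ?t) x = (h \<circ> inv_into V \<psi>) x" if x: "x \<in> ?N" for x
    proof -
      obtain q where q: "q \<in> V" "q \<in> U" "x = \<psi> q" using x by (auto simp: W_def)
      then show ?thesis using t chartD(3)[OF c] chartD(3)[OF d] by (simp add: inv_into_f_f)
    qed
    have sub: "?t ` ?N \<subseteq> O'"
    proof
      fix y assume "y \<in> ?t ` ?N"
      then obtain q where "q \<in> V" "q \<in> W" "y = ?t (\<psi> q)" by blast
      then show "y \<in> O'" using t by (simp add: W_def)
    qed
    have "Ck_on k ?N ((h \<circ> inv_into U \<phi>) \<circ> ?t)" for k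
    proof (rule Ck_on_compose[OF N sub])
      show "Ck_on k ?N (\<lambda>x. ?t x $ j)" for j
        using smooth_transition[OF d c, of j] unfolding smooth_on_def
        by (auto simp: W_def intro: Ck_on_subset)
      show "Ck_on k O' (h \<circ> inv_into U \<phi>)" using sm by (simp add: smooth_on_def)
    qed
    then have "smooth_on ?N ((h \<circ> inv_into U \<phi>) \<circ> ?t)" by (simp add: smooth_on_def)
    then show "smooth_on ?N (h \<circ> inv_into V \<psi>)" by (rule smooth_on_cong[OF N]) (rule eq)
  qed
  with W show ?thesis unfolding smooth_at_def by blast
qed

lemma smooth_at_chartE:
  assumes "(U, \<phi>) \<in> A" "p \<in> U" "smooth_at A p h"
  obtains O' where "open O'" "\<phi> p \<in> O'" "O' \<subseteq> \<phi> ` U" "smooth_on O' (h \<circ> inv_into U \<phi>)"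
proof -
  obtain W where W: "open W" "p \<in> W" "smooth_fun_on A W h"
    using assms(3) unfolding smooth_at_def by auto
  show ?thesis
    by (rule that[of "\<phi> ` (U \<inter> W)"])
      (use W assms(2) open_chart_image[OF assms(1)] smooth_fun_on_chart[OF W(3) assms(1)] in auto)
qed

lemma smooth_at_coordinate:
  assumes "(U, \<phi>) \<in> A" "p \<in> U"
  shows "smooth_at A p (\<lambda>q. \<phi> q $ j)"
  unfolding smooth_at_def
proof (intro exI conjI smooth_fun_onI)
  show "open U" "p \<in> U" using chartD(1)[OF assms(1)] assms(2) by auto
  show "smooth_on (\<psi> ` (V \<inter> U)) ((\<lambda>q. \<phi> q $ j) \<circ> inv_into V \<psi>)" if "(V, \<psi>) \<in> A" for V \<psi>
    using smooth_transition[OF that assms(1), of j] by (simp add: transition_def o_def)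
qed

lemma tangent_add: "v \<in> tangent_space A p \<Longrightarrow> smooth_at A p h \<Longrightarrow> smooth_at A p k \<Longrightarrow>
    v (\<lambda>q. h q + k q) = v h + v k"
  and tangent_mult: "v \<in> tangent_space A p \<Longrightarrow> smooth_at A p h \<Longrightarrow> smooth_at A p k \<Longrightarrow>
    v (\<lambda>q. h q * k q) = v h * k p + h p * v k"
  and tangent_scale: "v \<in> tangent_space A p \<Longrightarrow> smooth_at A p h \<Longrightarrow> v (\<lambda>q. c * h q) = c * v h"
  and tangent_not_smooth: "v \<in> tangent_space A p \<Longrightarrow> \<not> smooth_at A p h \<Longrightarrow> v h = 0"
  unfolding tangent_space_def by blast+

lemma tangentI:
  assumes "\<And>h. \<not> smooth_at A p h \<Longrightarrow> v h = 0"
    and "\<And>h k. smooth_at A p h \<Longrightarrow> smooth_at A p k \<Longrightarrow> v (\<lambda>q. h q + k q) = v h + v k"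
    and "\<And>h k. smooth_at A p h \<Longrightarrow> smooth_at A p k \<Longrightarrow> v (\<lambda>q. h q * k q) = v h * k p + h p * v k"
    and "\<And>c h. smooth_at A p h \<Longrightarrow> v (\<lambda>q. c * h q) = c * v h"
  shows "v \<in> tangent_space A p"
  unfolding tangent_space_def using assms by blast

lemma tangent_const: 
  assumes "v \<in> tangent_space A p"
  shows "v (\<lambda>q. c) = 0"
proof -
  have "v (\<lambda>q. 1) = 0"
    using tangent_mult[OF assms smooth_at_const smooth_at_const, of 1 1] by simp
  then show ?thesis using tangent_scale[OF assms smooth_at_const, of c 1] by simp
qed

lemma tangent_minus: "v \<in> tangent_space A p \<Longrightarrow> smooth_at A p h \<Longrightarrow> v (\<lambda>q. - h q) = - v h"
  using tangent_scale[of v p h "-1"] by simp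

lemma tangent_diff: "v \<in> tangent_space A p \<Longrightarrow> smooth_at A p h \<Longrightarrow> smooth_at A p k \<Longrightarrow>
    v (\<lambda>q. h q - k q) = v h - v k"
  using tangent_add[OF _ _ smooth_at_minus, of v p h k] by (simp add: tangent_minus)

lemma tangent_sum:
  assumes "v \<in> tangent_space A p" "\<And>i. i \<in> I \<Longrightarrow> smooth_at A p (h i)"
  shows "v (\<lambda>q. \<Sum>i\<in>I. h i q) = (\<Sum>i\<in>I. v (h i))"
  using assms(2)
  by (induction I rule: infinite_finite_induct)
    (auto simp: tangent_const[OF assms(1)] tangent_add[OF assms(1)] smooth_at_sum)

text \<open>A difference \<open>d\<close> vanishing near \<open>p\<close> equals \<open>d * u\<close> for the indicator \<open>u\<close> of the set where
  it is not zero; \<open>u\<close> vanishes near \<open>p\<close> too, so the Leibniz rule kills \<open>v d\<close>.\<close>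

lemma tangent_cong:
  assumes v: "v \<in> tangent_space A p" and eq: "\<forall>\<^sub>F q in nhds p. h q = k q"
  shows "v h = v k"
proof (cases "smooth_at A p h")
  case True
  then have k: "smooth_at A p k" by (rule smooth_at_cong[OF eq])
  define d where "d q = h q - k q" for q
  define u where "u q = (if h q = k q then 0 else 1 :: real)" for q
  have d: "smooth_at A p d" unfolding d_def by (intro smooth_at_diff True k)
  have "\<forall>\<^sub>F q in nhds p. 0 = u q" using eq by eventually_elim (simp add: u_def)
  then have u: "smooth_at A p u" by (rule smooth_at_cong) (rule smooth_at_const)
  have p: "h p = k p" using eq by (rule eventually_nhds_x_imp_x)
  have "v d = v (\<lambda>q. d q * u q)" by (rule arg_cong[of _ _ v]) (auto simp: d_def u_def)
  also have "\<dots> = 0" using tangent_mult[OF v d u] p by (simp add: d_def u_def)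
  finally show ?thesis unfolding d_def using tangent_diff[OF v True k] by simp
next
  case False
  then have "\<not> smooth_at A p k"
    using smooth_at_cong[of k h p] eq by (auto simp: eq_commute)
  with False show ?thesis using tangent_not_smooth[OF v] by simp
qed

lemma subspace_tangent: "subspace (tangent_space A p)"
proof (rule subspaceI)
  show "0 \<in> tangent_space A p" by (rule tangentI) auto
  show "u + v \<in> tangent_space A p" if "u \<in> tangent_space A p" "v \<in> tangent_space A p" for u v
    by (rule tangentI) (simp_all add: tangent_not_smooth[OF that(1)] tangent_not_smooth[OF that(2)]
        tangent_add[OF that(1)] tangent_add[OF that(2)] tangent_mult[OF that(1)] tangent_mult[OF that(2)]
        tangent_scale[OF that(1)] tangent_scale[OF that(2)] algebra_simps)
  show "c *\<^sub>R v \<in> tangent_space A p" if "v \<in> tangent_space A p" for c v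
    by (rule tangentI) (simp_all add: tangent_not_smooth[OF that]
        tangent_add[OF that] tangent_mult[OF that] tangent_scale[OF that] algebra_simps)
qed

lemmas tangent_closed = subspace_add[OF subspace_tangent] subspace_scale[OF subspace_tangent]
  subspace_diff[OF subspace_tangent] subspace_neg[OF subspace_tangent] subspace_sum[OF subspace_tangent]
  subspace_0[OF subspace_tangent]

lemma vfield_at_iff: "vfield_at A p X \<longleftrightarrow> (\<forall>\<^sub>F q in nhds p. X q \<in> tangent_space A q \<and>
    (\<forall>h. smooth_at A q h \<longrightarrow> smooth_at A q (\<lambda>r. X r h)))"
  unfolding vfield_at_def eventually_nhds by blast

lemma vfield_tangent: "vfield_at A p X \<Longrightarrow> X p \<in> tangent_space A p"
  and vfield_smooth: "vfield_at A p X \<Longrightarrow> smooth_at A p h \<Longrightarrow> smooth_at A p (\<lambda>q. X q h)"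
  unfolding vfield_at_iff by (auto dest: eventually_nhds_x_imp_x)

lemma vfield_eventually: "vfield_at A p X \<Longrightarrow> \<forall>\<^sub>F q in nhds p. vfield_at A q X"
  unfolding vfield_at_def eventually_nhds by blast

lemma vfield_cong:
  assumes "\<forall>\<^sub>F q in nhds p. X q = Y q" "vfield_at A p X"
  shows "vfield_at A p Y"
proof -
  have "\<forall>\<^sub>F q in nhds p. \<forall>\<^sub>F r in nhds q. X r = Y r" using assms(1) by (simp add: eventually_eventually)
  with assms(1) assms(2)[unfolded vfield_at_iff] show ?thesis unfolding vfield_at_iff
  proof eventually_elim
    case (elim q)
    have "smooth_at A q (\<lambda>r. Y r h)" if "smooth_at A q h" for h
      by (rule smooth_at_cong[of "\<lambda>r. X r h"]) (use elim that in \<open>auto elim: eventually_mono\<close>)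
    then show ?case using elim by simp
  qed
qed

lemma vfield_add:
  assumes "vfield_at A p X" "vfield_at A p Y"
  shows "vfield_at A p (\<lambda>q. X q + Y q)"
  using assms unfolding vfield_at_iff
  by eventually_elim (simp add: tangent_closed(1) smooth_at_add)

lemma vfield_scale:
  assumes "smooth_at A p k" "vfield_at A p X"
  shows "vfield_at A p (\<lambda>q. k q *\<^sub>R X q)"
  using smooth_at_eventually[OF assms(1)] assms(2) unfolding vfield_at_iff
  by eventually_elim (simp add: tangent_closed(2) smooth_at_mult)

lemma vfield_cscale: "vfield_at A p X \<Longrightarrow> vfield_at A p (\<lambda>q. c *\<^sub>R X q)"
  using vfield_scale[OF smooth_at_const] by blast

lemma vfield_diff: "vfield_at A p X \<Longrightarrow> vfield_at A p Y \<Longrightarrow> vfield_at A p (\<lambda>q. X q - Y q)"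
  using vfield_add[OF _ vfield_cscale[of p Y "-1"]] by simp

lemma vfield_zero: "vfield_at A p (\<lambda>q. 0)"
  unfolding vfield_at_iff by (intro always_eventually) (simp add: tangent_closed(6) smooth_at_const)

lemma vfield_sum: "(\<And>i. i \<in> I \<Longrightarrow> vfield_at A p (X i)) \<Longrightarrow> vfield_at A p (\<lambda>q. \<Sum>i\<in>I. X i q)"
  by (induction I rule: infinite_finite_induct) (auto intro: vfield_zero vfield_add)

lemma lie_bracket_smooth:
  "smooth_at A p h \<Longrightarrow> lie_bracket A X Y p h = X p (\<lambda>q. Y q h) - Y p (\<lambda>q. X q h)"
  by (simp add: lie_bracket_def)

lemma vfield_eq_on_smooth:
  assumes "vfield_at A p X" "\<And>q. smooth_at A q h \<Longrightarrow> smooth_at A q k \<Longrightarrow> X q \<in> tangent_space A q \<Longrightarrow> F q = G q"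
    "smooth_at A p h" "smooth_at A p k"
  shows "\<forall>\<^sub>F q in nhds p. F q = G q"
  using vfield_eventually[OF assms(1)] smooth_at_eventually[OF assms(3)] smooth_at_eventually[OF assms(4)]
  by eventually_elim (simp add: assms(2) vfield_tangent)

lemma vfield_lie_bracket:
  assumes "vfield_at A p X" "vfield_at A p Y"
  shows "vfield_at A p (lie_bracket A X Y)"
  unfolding vfield_at_iff using vfield_eventually[OF assms(1)] vfield_eventually[OF assms(2)]
proof eventually_elim
  case (elim q)
  note X = elim(1) and Y = elim(2)
  note tX = vfield_tangent[OF X] and tY = vfield_tangent[OF Y]
  have "lie_bracket A X Y q \<in> tangent_space A q"
  proof (rule tangentI)
    fix h k c assume h: "smooth_at A q h"
    have *: "X q (\<lambda>r. Y r (\<lambda>s. c * h s)) = c * X q (\<lambda>r. Y r h)" if "vfield_at A q X" "vfield_at A q Y" for X Y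
    proof -
      have "\<forall>\<^sub>F r in nhds q. Y r (\<lambda>s. c * h s) = c * Y r h"
        by (rule vfield_eq_on_smooth[OF that(2) _ h h]) (rule tangent_scale)
      from tangent_cong[OF vfield_tangent[OF that(1)] this] show ?thesis
        by (simp add: tangent_scale[OF vfield_tangent[OF that(1)] vfield_smooth[OF that(2) h]])
    qed
    show "lie_bracket A X Y q (\<lambda>s. c * h s) = c * lie_bracket A X Y q h"
      by (simp add: lie_bracket_smooth h smooth_at_cmult *[OF X Y] *[OF Y X] algebra_simps)
    assume k: "smooth_at A q k"
    have *: "X q (\<lambda>r. Y r (\<lambda>s. h s + k s)) = X q (\<lambda>r. Y r h) + X q (\<lambda>r. Y r k)"
      if "vfield_at A q X" "vfield_at A q Y" for X Y
    proof -
      have "\<forall>\<^sub>F r in nhds q. Y r (\<lambda>s. h s + k s) = Y r h + Y r k"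
        by (rule vfield_eq_on_smooth[OF that(2) _ h k]) (rule tangent_add)
      from tangent_cong[OF vfield_tangent[OF that(1)] this] show ?thesis
        by (simp add: tangent_add[OF vfield_tangent[OF that(1)] vfield_smooth[OF that(2) h] vfield_smooth[OF that(2) k]])
    qed
    show "lie_bracket A X Y q (\<lambda>s. h s + k s) = lie_bracket A X Y q h + lie_bracket A X Y q k"
      by (simp add: lie_bracket_smooth h k smooth_at_add *[OF X Y] *[OF Y X])
    have *: "X q (\<lambda>r. Y r (\<lambda>s. h s * k s)) =
        X q (\<lambda>r. Y r h) * k q + Y q h * X q k + (X q h * Y q k + h q * X q (\<lambda>r. Y r k))"
      if "vfield_at A q X" "vfield_at A q Y" for X Y
    proof -
      have "\<forall>\<^sub>F r in nhds q. Y r (\<lambda>s. h s * k s) = Y r h * k r + h r * Y r k"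
        by (rule vfield_eq_on_smooth[OF that(2) _ h k]) (rule tangent_mult)
      from tangent_cong[OF vfield_tangent[OF that(1)] this] show ?thesis
        using vfield_smooth[OF that(2) h] vfield_smooth[OF that(2) k] h k
        by (simp add: tangent_add[OF vfield_tangent[OF that(1)]] tangent_mult[OF vfield_tangent[OF that(1)]]
            smooth_at_mult)
    qed
    show "lie_bracket A X Y q (\<lambda>s. h s * k s) = lie_bracket A X Y q h * k q + h q * lie_bracket A X Y q k"
      by (simp add: lie_bracket_smooth h k smooth_at_mult *[OF X Y] *[OF Y X] algebra_simps)
  qed (simp add: lie_bracket_def)
  moreover have "smooth_at A q (\<lambda>r. lie_bracket A X Y r h)" if h: "smooth_at A q h" for h
  proof (rule smooth_at_cong)
    show "smooth_at A q (\<lambda>r. X r (\<lambda>s. Y s h) - Y r (\<lambda>s. X s h))"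
      by (rule smooth_at_diff[OF vfield_smooth[OF X vfield_smooth[OF Y h]] vfield_smooth[OF Y vfield_smooth[OF X h]]])
    show "\<forall>\<^sub>F r in nhds q. X r (\<lambda>s. Y s h) - Y r (\<lambda>s. X s h) = lie_bracket A X Y r h"
      using smooth_at_eventually[OF h] by eventually_elim (simp add: lie_bracket_smooth)
  qed
  ultimately show ?case by blast
qed

text \<open>Like every tangent vector, a coordinate vector is set to zero on the functions that are not smooth at \<open>q\<close>.\<close>

definition coord_vec :: "'a chart \<Rightarrow> 3 \<Rightarrow> 'a vfield"
  where "coord_vec c i q h =
    (if smooth_at A q h then partial_deriv i (h \<circ> inv_into (fst c) (snd c)) (snd c q) else 0)"

lemma coord_vec_tangent:
  assumes c: "(U, \<phi>) \<in> A" and q: "q \<in> U"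
  shows "coord_vec (U, \<phi>) i q \<in> tangent_space A q"
proof -
  have inv: "inv_into U \<phi> (\<phi> q) = q" using chartD(3)[OF c] q by (simp add: inv_into_f_f)
  have d: "((h \<circ> inv_into U \<phi>) has_derivative frechet_derivative (h \<circ> inv_into U \<phi>) (at (\<phi> q))) (at (\<phi> q))"
    if h: "smooth_at A q h" for h
  proof -
    obtain O' where "open O'" "\<phi> q \<in> O'" "O' \<subseteq> \<phi> ` U" "smooth_on O' (h \<circ> inv_into U \<phi>)"
      by (rule smooth_at_chartE[OF c q h])
    then show ?thesis using smooth_on_differentiable by (simp add: frechet_derivative_works)
  qed
  show ?thesis
  proof (rule tangentI)
    fix h k c' assume h: "smooth_at A q h"
    show "coord_vec (U, \<phi>) i q (\<lambda>r. c' * h r) = c' * coord_vec (U, \<phi>) i q h"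
      using partial_deriv_eq[OF has_derivative_mult_right[OF d[OF h], of c'], of i]
      by (simp add: coord_vec_def h smooth_at_cmult o_def flip: partial_deriv_def)
    assume k: "smooth_at A q k"
    show "coord_vec (U, \<phi>) i q (\<lambda>r. h r + k r) = coord_vec (U, \<phi>) i q h + coord_vec (U, \<phi>) i q k"
      using partial_deriv_eq[OF has_derivative_add[OF d[OF h] d[OF k]], of i]
      by (simp add: coord_vec_def h k smooth_at_add o_def flip: partial_deriv_def)
    show "coord_vec (U, \<phi>) i q (\<lambda>r. h r * k r) = coord_vec (U, \<phi>) i q h * k q + h q * coord_vec (U, \<phi>) i q k"
      using partial_deriv_eq[OF has_derivative_mult[OF d[OF h] d[OF k]], of i]
      by (simp add: coord_vec_def h k smooth_at_mult o_def inv flip: partial_deriv_def)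
  qed (simp add: coord_vec_def)
qed

lemma coord_vec_smooth:
  assumes c: "(U, \<phi>) \<in> A" and q: "q \<in> U" and h: "smooth_at A q h"
  shows "smooth_at A q (\<lambda>r. coord_vec (U, \<phi>) i r h)"
proof (rule smooth_at_cong)
  let ?k = "\<lambda>r. partial_deriv i (h \<circ> inv_into U \<phi>) (\<phi> r)"
  show "\<forall>\<^sub>F r in nhds q. ?k r = coord_vec (U, \<phi>) i r h"
    using smooth_at_eventually[OF h] by eventually_elim (simp add: coord_vec_def)
  obtain O' where O': "open O'" "\<phi> q \<in> O'" "O' \<subseteq> \<phi> ` U" "smooth_on O' (h \<circ> inv_into U \<phi>)"
    by (rule smooth_at_chartE[OF c q h])
  have eq: "partial_deriv i (h \<circ> inv_into U \<phi>) x = (?k \<circ> inv_into U \<phi>) x" if "x \<in> O'" for x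
    using that O'(3) by (auto simp: f_inv_into_f)
  show "smooth_at A q ?k"
    by (rule smooth_atI_chart[OF c q O'(1,2)], rule smooth_on_cong[OF O'(1) smooth_on_partial_deriv[OF O'(4)]], rule eq)
qed

lemma vfield_coord_vec:
  assumes "(U, \<phi>) \<in> A" "p \<in> U"
  shows "vfield_at A p (coord_vec (U, \<phi>) i)"
  unfolding vfield_at_def
  by (intro exI[of _ U] conjI ballI allI impI chartD(1)[OF assms(1)] assms(2)
      coord_vec_tangent[OF assms(1)] coord_vec_smooth[OF assms(1)])

lemma coord_vec_coordinate:
  assumes c: "(U, \<phi>) \<in> A" and p: "p \<in> U"
  shows "coord_vec (U, \<phi>) i p (\<lambda>q. \<phi> q $ j) = (if i = j then 1 else 0)"
proof -
  have "partial_deriv i ((\<lambda>q. \<phi> q $ j) \<circ> inv_into U \<phi>) (\<phi> p) = partial_deriv i (\<lambda>x. x $ j) (\<phi> p)"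
    by (rule partial_deriv_cong[OF chartD(2)[OF c]]) (use p in \<open>auto simp: f_inv_into_f\<close>)
  also have "\<dots> = axis i 1 $ j"
    by (rule partial_deriv_eq, rule bounded_linear.has_derivative[OF bounded_linear_vec_nth]) simp
  finally show ?thesis using smooth_at_coordinate[OF c p] by (simp add: coord_vec_def axis_def)
qed

text \<open>By Hadamard's lemma a smooth function differs from its value at \<open>p\<close> by a combination of the
  centred coordinates with smooth coefficients, so a derivation at \<open>p\<close> is determined by its values on
  the coordinates.\<close>

lemma tangent_coord_expansion:
  assumes c: "(U, \<phi>) \<in> A" and p: "p \<in> U" and v: "v \<in> tangent_space A p"
  shows "v = (\<Sum>i\<in>UNIV. v (\<lambda>q. \<phi> q $ i) *\<^sub>R coord_vec (U, \<phi>) i p)"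
proof
  fix h
  show "v h = (\<Sum>i\<in>UNIV. v (\<lambda>q. \<phi> q $ i) *\<^sub>R coord_vec (U, \<phi>) i p) h"
  proof (cases "smooth_at A p h")
    case h: True
    obtain O' where O': "open O'" "\<phi> p \<in> O'" "O' \<subseteq> \<phi> ` U" "smooth_on O' (h \<circ> inv_into U \<phi>)"
      by (rule smooth_at_chartE[OF c p h])
    obtain r where r: "r > 0" "ball (\<phi> p) r \<subseteq> O'" using O' open_contains_ball by blast
    let ?B = "ball (\<phi> p) r" and ?H = "h \<circ> inv_into U \<phi>"
    have "smooth_on ?B ?H" using O'(4) r(2) Ck_on_subset unfolding smooth_on_def by blast
    then obtain G where G: "\<And>j. smooth_on ?B (G j)" "\<And>j. G j (\<phi> p) = partial_deriv j ?H (\<phi> p)"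
      "\<And>x. x \<in> ?B \<Longrightarrow> ?H x = ?H (\<phi> p) + (\<Sum>j\<in>UNIV. (x $ j - \<phi> p $ j) * G j x)"
      by (rule hadamard) (rule that)
    have Gs: "smooth_at A p (\<lambda>q. G j (\<phi> q))" for j
    proof (rule smooth_atI_chart[OF c p])
      have eq: "G j x = ((\<lambda>q. G j (\<phi> q)) \<circ> inv_into U \<phi>) x" if "x \<in> ?B" for x
        using that O'(3) r(2) by (auto simp: f_inv_into_f subset_iff)
      show "smooth_on ?B ((\<lambda>q. G j (\<phi> q)) \<circ> inv_into U \<phi>)"
        by (rule smooth_on_cong[OF open_ball G(1)]) (rule eq)
    qed (use r in auto)
    have cs: "smooth_at A p (\<lambda>q. \<phi> q $ j - \<phi> p $ j)" for j
      by (intro smooth_at_diff smooth_at_coordinate[OF c p] smooth_at_const)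
    have inv: "inv_into U \<phi> (\<phi> q) = q" if "q \<in> U" for q using chartD(3)[OF c] that by (simp add: inv_into_f_f)
    have "open (U \<inter> \<phi> -` ?B)"
      by (rule continuous_open_preimage[OF homeomorphism_cont1[OF chartD(4)[OF c]] chartD(1)[OF c] open_ball])
    then have "\<forall>\<^sub>F q in nhds p. q \<in> U \<and> \<phi> q \<in> ?B" unfolding eventually_nhds using p r(1) by (intro exI) auto
    then have "\<forall>\<^sub>F q in nhds p. h q = h p + (\<Sum>j\<in>UNIV. (\<phi> q $ j - \<phi> p $ j) * G j (\<phi> q))"
    proof eventually_elim
      case (elim q)
      then show ?case using G(3)[of "\<phi> q"] inv[of q] inv[OF p] by simp
    qed
    then have "v h = v (\<lambda>q. h p + (\<Sum>j\<in>UNIV. (\<phi> q $ j - \<phi> p $ j) * G j (\<phi> q)))"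
      by (rule tangent_cong[OF v])
    also have "\<dots> = (\<Sum>j\<in>UNIV. v (\<lambda>q. \<phi> q $ j) * G j (\<phi> p))"
      using cs Gs smooth_at_coordinate[OF c p]
      by (simp add: tangent_add[OF v] tangent_sum[OF v] tangent_mult[OF v] tangent_diff[OF v]
          tangent_const[OF v] smooth_at_sum smooth_at_mult smooth_at_const)
    finally show ?thesis by (simp add: sum_fun_apply coord_vec_def h G(2))
  next
    case False
    then show ?thesis by (simp add: tangent_not_smooth[OF v] sum_fun_apply coord_vec_def)
  qed
qed

lemma ex_extension:
  assumes "v \<in> tangent_space A p"
  obtains X where "extends_vec A p X v"
proof -
  obtain U \<phi> where c: "(U, \<phi>) \<in> A" "p \<in> U" by (rule ex_chart)
  let ?X = "\<lambda>q. \<Sum>i\<in>UNIV. v (\<lambda>q. \<phi> q $ i) *\<^sub>R coord_vec (U, \<phi>) i q"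
  have "vfield_at A p ?X" by (intro vfield_sum vfield_cscale vfield_coord_vec c)
  moreover have "?X p = v" using tangent_coord_expansion[OF c assms] by simp
  ultimately show ?thesis using that[of ?X] unfolding extends_vec_def by blast
qed

lemma tangent_independent_bound:
  assumes "independent B" "B \<subseteq> tangent_space A p"
  shows "finite B \<and> card B \<le> 3"
proof -
  obtain U \<phi> where c: "(U, \<phi>) \<in> A" "p \<in> U" by (rule ex_chart)
  let ?C = "range (\<lambda>i. coord_vec (U, \<phi>) i p)"
  have "v \<in> span ?C" if "v \<in> tangent_space A p" for v
    by (subst tangent_coord_expansion[OF c that]) (intro span_sum span_scale span_base, auto)
  then have "finite B \<and> card B \<le> card ?C"
    using assms by (intro independent_span_bound) auto
  moreover have "card ?C \<le> 3" using card_image_le[of UNIV "\<lambda>i. coord_vec (U, \<phi>) i p"] by simp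
  ultimately show ?thesis by auto
qed

lemma lie_bracket_swap: "lie_bracket A X Y p = - lie_bracket A Y X p"
  by (rule ext) (simp add: lie_bracket_def)

lemma lie_bracket_add:
  assumes "vfield_at A p X" "vfield_at A p X'" "vfield_at A p Y"
  shows "lie_bracket A (\<lambda>q. X q + X' q) Y p = lie_bracket A X Y p + lie_bracket A X' Y p"
  using assms
  by (intro ext) (simp add: lie_bracket_def tangent_add[OF vfield_tangent[OF assms(3)]] vfield_smooth)

lemma lie_bracket_scale:
  assumes "smooth_at A p k" "vfield_at A p X" "vfield_at A p Y"
  shows "lie_bracket A (\<lambda>q. k q *\<^sub>R X q) Y p = k p *\<^sub>R lie_bracket A X Y p - Y p k *\<^sub>R X p"
  using assms
  by (intro ext) (simp add: lie_bracket_def tangent_mult[OF vfield_tangent[OF assms(3)]] vfield_smooth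
      tangent_not_smooth[OF vfield_tangent[OF assms(2)]] algebra_simps)

end

section \<open>Riemannian metrics and orthonormal frames\<close>

context smooth_manifold
begin

text \<open>Linearity is only asked on the tangent space, because the type of tangent vectors contains all functionals.\<close>

definition lin_at :: "'a \<Rightarrow> ('a tvec \<Rightarrow> 'b::real_vector) \<Rightarrow> bool"
  where "lin_at p L \<longleftrightarrow>
    (\<forall>u\<in>tangent_space A p. \<forall>v\<in>tangent_space A p. L (u + v) = L u + L v) \<and>
    (\<forall>c. \<forall>u\<in>tangent_space A p. L (c *\<^sub>R u) = c *\<^sub>R L u)"

lemma lin_at_add: "lin_at p L \<Longrightarrow> u \<in> tangent_space A p \<Longrightarrow> v \<in> tangent_space A p \<Longrightarrow> L (u + v) = L u + L v"
  and lin_at_scale: "lin_at p L \<Longrightarrow> u \<in> tangent_space A p \<Longrightarrow> L (c *\<^sub>R u) = c *\<^sub>R L u"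
  unfolding lin_at_def by blast+

lemma lin_at_sum:
  assumes "lin_at p L" "\<And>i. i \<in> I \<Longrightarrow> u i \<in> tangent_space A p"
  shows "L (\<Sum>i\<in>I. u i) = (\<Sum>i\<in>I. L (u i))"
proof -
  have "L 0 = 0" using lin_at_scale[OF assms(1) tangent_closed(6), of 0] by simp
  then show ?thesis using assms(2)
    by (induction I rule: infinite_finite_induct)
      (simp_all add: lin_at_add[OF assms(1)] tangent_closed(5))
qed

definition tensorial_at :: "'a \<Rightarrow> ('a vfield \<Rightarrow> 'b::real_vector) \<Rightarrow> bool"
  where "tensorial_at p L \<longleftrightarrow>
    (\<forall>X Y. vfield_at A p X \<and> vfield_at A p Y \<longrightarrow> L (\<lambda>q. X q + Y q) = L X + L Y) \<and>
    (\<forall>k X. smooth_at A p k \<and> vfield_at A p X \<longrightarrow> L (\<lambda>q. k q *\<^sub>R X q) = k p *\<^sub>R L X)"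

lemma tensorial_add: "tensorial_at p L \<Longrightarrow> vfield_at A p X \<Longrightarrow> vfield_at A p Y \<Longrightarrow>
    L (\<lambda>q. X q + Y q) = L X + L Y"
  and tensorial_scale: "tensorial_at p L \<Longrightarrow> smooth_at A p k \<Longrightarrow> vfield_at A p X \<Longrightarrow>
    L (\<lambda>q. k q *\<^sub>R X q) = k p *\<^sub>R L X"
  unfolding tensorial_at_def by blast+

lemma tensorial_atI:
  assumes "\<And>X Y. vfield_at A p X \<Longrightarrow> vfield_at A p Y \<Longrightarrow> L (\<lambda>q. X q + Y q) = L X + L Y"
    and "\<And>k X. smooth_at A p k \<Longrightarrow> vfield_at A p X \<Longrightarrow> L (\<lambda>q. k q *\<^sub>R X q) = k p *\<^sub>R L X"
  shows "tensorial_at p L"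
  unfolding tensorial_at_def using assms by blast

lemma tensorial_sum:
  assumes "tensorial_at p L" "\<And>i. i \<in> I \<Longrightarrow> vfield_at A p (X i)"
  shows "L (\<lambda>q. \<Sum>i\<in>I. X i q) = (\<Sum>i\<in>I. L (X i))"
proof -
  have "L (\<lambda>q. 0) = 0" using tensorial_scale[OF assms(1) smooth_at_const vfield_zero, of 0] by simp
  then show ?thesis using assms(2)
    by (induction I rule: infinite_finite_induct)
      (simp_all add: tensorial_add[OF assms(1)] vfield_sum)
qed

text \<open>Multiplying two fields by this function makes them equal everywhere without changing them near \<open>p\<close>;
  thus a Leibniz rule implies that an operator on fields is local.\<close>

lemma smooth_agreement_indicator:
  assumes "\<forall>\<^sub>F q in nhds p. X q = Y q"
  shows "smooth_at A p (\<lambda>q. if X q = Y q then 1 else 0)"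
proof (rule smooth_at_cong)
  show "\<forall>\<^sub>F q in nhds p. 1 = (if X q = Y q then 1 else 0::real)"
    using assms by eventually_elim simp
qed (rule smooth_at_const)

lemma tensorial_local:
  assumes L: "tensorial_at p L" and X: "vfield_at A p X" and eq: "\<forall>\<^sub>F q in nhds p. X q = Y q"
  shows "L X = L Y"
proof -
  let ?k = "\<lambda>q. if X q = Y q then 1 else 0 :: real"
  note k = smooth_agreement_indicator[OF eq] and Y = vfield_cong[OF eq X]
  have kp: "?k p = 1" using eventually_nhds_x_imp_x[OF eq] by simp
  have "(\<lambda>q. ?k q *\<^sub>R X q) = (\<lambda>q. ?k q *\<^sub>R Y q)" by (rule ext) simp
  then have "L (\<lambda>q. ?k q *\<^sub>R X q) = L (\<lambda>q. ?k q *\<^sub>R Y q)" by (rule arg_cong)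
  then show ?thesis
    unfolding tensorial_scale[OF L k X] tensorial_scale[OF L k Y] kp by simp
qed

end

locale riemannian_manifold = smooth_manifold A
  for A :: "'a::topological_space chart set" +
  fixes g :: "'a bform"
  assumes metric: "riemannian_metric A g"
begin

abbreviation T :: "'a \<Rightarrow> 'a tvec set" where "T \<equiv> tangent_space A"
abbreviation vf :: "'a \<Rightarrow> 'a vfield \<Rightarrow> bool" where "vf \<equiv> vfield_at A"
abbreviation lb :: "'a vfield \<Rightarrow> 'a vfield \<Rightarrow> 'a vfield" where "lb \<equiv> lie_bracket A"

lemma g_sym: "u \<in> T p \<Longrightarrow> v \<in> T p \<Longrightarrow> g p u v = g p v u"
  and g_add_left: "u \<in> T p \<Longrightarrow> v \<in> T p \<Longrightarrow> w \<in> T p \<Longrightarrow> g p (u + v) w = g p u w + g p v w"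
  and g_scale_left: "u \<in> T p \<Longrightarrow> v \<in> T p \<Longrightarrow> g p (c *\<^sub>R u) v = c * g p u v"
  and g_pos: "u \<in> T p \<Longrightarrow> u \<noteq> 0 \<Longrightarrow> g p u u > 0"
  and g_smooth: "vf p X \<Longrightarrow> vf p Y \<Longrightarrow> smooth_at A p (\<lambda>q. g q (X q) (Y q))"
  using metric unfolding riemannian_metric_def by blast+

lemma g_add_right: "u \<in> T p \<Longrightarrow> v \<in> T p \<Longrightarrow> w \<in> T p \<Longrightarrow> g p w (u + v) = g p w u + g p w v"
  using g_add_left[of u p v w] g_sym[of w p] tangent_closed(1)[of u p v] by simp

lemma g_scale_right: "u \<in> T p \<Longrightarrow> v \<in> T p \<Longrightarrow> g p u (c *\<^sub>R v) = c * g p u v"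
  using g_scale_left[of v p u c] g_sym[of u p] tangent_closed(2)[of v p c] by simp

lemma lin_at_g_left: "w \<in> T p \<Longrightarrow> lin_at p (\<lambda>u. g p u w)"
  unfolding lin_at_def by (simp add: g_add_left g_scale_left)

lemma g_minus_left: "u \<in> T p \<Longrightarrow> v \<in> T p \<Longrightarrow> g p (- u) v = - g p u v"
  using g_scale_left[of u p v "-1"] by simp

lemma g_minus_right: "u \<in> T p \<Longrightarrow> v \<in> T p \<Longrightarrow> g p u (- v) = - g p u v"
  using g_scale_right[of u p v "-1"] by simp

lemma g_diff_left: "u \<in> T p \<Longrightarrow> v \<in> T p \<Longrightarrow> w \<in> T p \<Longrightarrow> g p (u - v) w = g p u w - g p v w"
  using g_add_left[of u p "-v" w] by (simp add: g_minus_left tangent_closed(4))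

lemma g_diff_right: "u \<in> T p \<Longrightarrow> v \<in> T p \<Longrightarrow> w \<in> T p \<Longrightarrow> g p w (u - v) = g p w u - g p w v"
  using g_add_right[of u p "-v" w] by (simp add: g_minus_right tangent_closed(4))

lemma g_sum_left: "(\<And>i. i \<in> I \<Longrightarrow> u i \<in> T p) \<Longrightarrow> w \<in> T p \<Longrightarrow> g p (\<Sum>i\<in>I. u i) w = (\<Sum>i\<in>I. g p (u i) w)"
  using lin_at_sum[OF lin_at_g_left] by blast

lemma g_zero: "u \<in> T p \<Longrightarrow> g p 0 u = 0" "u \<in> T p \<Longrightarrow> g p u 0 = 0"
  using g_scale_left[of 0 p u 0] g_scale_right[of u p 0 0] tangent_closed(6) by auto

lemmas g_bilinear = g_add_left g_add_right g_scale_left g_scale_right g_minus_left g_minus_right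
  g_diff_left g_diff_right g_zero

lemma g_nondegenerate:
  assumes "u \<in> T p" "v \<in> T p" "\<And>w. w \<in> T p \<Longrightarrow> g p u w = g p v w"
  shows "u = v"
proof (rule ccontr)
  assume "u \<noteq> v"
  then have "g p (u - v) (u - v) > 0" using assms by (intro g_pos tangent_closed) auto
  then show False using assms by (simp add: g_bilinear tangent_closed(3))
qed

lemma g_nondegenerate_fields:
  assumes "u \<in> T p" "v \<in> T p" "\<And>Z. vf p Z \<Longrightarrow> g p u (Z p) = g p v (Z p)"
  shows "u = v"
  using assms(1,2)
proof (rule g_nondegenerate)
  fix w assume "w \<in> T p"
  then obtain Z where "extends_vec A p Z w" by (rule ex_extension)
  then show "g p u w = g p v w" using assms(3) unfolding extends_vec_def by blast
qed

lemma orthogonal_independent: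
  assumes "finite B" "B \<subseteq> T p" "0 \<notin> B" "\<And>u v. u \<in> B \<Longrightarrow> v \<in> B \<Longrightarrow> u \<noteq> v \<Longrightarrow> g p u v = 0"
  shows "independent B"
proof
  assume "dependent B"
  then obtain c v where v: "v \<in> B" "c v \<noteq> 0" and s: "(\<Sum>u\<in>B. c u *\<^sub>R u) = 0"
    using dependent_finite[OF assms(1)] by blast
  have "0 = g p (\<Sum>u\<in>B. c u *\<^sub>R u) v" using s g_zero(1)[of v p] v(1) assms(2) by auto
  also have "\<dots> = (\<Sum>u\<in>B. c u * g p u v)"
    using v(1) assms(2) by (subst g_sum_left) (auto intro!: sum.cong tangent_closed(2) simp: g_scale_left subset_iff)
  also have "\<dots> = (\<Sum>u\<in>B. if u = v then c v * g p v v else 0)"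
    using assms(4) v(1) by (intro sum.cong) auto
  also have "\<dots> = c v * g p v v" using v(1) assms(1) by simp
  finally show False using g_pos[of v p] v assms(2,3) by auto
qed

lemma onf_tangent: "orthonormal_frame A g p S \<Longrightarrow> S i \<in> T p"
  and onf_g: "orthonormal_frame A g p S \<Longrightarrow> g p (S i) (S j) = (if i = j then 1 else 0)"
  unfolding orthonormal_frame_def by blast+

text \<open>Otherwise the residual would be a fourth independent vector.\<close>

lemma onf_expand:
  assumes S: "orthonormal_frame A g p S" and u: "u \<in> T p"
  shows "u = (\<Sum>i\<in>UNIV. g p u (S i) *\<^sub>R S i)"
proof (rule ccontr)
  assume ne: "\<not> ?thesis"
  define w where "w = u - (\<Sum>i\<in>UNIV. g p u (S i) *\<^sub>R S i)"
  note t = onf_tangent[OF S]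
  have sT: "(\<Sum>i\<in>UNIV. g p u (S i) *\<^sub>R S i) \<in> T p" by (intro tangent_closed(5) tangent_closed(2) t)
  have w: "w \<in> T p" "w \<noteq> 0" using ne u sT by (auto simp: w_def intro: tangent_closed(3))
  have wS: "g p w (S j) = 0" for j
  proof -
    have "g p (\<Sum>i\<in>UNIV. g p u (S i) *\<^sub>R S i) (S j) = (\<Sum>i\<in>UNIV. g p u (S i) * (if i = j then 1 else 0))"
      using t by (simp add: g_sum_left tangent_closed(2) g_scale_left onf_g[OF S])
    also have "\<dots> = g p u (S j)" by (simp add: if_distrib[of "\<lambda>x. _ * x"] cong: if_cong)
    finally show ?thesis using u t sT by (simp add: w_def g_diff_left)
  qed
  have inj: "inj S" by (rule injI) (metis onf_g[OF S] zero_neq_one)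
  have w_notin: "w \<notin> range S"
  proof
    assume "w \<in> range S"
    then obtain i where "w = S i" by blast
    then show False using wS[of i] onf_g[OF S, of i i] by simp
  qed
  have ne0: "S i \<noteq> 0" for i using onf_g[OF S, of i i] g_zero(1)[OF t[of i]] by auto
  have "independent (insert w (range S))"
  proof (rule orthogonal_independent)
    show "insert w (range S) \<subseteq> T p" using w(1) t by auto
    show "0 \<notin> insert w (range S)" using w(2) ne0 by (metis imageE insertE)
    show "g p a b = 0" if "a \<in> insert w (range S)" "b \<in> insert w (range S)" "a \<noteq> b" for a b
      using that wS g_sym[OF w(1) t] onf_g[OF S] by auto
  qed simp
  then have "card (insert w (range S)) \<le> 3" using tangent_independent_bound w(1) t by blast
  moreover have "card (insert w (range S)) = 4" using w_notin card_image[OF inj] by simp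
  ultimately show False by simp
qed

lemma lin_at_expand:
  assumes "lin_at p L" "orthonormal_frame A g p S" "u \<in> T p"
  shows "L u = (\<Sum>i\<in>UNIV. g p u (S i) *\<^sub>R L (S i))"
proof -
  have "L u = L (\<Sum>i\<in>UNIV. g p u (S i) *\<^sub>R S i)" using onf_expand[OF assms(2,3)] by simp
  also have "\<dots> = (\<Sum>i\<in>UNIV. g p u (S i) *\<^sub>R L (S i))"
    by (simp add: lin_at_sum[OF assms(1)] tangent_closed(2) onf_tangent[OF assms(2)] lin_at_scale[OF assms(1)])
  finally show ?thesis .
qed

lemma onf_parseval:
  assumes "orthonormal_frame A g p S" "u \<in> T p" "v \<in> T p"
  shows "g p u v = (\<Sum>i\<in>UNIV. g p u (S i) * g p v (S i))"
  using lin_at_expand[OF lin_at_g_left[OF assms(3)] assms(1,2)] g_sym[OF onf_tangent[OF assms(1)] assms(3)]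
  by simp

definition local_frame :: "'a \<Rightarrow> (3 \<Rightarrow> 'a vfield) \<Rightarrow> bool"
  where "local_frame p E \<longleftrightarrow> (\<forall>i. vf p (E i)) \<and> (\<forall>\<^sub>F q in nhds p. orthonormal_frame A g q (\<lambda>i. E i q))"

lemma local_frame_vf: "local_frame p E \<Longrightarrow> vf p (E i)"
  and local_frame_onf: "local_frame p E \<Longrightarrow> orthonormal_frame A g p (\<lambda>i. E i p)"
  unfolding local_frame_def by (auto dest: eventually_nhds_x_imp_x)

definition normalized :: "'a vfield \<Rightarrow> 'a vfield"
  where "normalized X q = (g q (X q) (X q)) powr (-1/2) *\<^sub>R X q"

lemma vf_normalized:
  assumes X: "vf p X" and ne: "\<forall>\<^sub>F q in nhds p. X q \<noteq> 0"
  shows "vf p (normalized X)"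
proof -
  have "\<forall>\<^sub>F q in nhds p. g q (X q) (X q) > 0"
    using vfield_eventually[OF X] ne by eventually_elim (intro g_pos vfield_tangent)
  then show ?thesis
    unfolding normalized_def[abs_def] by (intro vfield_scale smooth_at_powr g_smooth X)
qed

lemma g_normalized:
  assumes "X q \<in> T q" "X q \<noteq> 0"
  shows "g q (normalized X q) (normalized X q) = 1"
proof -
  have "g q (X q) (X q) > 0" using assms by (rule g_pos)
  moreover have "(r powr (-1/2)) * (r powr (-1/2)) * r = 1" if "r > 0" for r :: real
  proof -
    have "(r powr (-1/2)) * (r powr (-1/2)) = r powr (-1/2 + -1/2)" by (simp only: powr_add)
    also have "\<dots> = inverse r" using that by (simp add: powr_minus)
    finally show ?thesis using that by simp
  qed
  ultimately show ?thesis
    using assms(1) by (simp add: normalized_def g_bilinear tangent_closed(2) mult.assoc)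
qed

text \<open>Gram--Schmidt on a coordinate frame.  The orthogonalised fields do not vanish because the one
  with index \<open>i\<close> takes the value one on the \<open>i\<close>-th coordinate.\<close>

lemma ex_local_frame: obtains E where "local_frame p E"
proof -
  obtain U \<phi> where c: "(U, \<phi>) \<in> A" "p \<in> U" by (rule ex_chart)
  define C where "C = coord_vec (U, \<phi>)"
  have U: "\<forall>\<^sub>F q in nhds p. q \<in> U" using chartD(1)[OF c(1)] c(2) by (simp add: eventually_nhds_in_open)
  have Cv: "vf q (C i)" if "q \<in> U" for q i unfolding C_def by (rule vfield_coord_vec[OF c(1) that])
  have Cx: "C i q (\<lambda>q. \<phi> q $ j) = (if i = j then 1 else 0)" if "q \<in> U" for q i j
    unfolding C_def by (rule coord_vec_coordinate[OF c(1) that])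
  define E1 where "E1 = normalized (C 1)"
  define U2 where "U2 q = C 2 q - g q (C 2 q) (E1 q) *\<^sub>R E1 q" for q
  define E2 where "E2 = normalized U2"
  define U3 where "U3 q = C 3 q - g q (C 3 q) (E1 q) *\<^sub>R E1 q - g q (C 3 q) (E2 q) *\<^sub>R E2 q" for q
  define E3 where "E3 = normalized U3"
  have E1x: "E1 q (\<lambda>q. \<phi> q $ j) = 0" if "q \<in> U" "j = 2 \<or> j = 3" for q j
    using that by (auto simp: E1_def normalized_def Cx)
  have U2x: "U2 q (\<lambda>q. \<phi> q $ 2) = 1" "U2 q (\<lambda>q. \<phi> q $ 3) = 0" if "q \<in> U" for q
    using that by (auto simp: U2_def Cx E1x)
  have E2x: "E2 q (\<lambda>q. \<phi> q $ 3) = 0" if "q \<in> U" for q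
    using that by (auto simp: E2_def normalized_def U2x)
  have U3x: "U3 q (\<lambda>q. \<phi> q $ 3) = 1" if "q \<in> U" for q
    using that by (auto simp: U3_def Cx E1x E2x)
  have n1: "C 1 q \<noteq> 0" and n2: "U2 q \<noteq> 0" and n3: "U3 q \<noteq> 0" if "q \<in> U" for q
    using Cx[OF that, of 1 1] U2x(1)[OF that] U3x[OF that] by auto
  have ev: "\<forall>\<^sub>F r in nhds q. r \<in> U" if "q \<in> U" for q using chartD(1)[OF c(1)] that by (simp add: eventually_nhds_in_open)
  have E1v: "vf q E1" if "q \<in> U" for q
    unfolding E1_def using ev[OF that] n1 by (intro vf_normalized Cv that) (auto elim: eventually_mono)
  have U2v: "vf q U2" if "q \<in> U" for q
    unfolding U2_def[abs_def] by (intro vfield_diff vfield_scale g_smooth Cv E1v that)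
  have E2v: "vf q E2" if "q \<in> U" for q
    unfolding E2_def using ev[OF that] n2 by (intro vf_normalized U2v that) (auto elim: eventually_mono)
  have U3v: "vf q U3" if "q \<in> U" for q
    unfolding U3_def[abs_def] by (intro vfield_diff vfield_scale g_smooth Cv E1v E2v that)
  have E3v: "vf q E3" if "q \<in> U" for q
    unfolding E3_def using ev[OF that] n3 by (intro vf_normalized U3v that) (auto elim: eventually_mono)
  define E where "E i = (if i = 1 then E1 else if i = 2 then E2 else E3)" for i :: 3
  have onf: "orthonormal_frame A g q (\<lambda>i. E i q)" if q: "q \<in> U" for q
  proof -
    note t[simp] = vfield_tangent[OF Cv[OF q]] vfield_tangent[OF E1v[OF q]] vfield_tangent[OF E2v[OF q]]
      vfield_tangent[OF E3v[OF q]] vfield_tangent[OF U2v[OF q]] vfield_tangent[OF U3v[OF q]]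
    have 11: "g q (E1 q) (E1 q) = 1" unfolding E1_def by (rule g_normalized) (use n1 q in auto)
    have 22: "g q (E2 q) (E2 q) = 1" unfolding E2_def by (rule g_normalized) (use n2 q in auto)
    have 33: "g q (E3 q) (E3 q) = 1" unfolding E3_def by (rule g_normalized) (use n3 q in auto)
    have "g q (U2 q) (E1 q) = 0" by (simp add: U2_def g_bilinear tangent_closed 11)
    then have 21: "g q (E2 q) (E1 q) = 0" by (simp add: E2_def normalized_def g_bilinear)
    then have 12: "g q (E1 q) (E2 q) = 0" using g_sym[of "E1 q" q "E2 q"] by simp
    have "g q (U3 q) (E1 q) = 0" by (simp add: U3_def g_bilinear tangent_closed 11 21)
    then have 31: "g q (E3 q) (E1 q) = 0" by (simp add: E3_def normalized_def g_bilinear)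
    then have 13: "g q (E1 q) (E3 q) = 0" using g_sym[of "E1 q" q "E3 q"] by simp
    have "g q (U3 q) (E2 q) = 0" by (simp add: U3_def g_bilinear tangent_closed 12 22)
    then have 32: "g q (E3 q) (E2 q) = 0" by (simp add: E3_def normalized_def g_bilinear)
    then have 23: "g q (E2 q) (E3 q) = 0" using g_sym[of "E2 q" q "E3 q"] by simp
    show ?thesis unfolding orthonormal_frame_def forall_3
      by (simp add: E_def 11 12 13 21 22 23 31 32 33)
  qed
  have "local_frame p E" unfolding local_frame_def forall_3
    using E1v[OF c(2)] E2v[OF c(2)] E3v[OF c(2)] eventually_mono[OF U onf] by (simp add: E_def)
  then show ?thesis by (rule that)
qed

lemma ex_onf: obtains S where "orthonormal_frame A g p S"
  using ex_local_frame local_frame_onf by meson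

lemma local_frame_expand:
  assumes "local_frame p E" "vf p X"
  shows "\<forall>\<^sub>F q in nhds p. X q = (\<Sum>i\<in>UNIV. g q (X q) (E i q) *\<^sub>R E i q)"
proof -
  have "\<forall>\<^sub>F q in nhds p. orthonormal_frame A g q (\<lambda>i. E i q)" using assms(1) by (simp add: local_frame_def)
  then show ?thesis using vfield_eventually[OF assms(2)]
    by eventually_elim (rule onf_expand[OF _ vfield_tangent])
qed

lemma tensorial_expand:
  assumes "tensorial_at p L" "local_frame p E" "vf p X"
  shows "L X = (\<Sum>i\<in>UNIV. g p (X p) (E i p) *\<^sub>R L (E i))"
proof -
  note E = local_frame_vf[OF assms(2)]
  have "L X = L (\<lambda>q. \<Sum>i\<in>UNIV. g q (X q) (E i q) *\<^sub>R E i q)"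
    by (rule tensorial_local[OF assms(1,3) local_frame_expand[OF assms(2,3)]])
  also have "\<dots> = (\<Sum>i\<in>UNIV. L (\<lambda>q. g q (X q) (E i q) *\<^sub>R E i q))"
    by (rule tensorial_sum[OF assms(1)]) (intro vfield_scale g_smooth assms(3) E)
  also have "\<dots> = (\<Sum>i\<in>UNIV. g p (X p) (E i p) *\<^sub>R L (E i))"
    by (simp add: tensorial_scale[OF assms(1) g_smooth[OF assms(3) E] E])
  finally show ?thesis .
qed

text \<open>The components of a field in a local frame can be pulled out of an operator that is linear over
  smooth functions, which leaves only their values at the point.\<close>

lemma tensorial_pointwise:
  assumes "tensorial_at p L" "vf p X" "vf p Y" "X p = Y p"
  shows "L X = L Y"
proof -
  obtain E where "local_frame p E" by (rule ex_local_frame)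
  then show ?thesis using tensorial_expand[OF assms(1)] assms by simp
qed

section \<open>The Levi-Civita connection\<close>

text \<open>A metric is symmetric and bilinear on tangent vectors only, and fields are tangent only near \<open>p\<close>,
  so these identities hold near \<open>p\<close> and pass to derivatives because derivations are local.\<close>

lemma deriv_g_sym:
  assumes "v \<in> T p" "vf p Y" "vf p Z"
  shows "v (\<lambda>q. g q (Y q) (Z q)) = v (\<lambda>q. g q (Z q) (Y q))"
proof (rule tangent_cong[OF assms(1)])
  show "\<forall>\<^sub>F q in nhds p. g q (Y q) (Z q) = g q (Z q) (Y q)"
    using vfield_eventually[OF assms(2)] vfield_eventually[OF assms(3)]
    by eventually_elim (intro g_sym vfield_tangent)
qed

lemma deriv_g_add:
  assumes "v \<in> T p" "vf p X" "vf p Y" "vf p Z"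
  shows "v (\<lambda>q. g q (X q + Y q) (Z q)) = v (\<lambda>q. g q (X q) (Z q)) + v (\<lambda>q. g q (Y q) (Z q))"
proof -
  have "\<forall>\<^sub>F q in nhds p. g q (X q + Y q) (Z q) = g q (X q) (Z q) + g q (Y q) (Z q)"
    using vfield_eventually[OF assms(2)] vfield_eventually[OF assms(3)] vfield_eventually[OF assms(4)]
    by eventually_elim (intro g_add_left vfield_tangent)
  from tangent_cong[OF assms(1) this] show ?thesis
    by (simp add: tangent_add[OF assms(1)] g_smooth assms)
qed

lemma deriv_g_scale:
  assumes "v \<in> T p" "smooth_at A p k" "vf p X" "vf p Z"
  shows "v (\<lambda>q. g q (k q *\<^sub>R X q) (Z q)) = v k * g p (X p) (Z p) + k p * v (\<lambda>q. g q (X q) (Z q))"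
proof -
  have "\<forall>\<^sub>F q in nhds p. g q (k q *\<^sub>R X q) (Z q) = k q * g q (X q) (Z q)"
    using vfield_eventually[OF assms(3)] vfield_eventually[OF assms(4)]
    by eventually_elim (intro g_scale_left vfield_tangent)
  from tangent_cong[OF assms(1) this] show ?thesis
    by (simp add: tangent_mult[OF assms(1)] g_smooth assms)
qed

lemma deriv_g_add_right:
  assumes "v \<in> T p" "vf p X" "vf p Y" "vf p Z"
  shows "v (\<lambda>q. g q (Z q) (X q + Y q)) = v (\<lambda>q. g q (Z q) (X q)) + v (\<lambda>q. g q (Z q) (Y q))"
  using deriv_g_add[OF assms] deriv_g_sym[OF assms(1,4)] vfield_add[OF assms(2,3)] assms by simp

lemma deriv_g_scale_right:
  assumes "v \<in> T p" "smooth_at A p k" "vf p X" "vf p Z"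
  shows "v (\<lambda>q. g q (Z q) (k q *\<^sub>R X q)) = v k * g p (Z p) (X p) + k p * v (\<lambda>q. g q (Z q) (X q))"
  using deriv_g_scale[OF assms] deriv_g_sym[OF assms(1,4)] vfield_scale[OF assms(2,3)] assms
    g_sym[OF vfield_tangent[OF assms(3)] vfield_tangent[OF assms(4)]] by simp

lemma lb_add_right:
  "vf p X \<Longrightarrow> vf p X' \<Longrightarrow> vf p Y \<Longrightarrow> lb Y (\<lambda>q. X q + X' q) p = lb Y X p + lb Y X' p"
  using lie_bracket_add[of p X X' Y] lie_bracket_swap[of Y _ p] by simp

lemma lb_scale_right:
  "smooth_at A p k \<Longrightarrow> vf p X \<Longrightarrow> vf p Y \<Longrightarrow> lb Y (\<lambda>q. k q *\<^sub>R X q) p = k p *\<^sub>R lb Y X p + Y p k *\<^sub>R X p"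
  using lie_bracket_scale[of p k X Y] lie_bracket_swap[of Y _ p] by simp

definition koszul :: "'a \<Rightarrow> 'a vfield \<Rightarrow> 'a vfield \<Rightarrow> 'a vfield \<Rightarrow> real"
  where "koszul p X Y Z = (X p (\<lambda>q. g q (Y q) (Z q)) + Y p (\<lambda>q. g q (X q) (Z q)) - Z p (\<lambda>q. g q (X q) (Y q))
    + g p (lb X Y p) (Z p) - g p (lb X Z p) (Y p) - g p (lb Y Z p) (X p)) / 2"

context
  fixes p X Y Z
  assumes X: "vf p X" and Y: "vf p Y" and Z: "vf p Z"
begin

lemmas koszul_tangent_facts = X Y Z vfield_tangent[OF X] vfield_tangent[OF Y] vfield_tangent[OF Z]
  vfield_tangent[OF vfield_lie_bracket[OF X Y]] vfield_tangent[OF vfield_lie_bracket[OF X Z]]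
  vfield_tangent[OF vfield_lie_bracket[OF Y Z]]

lemma koszul_smooth: "smooth_at A p (\<lambda>q. koszul q X Y Z)"
proof -
  have "smooth_at A p (\<lambda>q. 1/2 * (X q (\<lambda>q. g q (Y q) (Z q)) + Y q (\<lambda>q. g q (X q) (Z q)) - Z q (\<lambda>q. g q (X q) (Y q))
    + g q (lb X Y q) (Z q) - g q (lb X Z q) (Y q) - g q (lb Y Z q) (X q)))"
    by (rule smooth_at_cmult)
      (rule smooth_at_diff smooth_at_add vfield_smooth[OF X] vfield_smooth[OF Y] vfield_smooth[OF Z]
        g_smooth vfield_lie_bracket X Y Z)+
  then show ?thesis by (simp add: koszul_def)
qed

lemma koszul_torsion: "koszul p X Y Z - koszul p Y X Z = g p (lb X Y p) (Z p)"
  using deriv_g_sym[of "Z p" p X Y] koszul_tangent_facts lie_bracket_swap[of Y X p]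
  by (simp add: koszul_def g_bilinear field_simps)

lemma koszul_metric: "koszul p X Y Z + koszul p X Z Y = X p (\<lambda>q. g q (Y q) (Z q))"
  using deriv_g_sym[of "X p" p Y Z] deriv_g_sym[of "Y p" p X Z] deriv_g_sym[of "Z p" p X Y]
    koszul_tangent_facts lie_bracket_swap[of Z Y p]
  by (simp add: koszul_def g_bilinear field_simps)

lemma koszul_scale1: "smooth_at A p k \<Longrightarrow> koszul p (\<lambda>q. k q *\<^sub>R X q) Y Z = k p * koszul p X Y Z"
  using koszul_tangent_facts g_sym[of "X p" p "Y p"] g_sym[of "X p" p "Z p"] g_sym[of "Y p" p "Z p"]
  by (simp add: koszul_def deriv_g_scale lie_bracket_scale g_bilinear tangent_closed field_simps)

lemma koszul_scale2: "smooth_at A p k \<Longrightarrow>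
    koszul p X (\<lambda>q. k q *\<^sub>R Y q) Z = X p k * g p (Y p) (Z p) + k p * koszul p X Y Z"
  using koszul_tangent_facts g_sym[of "X p" p "Y p"] g_sym[of "X p" p "Z p"] g_sym[of "Y p" p "Z p"]
  by (simp add: koszul_def deriv_g_scale deriv_g_scale_right lie_bracket_scale lb_scale_right g_bilinear
      tangent_closed field_simps)

lemma koszul_scale3: "smooth_at A p k \<Longrightarrow> koszul p X Y (\<lambda>q. k q *\<^sub>R Z q) = k p * koszul p X Y Z"
  using koszul_tangent_facts g_sym[of "X p" p "Y p"] g_sym[of "X p" p "Z p"] g_sym[of "Y p" p "Z p"]
  by (simp add: koszul_def deriv_g_scale_right lb_scale_right g_bilinear tangent_closed field_simps)

end

context
  fixes p X Y Z W
  assumes X: "vf p X" and Y: "vf p Y" and Z: "vf p Z" and W: "vf p W"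
begin

lemmas koszul_tangent_facts4 = W vfield_tangent[OF W] koszul_tangent_facts[OF X Y Z] 
  vfield_tangent[OF vfield_lie_bracket[OF X W]] vfield_tangent[OF vfield_lie_bracket[OF Y W]]
  vfield_tangent[OF vfield_lie_bracket[OF Z W]] vfield_tangent[OF vfield_lie_bracket[OF W X]]
  vfield_tangent[OF vfield_lie_bracket[OF W Y]] vfield_tangent[OF vfield_lie_bracket[OF W Z]]

lemma koszul_add1: "koszul p (\<lambda>q. X q + W q) Y Z = koszul p X Y Z + koszul p W Y Z"
  using koszul_tangent_facts4
  by (simp add: koszul_def deriv_g_add lie_bracket_add g_bilinear tangent_closed field_simps)

lemma koszul_add2: "koszul p X (\<lambda>q. Y q + W q) Z = koszul p X Y Z + koszul p X W Z"
  using koszul_tangent_facts4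
  by (simp add: koszul_def deriv_g_add deriv_g_add_right lie_bracket_add lb_add_right g_bilinear tangent_closed field_simps)

lemma koszul_add3: "koszul p X Y (\<lambda>q. Z q + W q) = koszul p X Y Z + koszul p X Y W"
  using koszul_tangent_facts4
  by (simp add: koszul_def deriv_g_add_right lb_add_right g_bilinear tangent_closed field_simps)

end

text \<open>In the first and third slot the derivatives of the coefficient function cancel between the derivative
  terms and the bracket terms of the Koszul expression; in the second slot one of them survives and gives the
  Leibniz rule of the connection (\<open>koszul_scale2\<close>).\<close>

lemma koszul_tensorial1: "vf p Y \<Longrightarrow> vf p Z \<Longrightarrow> tensorial_at p (\<lambda>X. koszul p X Y Z)"
  by (rule tensorial_atI) (simp_all add: koszul_add1 koszul_scale1)

lemma koszul_tensorial3: "vf p X \<Longrightarrow> vf p Y \<Longrightarrow> tensorial_at p (\<lambda>Z. koszul p X Y Z)"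
  by (rule tensorial_atI) (simp_all add: koszul_add3 koszul_scale3)

text \<open>Metric compatibility for the three cyclic permutations of the fields, combined with the absence of
  torsion, determines the connection.\<close>

lemma levi_civita_koszul:
  assumes D: "is_levi_civita A g D" and X: "vf p X" and Y: "vf p Y" and Z: "vf p Z"
  shows "g p (D p (X p) Y) (Z p) = koszul p X Y Z"
proof -
  note t = koszul_tangent_facts[OF X Y Z]
  have D_T: "D p u V \<in> T p" if "u \<in> T p" "vf p V" for u V
    using D that unfolding is_levi_civita_def is_connection_def by blast
  have tors: "lb V W p = D p (V p) W - D p (W p) V" if "vf p V" "vf p W" for V W
    using D that unfolding is_levi_civita_def by simp
  have compat: "v (\<lambda>q. g q (V q) (W q)) = g p (D p v V) (W p) + g p (V p) (D p v W)"
    if "v \<in> T p" "vf p V" "vf p W" for v V W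
    using D that unfolding is_levi_civita_def by blast
  show ?thesis
    using t g_sym[of "D p (X p) Z" p "Y p"] g_sym[of "D p (Y p) Z" p "X p"] g_sym[of "D p (Z p) X" p "Y p"]
      g_sym[of "D p (Z p) Y" p "X p"] g_sym[of "D p (X p) Y" p "Z p"] g_sym[of "D p (Y p) X" p "Z p"]
    by (simp add: koszul_def compat tors D_T g_bilinear)
qed

definition frame_at :: "'a \<Rightarrow> 3 \<Rightarrow> 'a vfield"
  where "frame_at p = (SOME E. local_frame p E)"

definition extension_at :: "'a \<Rightarrow> 'a tvec \<Rightarrow> 'a vfield"
  where "extension_at p v = (SOME X. extends_vec A p X v)"

text \<open>The vector whose inner products with a frame are the Koszul expressions.  It does not depend on the
  chosen frame and extension (\<open>koszul_connection_g\<close>), which is why it varies smoothly with the point.\<close>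

definition koszul_connection :: "'a conn"
  where "koszul_connection p v Y =
    (\<Sum>i\<in>UNIV. koszul p (extension_at p v) Y (frame_at p i) *\<^sub>R frame_at p i p)"

lemma local_frame_at: "local_frame p (frame_at p)"
  unfolding frame_at_def using someI_ex[of "local_frame p"] ex_local_frame[of p] by blast

lemma extension_at: 
  assumes "v \<in> T p"
  shows "vf p (extension_at p v)" "extension_at p v p = v"
proof -
  have "extends_vec A p (extension_at p v) v"
    unfolding extension_at_def using someI_ex[of "\<lambda>X. extends_vec A p X v"] ex_extension[OF assms] by blast
  then show "vf p (extension_at p v)" "extension_at p v p = v" by (simp_all add: extends_vec_def)
qed

lemma koszul_connection_tangent: "koszul_connection p v Y \<in> T p"
  unfolding koszul_connection_def
  by (intro tangent_closed(5) tangent_closed(2) vfield_tangent local_frame_vf[OF local_frame_at])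

lemma koszul_connection_g:
  assumes X: "vf p X" and Y: "vf p Y" and Z: "vf p Z"
  shows "g p (koszul_connection p (X p) Y) (Z p) = koszul p X Y Z"
proof -
  let ?E = "frame_at p"
  note E = local_frame_vf[OF local_frame_at] and tX = vfield_tangent[OF X] and tZ = vfield_tangent[OF Z]
  note ext = extension_at[OF tX]
  have "g p (koszul_connection p (X p) Y) (Z p) = (\<Sum>i\<in>UNIV. koszul p X Y (?E i) * g p (?E i p) (Z p))"
    unfolding koszul_connection_def
    by (simp add: g_sum_left tangent_closed(2) vfield_tangent[OF E] tZ g_scale_left
        tensorial_pointwise[OF koszul_tensorial1[OF Y E] ext(1) X ext(2)])
  also have "\<dots> = koszul p X Y Z"
    using tensorial_expand[OF koszul_tensorial3[OF X Y] local_frame_at Z] g_sym[OF tZ vfield_tangent[OF E]]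
    by (simp add: mult.commute)
  finally show ?thesis .
qed

lemma vf_koszul_connection:
  assumes X: "vf p X" and Y: "vf p Y"
  shows "vf p (\<lambda>q. koszul_connection q (X q) Y)"
proof (rule vfield_cong)
  let ?E = "frame_at p"
  note E = local_frame_vf[OF local_frame_at]
  show "vf p (\<lambda>q. \<Sum>i\<in>UNIV. koszul q X Y (?E i) *\<^sub>R ?E i q)"
    by (intro vfield_sum vfield_scale koszul_smooth X Y E)
  have "\<forall>\<^sub>F q in nhds p. \<forall>i. vf q (?E i)"
    unfolding forall_3 by (intro eventually_conj vfield_eventually E)
  moreover have "\<forall>\<^sub>F q in nhds p. orthonormal_frame A g q (\<lambda>i. ?E i q)"
    using local_frame_at by (simp add: local_frame_def)
  ultimately show "\<forall>\<^sub>F q in nhds p. (\<Sum>i\<in>UNIV. koszul q X Y (?E i) *\<^sub>R ?E i q) = koszul_connection q (X q) Y"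
    using vfield_eventually[OF X] vfield_eventually[OF Y]
  proof eventually_elim
    case (elim q)
    then show ?case
      using onf_expand[OF elim(2) koszul_connection_tangent, of "X q" Y] by (simp add: koszul_connection_g)
  qed
qed

lemma koszul_connection_connection: "is_connection A koszul_connection"
proof -
  let ?D = koszul_connection
  note t = koszul_connection_tangent
  have "?D p (u + v) Y = ?D p u Y + ?D p v Y" if u: "u \<in> T p" and v: "v \<in> T p" and Y: "vf p Y" for p u v Y
  proof (rule g_nondegenerate_fields)
    fix Z assume Z: "vf p Z"
    note U = extension_at[OF u] and V = extension_at[OF v]
    show "g p (?D p (u + v) Y) (Z p) = g p (?D p u Y + ?D p v Y) (Z p)"
      using koszul_connection_g[OF vfield_add[OF U(1) V(1)] Y Z] koszul_connection_g[OF U(1) Y Z]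
        koszul_connection_g[OF V(1) Y Z] koszul_add1[OF U(1) Y Z V(1)] t vfield_tangent[OF Z]
      by (simp add: U(2) V(2) g_bilinear)
  qed (intro tangent_closed t)+
  moreover have "?D p (c *\<^sub>R u) Y = c *\<^sub>R ?D p u Y" if u: "u \<in> T p" and Y: "vf p Y" for p u c Y
  proof (rule g_nondegenerate_fields)
    fix Z assume Z: "vf p Z"
    note U = extension_at[OF u]
    show "g p (?D p (c *\<^sub>R u) Y) (Z p) = g p (c *\<^sub>R ?D p u Y) (Z p)"
      using koszul_connection_g[OF vfield_cscale[OF U(1)] Y Z, of c] koszul_connection_g[OF U(1) Y Z]
        koszul_scale1[OF U(1) Y Z smooth_at_const, of c] t vfield_tangent[OF Z]
      by (simp add: U(2) g_bilinear)
  qed (intro tangent_closed t)+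
  moreover have "?D p u (\<lambda>q. Y q + W q) = ?D p u Y + ?D p u W"
    if u: "u \<in> T p" and Y: "vf p Y" and W: "vf p W" for p u Y W
  proof (rule g_nondegenerate_fields)
    fix Z assume Z: "vf p Z"
    note U = extension_at[OF u]
    show "g p (?D p u (\<lambda>q. Y q + W q)) (Z p) = g p (?D p u Y + ?D p u W) (Z p)"
      using koszul_connection_g[OF U(1) vfield_add[OF Y W] Z] koszul_connection_g[OF U(1) Y Z]
        koszul_connection_g[OF U(1) W Z] koszul_add2[OF U(1) Y Z W] t vfield_tangent[OF Z]
      by (simp add: U(2) g_bilinear)
  qed (intro tangent_closed t)+
  moreover have "?D p u (\<lambda>q. k q *\<^sub>R Y q) = u k *\<^sub>R Y p + k p *\<^sub>R ?D p u Y"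
    if u: "u \<in> T p" and Y: "vf p Y" and k: "smooth_at A p k" for p u Y k
  proof (rule g_nondegenerate_fields)
    fix Z assume Z: "vf p Z"
    note U = extension_at[OF u]
    show "g p (?D p u (\<lambda>q. k q *\<^sub>R Y q)) (Z p) = g p (u k *\<^sub>R Y p + k p *\<^sub>R ?D p u Y) (Z p)"
      using koszul_connection_g[OF U(1) vfield_scale[OF k Y] Z] koszul_connection_g[OF U(1) Y Z]
        koszul_scale2[OF U(1) Y Z k] t vfield_tangent[OF Z] vfield_tangent[OF Y]
      by (simp add: U(2) g_bilinear tangent_closed)
  qed (intro tangent_closed t vfield_tangent[OF Y])+
  ultimately show ?thesis
    unfolding is_connection_def by (simp add: t vf_koszul_connection)
qed

lemma koszul_connection_levi_civita: "is_levi_civita A g koszul_connection"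
  unfolding is_levi_civita_def
proof (intro conjI allI impI ballI koszul_connection_connection)
  let ?D = koszul_connection
  note t = koszul_connection_tangent
  fix p X Y assume XY: "vf p X \<and> vf p Y"
  then have X: "vf p X" and Y: "vf p Y" by auto
  show "?D p (X p) Y - ?D p (Y p) X = lb X Y p"
  proof (rule g_nondegenerate_fields)
    fix Z assume Z: "vf p Z"
    show "g p (?D p (X p) Y - ?D p (Y p) X) (Z p) = g p (lb X Y p) (Z p)"
      using koszul_torsion[OF X Y Z] koszul_connection_g[OF X Y Z] koszul_connection_g[OF Y X Z] t vfield_tangent[OF Z]
      by (simp add: g_bilinear)
  qed (intro tangent_closed t vfield_tangent[OF vfield_lie_bracket[OF X Y]])+
next
  let ?D = koszul_connection
  fix p Y Z v assume v: "v \<in> T p" and YZ: "vf p Y \<and> vf p Z"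
  then have Y: "vf p Y" and Z: "vf p Z" by auto
  note V = extension_at[OF v]
  show "v (\<lambda>q. g q (Y q) (Z q)) = g p (?D p v Y) (Z p) + g p (Y p) (?D p v Z)"
    using koszul_metric[OF V(1) Y Z] koszul_connection_g[OF V(1) Y Z] koszul_connection_g[OF V(1) Z Y]
      g_sym[OF koszul_connection_tangent vfield_tangent[OF Y], of v Z] by (simp add: V(2))
qed

abbreviation D :: "'a conn" where "D \<equiv> levi_civita A g"

lemma levi_civita: "is_levi_civita A g D"
  unfolding levi_civita_def using someI[of "is_levi_civita A g"] koszul_connection_levi_civita by blast

lemma D_koszul: "vf p X \<Longrightarrow> vf p Y \<Longrightarrow> vf p Z \<Longrightarrow> g p (D p (X p) Y) (Z p) = koszul p X Y Z"
  by (rule levi_civita_koszul[OF levi_civita])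

lemma D_tangent: "u \<in> T p \<Longrightarrow> vf p Y \<Longrightarrow> D p u Y \<in> T p"
  and D_add_dir: "u \<in> T p \<Longrightarrow> v \<in> T p \<Longrightarrow> vf p Y \<Longrightarrow> D p (u + v) Y = D p u Y + D p v Y"
  and D_scale_dir: "u \<in> T p \<Longrightarrow> vf p Y \<Longrightarrow> D p (c *\<^sub>R u) Y = c *\<^sub>R D p u Y"
  and D_add: "u \<in> T p \<Longrightarrow> vf p Y \<Longrightarrow> vf p Z \<Longrightarrow> D p u (\<lambda>q. Y q + Z q) = D p u Y + D p u Z"
  and D_scale: "u \<in> T p \<Longrightarrow> vf p Y \<Longrightarrow> smooth_at A p k \<Longrightarrow>
    D p u (\<lambda>q. k q *\<^sub>R Y q) = u k *\<^sub>R Y p + k p *\<^sub>R D p u Y"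
  and vf_D: "vf p X \<Longrightarrow> vf p Y \<Longrightarrow> vf p (\<lambda>q. D q (X q) Y)"
  and D_torsion: "vf p X \<Longrightarrow> vf p Y \<Longrightarrow> lb X Y p = D p (X p) Y - D p (Y p) X"
  and D_metric: "v \<in> T p \<Longrightarrow> vf p Y \<Longrightarrow> vf p Z \<Longrightarrow>
    v (\<lambda>q. g q (Y q) (Z q)) = g p (D p v Y) (Z p) + g p (Y p) (D p v Z)"
  using levi_civita unfolding is_levi_civita_def is_connection_def by (blast, blast, blast, blast, blast, blast, metis, blast)

lemma lin_at_D: "vf p Y \<Longrightarrow> lin_at p (\<lambda>u. D p u Y)"
  unfolding lin_at_def by (simp add: D_add_dir D_scale_dir)

lemma D_cong:
  assumes u: "u \<in> T p" and Y: "vf p Y" and eq: "\<forall>\<^sub>F q in nhds p. Y q = Z q"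
  shows "D p u Y = D p u Z"
proof -
  let ?k = "\<lambda>q. if Y q = Z q then 1 else 0 :: real"
  note k = smooth_agreement_indicator[OF eq] and Z = vfield_cong[OF eq Y]
  have kp: "Y p = Z p" using eventually_nhds_x_imp_x[OF eq] .
  have "\<forall>\<^sub>F q in nhds p. ?k q = 1" using eq by eventually_elim simp
  then have uk: "u ?k = 0" using tangent_cong[OF u, of ?k "\<lambda>_. 1"] tangent_const[OF u, of 1] by simp
  have "(\<lambda>q. ?k q *\<^sub>R Y q) = (\<lambda>q. ?k q *\<^sub>R Z q)" by (rule ext) simp
  then have "D p u (\<lambda>q. ?k q *\<^sub>R Y q) = D p u (\<lambda>q. ?k q *\<^sub>R Z q)" by (rule arg_cong)
  then show ?thesis
    unfolding D_scale[OF u Y k] D_scale[OF u Z k] uk using kp by simp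
qed

lemma D_minus: "u \<in> T p \<Longrightarrow> vf p Y \<Longrightarrow> D p u (\<lambda>q. - Y q) = - D p u Y"
  using D_scale[OF _ _ smooth_at_const, of u p Y "-1"] tangent_const[of u p "-1"] by simp

lemma D_diff: "u \<in> T p \<Longrightarrow> vf p Y \<Longrightarrow> vf p Z \<Longrightarrow> D p u (\<lambda>q. Y q - Z q) = D p u Y - D p u Z"
  using D_add[of u p Y "\<lambda>q. - Z q"] D_minus[of u p Z] vfield_cscale[of p Z "-1"] by simp

lemma D_sum:
  assumes "u \<in> T p" "\<And>i. i \<in> I \<Longrightarrow> vf p (Y i)"
  shows "D p u (\<lambda>q. \<Sum>i\<in>I. Y i q) = (\<Sum>i\<in>I. D p u (Y i))"
proof -
  have "D p u (\<lambda>q. 0) = 0"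
    using D_scale[OF assms(1) vfield_zero smooth_at_const, of 0] tangent_const[OF assms(1), of 0] by simp
  then show ?thesis using assms(2)
    by (induction I rule: infinite_finite_induct) (simp_all add: D_add[OF assms(1)] vfield_sum)
qed

text \<open>Subtracting from an arbitrary extension \<open>X\<close> the centred coordinates times the coordinate covariant
  derivatives of \<open>X\<close> keeps the value at \<open>p\<close> and cancels the derivative there.\<close>

lemma ex_parallel_extension:
  assumes "x \<in> T p"
  obtains X where "extends_vec A p X x" "\<And>v. v \<in> T p \<Longrightarrow> D p v X = 0"
proof -
  obtain U \<phi> where c: "(U, \<phi>) \<in> A" "p \<in> U" by (rule ex_chart)
  let ?C = "coord_vec (U, \<phi>)"
  note C = vfield_coord_vec[OF c]
  obtain W where W: "extends_vec A p W x" using ex_extension[OF assms] .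
  then have Wv: "vf p W" and Wp: "W p = x" by (auto simp: extends_vec_def)
  define k where "k i q = \<phi> q $ i - \<phi> p $ i" for i q
  define Y where "Y i q = D q (?C i q) W" for i q
  define X where "X q = W q - (\<Sum>i\<in>UNIV. k i q *\<^sub>R Y i q)" for q
  have k: "smooth_at A p (k i)" for i
    unfolding k_def by (intro smooth_at_diff smooth_at_coordinate[OF c] smooth_at_const)
  have Y: "vf p (Y i)" for i unfolding Y_def by (rule vf_D[OF C Wv])
  have kY: "vf p (\<lambda>q. k i q *\<^sub>R Y i q)" for i by (rule vfield_scale[OF k Y])
  have Xv: "vf p X" unfolding X_def[abs_def] by (intro vfield_diff vfield_sum Wv kY)
  have kp: "k i p = 0" for i by (simp add: k_def)
  show ?thesis
  proof
    show "extends_vec A p X x" using Xv Wp by (simp add: extends_vec_def X_def kp)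
    show "D p v X = 0" if v: "v \<in> T p" for v
    proof -
      have vk: "v (k i) = v (\<lambda>q. \<phi> q $ i)" for i
        unfolding k_def
        by (simp add: tangent_diff[OF v] tangent_const[OF v] smooth_at_coordinate[OF c] smooth_at_const)
      have "D p v X = D p v W - (\<Sum>i\<in>UNIV. v (\<lambda>q. \<phi> q $ i) *\<^sub>R D p (?C i p) W)"
        unfolding X_def[abs_def] D_diff[OF v Wv vfield_sum[OF kY]] D_sum[OF v kY] D_scale[OF v Y k] vk kp
        by (simp add: Y_def)
      also have "(\<Sum>i\<in>UNIV. v (\<lambda>q. \<phi> q $ i) *\<^sub>R D p (?C i p) W) = D p (\<Sum>i\<in>UNIV. v (\<lambda>q. \<phi> q $ i) *\<^sub>R ?C i p) W"
        by (simp add: lin_at_sum[OF lin_at_D[OF Wv]] D_scale_dir Wv tangent_closed(2) vfield_tangent[OF C])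
      also have "\<dots> = D p v W" using tangent_coord_expansion[OF c v] by simp
      finally show ?thesis by (simp add: fun_eq_iff)
    qed
  qed
qed

end

section \<open>Curvature\<close>

context riemannian_manifold
begin

abbreviation cf :: "'a vfield \<Rightarrow> 'a vfield \<Rightarrow> 'a vfield \<Rightarrow> 'a vfield"
  where "cf \<equiv> curvature_fields A g"

abbreviation R :: "'a \<Rightarrow> 'a tvec \<Rightarrow> 'a tvec \<Rightarrow> 'a tvec \<Rightarrow> 'a tvec"
  where "R \<equiv> curvature A g"

lemma cf_eq: "cf X Y Z p =
    D p (X p) (\<lambda>q. D q (Y q) Z) - D p (Y p) (\<lambda>q. D q (X q) Z) - D p (lb X Y p) Z"
  by (simp add: curvature_fields_def Let_def)

lemma vf_cf: "vf p X \<Longrightarrow> vf p Y \<Longrightarrow> vf p Z \<Longrightarrow> vf p (cf X Y Z)"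
  unfolding cf_eq[abs_def] by (intro vfield_diff vf_D vfield_lie_bracket)

lemma cf_swap:
  assumes "vf p X" "vf p Y" "vf p Z"
  shows "cf X Y Z p = - cf Y X Z p"
  using D_scale_dir[OF vfield_tangent[OF vfield_lie_bracket[OF assms(1,2)]] assms(3), of "-1"]
    lie_bracket_swap[of Y X p] by (simp add: cf_eq)

lemma D_D_add_dir:
  assumes "v \<in> T p" "vf p X" "vf p Y" "vf p Z"
  shows "D p v (\<lambda>q. D q (X q + Y q) Z) = D p v (\<lambda>q. D q (X q) Z) + D p v (\<lambda>q. D q (Y q) Z)"
proof -
  have "\<forall>\<^sub>F q in nhds p. D q (X q + Y q) Z = D q (X q) Z + D q (Y q) Z"
    using vfield_eventually[OF assms(2)] vfield_eventually[OF assms(3)] vfield_eventually[OF assms(4)]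
    by eventually_elim (intro D_add_dir vfield_tangent)
  from D_cong[OF assms(1) vf_D[OF vfield_add[OF assms(2,3)] assms(4)] this] show ?thesis
    by (simp add: D_add vf_D assms)
qed

lemma D_D_scale_dir:
  assumes "v \<in> T p" "smooth_at A p k" "vf p X" "vf p Z"
  shows "D p v (\<lambda>q. D q (k q *\<^sub>R X q) Z) = v k *\<^sub>R D p (X p) Z + k p *\<^sub>R D p v (\<lambda>q. D q (X q) Z)"
proof -
  have "\<forall>\<^sub>F q in nhds p. D q (k q *\<^sub>R X q) Z = k q *\<^sub>R D q (X q) Z"
    using vfield_eventually[OF assms(3)] vfield_eventually[OF assms(4)]
    by eventually_elim (intro D_scale_dir vfield_tangent)
  from D_cong[OF assms(1) vf_D[OF vfield_scale[OF assms(2,3)] assms(4)] this] show ?thesis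
    by (simp add: D_scale vf_D assms)
qed

lemma D_D_add:
  assumes "v \<in> T p" "vf p X" "vf p Y" "vf p Z"
  shows "D p v (\<lambda>q. D q (X q) (\<lambda>r. Y r + Z r)) = D p v (\<lambda>q. D q (X q) Y) + D p v (\<lambda>q. D q (X q) Z)"
proof -
  have "\<forall>\<^sub>F q in nhds p. D q (X q) (\<lambda>r. Y r + Z r) = D q (X q) Y + D q (X q) Z"
    using vfield_eventually[OF assms(2)] vfield_eventually[OF assms(3)] vfield_eventually[OF assms(4)]
    by eventually_elim (intro D_add vfield_tangent)
  from D_cong[OF assms(1) vf_D[OF assms(2) vfield_add[OF assms(3,4)]] this] show ?thesis
    by (simp add: D_add vf_D assms)
qed

text \<open>These second-order Leibniz rules are what makes the curvature linear over the smooth functions: the terms that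
  differentiate the coefficient are either symmetric in the two directions or cancelled by the bracket.\<close>

lemma D_D_scale:
  assumes "v \<in> T p" "smooth_at A p k" "vf p X" "vf p Z"
  shows "D p v (\<lambda>q. D q (X q) (\<lambda>r. k r *\<^sub>R Z r)) =
    v (\<lambda>q. X q k) *\<^sub>R Z p + X p k *\<^sub>R D p v Z + v k *\<^sub>R D p (X p) Z + k p *\<^sub>R D p v (\<lambda>q. D q (X q) Z)"
proof -
  have "\<forall>\<^sub>F q in nhds p. D q (X q) (\<lambda>r. k r *\<^sub>R Z r) = X q k *\<^sub>R Z q + k q *\<^sub>R D q (X q) Z"
    using vfield_eventually[OF assms(3)] vfield_eventually[OF assms(4)] smooth_at_eventually[OF assms(2)]
    by eventually_elim (intro D_scale vfield_tangent)
  from D_cong[OF assms(1) vf_D[OF assms(3) vfield_scale[OF assms(2,4)]] this] show ?thesis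
    by (simp add: D_add D_scale vf_D vfield_scale vfield_smooth assms)
qed

lemma cf_tensorial1:
  assumes Y: "vf p Y" and Z: "vf p Z"
  shows "tensorial_at p (\<lambda>X. cf X Y Z p)"
proof (rule tensorial_atI)
  note t = vfield_tangent[OF Y]
  fix X X' assume X: "vf p X" and X': "vf p X'"
  show "cf (\<lambda>q. X q + X' q) Y Z p = cf X Y Z p + cf X' Y Z p"
    using vfield_tangent[OF X] vfield_tangent[OF X'] t X X' Y Z
    by (simp add: cf_eq D_add_dir vf_D D_D_add_dir lie_bracket_add
        vfield_tangent[OF vfield_lie_bracket[OF X Y]] vfield_tangent[OF vfield_lie_bracket[OF X' Y]])
next
  fix k X assume k: "smooth_at A p k" and X: "vf p X"
  note tL = vfield_tangent[OF vfield_lie_bracket[OF X Y]]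
  have "D p (k p *\<^sub>R lb X Y p - Y p k *\<^sub>R X p) Z = k p *\<^sub>R D p (lb X Y p) Z + (- Y p k) *\<^sub>R D p (X p) Z"
    using D_add_dir[OF tangent_closed(2)[OF tL] tangent_closed(2)[OF vfield_tangent[OF X]] Z, of "k p" "- Y p k"]
      D_scale_dir[OF tL Z] D_scale_dir[OF vfield_tangent[OF X] Z, of "- Y p k"] by simp
  then show "cf (\<lambda>q. k q *\<^sub>R X q) Y Z p = k p *\<^sub>R cf X Y Z p"
    using vfield_tangent[OF X] vfield_tangent[OF Y] X Y Z k
    by (simp add: cf_eq D_scale_dir vf_D D_D_scale_dir lie_bracket_scale scaleR_diff_right)
qed

lemma cf_tensorial2:
  assumes X: "vf p X" and Z: "vf p Z"
  shows "tensorial_at p (\<lambda>Y. cf X Y Z p)"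
proof (rule tensorial_atI)
  note t = cf_tensorial1[OF X Z]
  show "cf X (\<lambda>q. Y q + Y' q) Z p = cf X Y Z p + cf X Y' Z p" if "vf p Y" "vf p Y'" for Y Y'
    using tensorial_add[OF t that] that X Z by (simp add: cf_swap[of p X] vfield_add)
  show "cf X (\<lambda>q. k q *\<^sub>R Y q) Z p = k p *\<^sub>R cf X Y Z p" if "smooth_at A p k" "vf p Y" for k Y
    using tensorial_scale[OF t that] that X Z by (simp add: cf_swap[of p X] vfield_scale)
qed

lemma cf_tensorial3:
  assumes X: "vf p X" and Y: "vf p Y"
  shows "tensorial_at p (\<lambda>Z. cf X Y Z p)"
proof (rule tensorial_atI)
  note t = vfield_tangent[OF X] vfield_tangent[OF Y] vfield_tangent[OF vfield_lie_bracket[OF X Y]]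
  show "cf X Y (\<lambda>q. Z q + Z' q) p = cf X Y Z p + cf X Y Z' p" if "vf p Z" "vf p Z'" for Z Z'
    using t X Y that by (simp add: cf_eq D_D_add D_add)
  show "cf X Y (\<lambda>q. k q *\<^sub>R Z q) p = k p *\<^sub>R cf X Y Z p" if k: "smooth_at A p k" and "vf p Z" for k Z
    using t X Y that by (simp add: cf_eq D_D_scale D_scale lie_bracket_smooth[OF k] algebra_simps)
qed

lemma curvature_eq:
  assumes X: "vf p X" and Y: "vf p Y" and Z: "vf p Z"
  shows "R p (X p) (Y p) (Z p) = cf X Y Z p"
  unfolding curvature_def
proof (rule the_equality)
  show "\<forall>X' Y' Z'. extends_vec A p X' (X p) \<and> extends_vec A p Y' (Y p) \<and> extends_vec A p Z' (Z p) \<longrightarrow>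
      cf X Y Z p = cf X' Y' Z' p"
  proof (intro allI impI)
    fix X' Y' Z'
    assume "extends_vec A p X' (X p) \<and> extends_vec A p Y' (Y p) \<and> extends_vec A p Z' (Z p)"
    then have v: "vf p X'" "vf p Y'" "vf p Z'" and eq: "X p = X' p" "Y p = Y' p" "Z p = Z' p"
      by (auto simp: extends_vec_def)
    have "cf X Y Z p = cf X' Y Z p" by (rule tensorial_pointwise[OF cf_tensorial1[OF Y Z] X v(1) eq(1)])
    also have "\<dots> = cf X' Y' Z p" by (rule tensorial_pointwise[OF cf_tensorial2[OF v(1) Z] Y v(2) eq(2)])
    also have "\<dots> = cf X' Y' Z' p" by (rule tensorial_pointwise[OF cf_tensorial3[OF v(1,2)] Z v(3) eq(3)])
    finally show "cf X Y Z p = cf X' Y' Z' p" .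
  qed
  show "w = cf X Y Z p" if "\<forall>X' Y' Z'. extends_vec A p X' (X p) \<and> extends_vec A p Y' (Y p) \<and>
      extends_vec A p Z' (Z p) \<longrightarrow> w = cf X' Y' Z' p" for w
    using that X Y Z unfolding extends_vec_def by blast
qed

text \<open>Extending \<open>u\<close> and \<open>v\<close> to fields turns linearity over functions into linearity on the tangent space.\<close>

lemma tensorial_lin_at:
  assumes "tensorial_at p L" "\<And>X. vf p X \<Longrightarrow> l (X p) = L X"
  shows "lin_at p l"
  unfolding lin_at_def
proof (intro conjI ballI allI)
  show "l (u + v) = l u + l v" if u: "u \<in> T p" and v: "v \<in> T p" for u v
    using assms(2)[OF vfield_add[OF extension_at(1)[OF u] extension_at(1)[OF v]]]
      assms(2)[OF extension_at(1)[OF u]] assms(2)[OF extension_at(1)[OF v]]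
      tensorial_add[OF assms(1) extension_at(1)[OF u] extension_at(1)[OF v]]
    by (simp add: extension_at(2) u v)
  show "l (c *\<^sub>R u) = c *\<^sub>R l u" if u: "u \<in> T p" for c u
    using assms(2)[OF vfield_cscale[OF extension_at(1)[OF u]]] assms(2)[OF extension_at(1)[OF u]]
      tensorial_scale[OF assms(1) smooth_at_const extension_at(1)[OF u], of c]
    by (simp add: extension_at(2) u)
qed

lemma curvature_lin1:
  assumes "y \<in> T p" "z \<in> T p" shows "lin_at p (\<lambda>x. R p x y z)"
  by (rule tensorial_lin_at[OF cf_tensorial1[OF extension_at(1)[OF assms(1)] extension_at(1)[OF assms(2)]]])
    (use curvature_eq[OF _ extension_at(1)[OF assms(1)] extension_at(1)[OF assms(2)]] in
      \<open>simp add: extension_at(2) assms\<close>)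

lemma curvature_lin2:
  assumes "x \<in> T p" "z \<in> T p" shows "lin_at p (\<lambda>y. R p x y z)"
  by (rule tensorial_lin_at[OF cf_tensorial2[OF extension_at(1)[OF assms(1)] extension_at(1)[OF assms(2)]]])
    (use curvature_eq[OF extension_at(1)[OF assms(1)] _ extension_at(1)[OF assms(2)]] in
      \<open>simp add: extension_at(2) assms\<close>)

lemma curvature_lin3:
  assumes "x \<in> T p" "y \<in> T p" shows "lin_at p (\<lambda>z. R p x y z)"
  by (rule tensorial_lin_at[OF cf_tensorial3[OF extension_at(1)[OF assms(1)] extension_at(1)[OF assms(2)]]])
    (use curvature_eq[OF extension_at(1)[OF assms(1)] extension_at(1)[OF assms(2)]] in
      \<open>simp add: extension_at(2) assms\<close>)

lemma curvature_tangent: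
  assumes "x \<in> T p" "y \<in> T p" "z \<in> T p" shows "R p x y z \<in> T p"
proof -
  note X = extension_at[OF assms(1)] and Y = extension_at[OF assms(2)] and Z = extension_at[OF assms(3)]
  show ?thesis using curvature_eq[OF X(1) Y(1) Z(1)] vfield_tangent[OF vf_cf[OF X(1) Y(1) Z(1)]]
    by (simp add: X(2) Y(2) Z(2))
qed

lemma curvature_swap:
  assumes "x \<in> T p" "y \<in> T p" "z \<in> T p"
  shows "R p x y z = - R p y x z"
proof -
  note X = extension_at[OF assms(1)] and Y = extension_at[OF assms(2)] and Z = extension_at[OF assms(3)]
  show ?thesis using curvature_eq[OF X(1) Y(1) Z(1)] curvature_eq[OF Y(1) X(1) Z(1)] cf_swap[OF X(1) Y(1) Z(1)]
    by (simp add: X(2) Y(2) Z(2))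
qed

lemma second_deriv_g:
  assumes v: "v \<in> T p" and X: "vf p X" and Z: "vf p Z" and W: "vf p W"
  shows "v (\<lambda>q. X q (\<lambda>r. g r (Z r) (W r))) =
    g p (D p v (\<lambda>q. D q (X q) Z)) (W p) + g p (D p (X p) Z) (D p v W) +
    (g p (D p v Z) (D p (X p) W) + g p (Z p) (D p v (\<lambda>q. D q (X q) W)))"
proof -
  have "\<forall>\<^sub>F q in nhds p. X q (\<lambda>r. g r (Z r) (W r)) = g q (D q (X q) Z) (W q) + g q (Z q) (D q (X q) W)"
    using vfield_eventually[OF X] vfield_eventually[OF Z] vfield_eventually[OF W]
    by eventually_elim (intro D_metric vfield_tangent)
  then have "v (\<lambda>q. X q (\<lambda>r. g r (Z r) (W r))) = v (\<lambda>q. g q (D q (X q) Z) (W q) + g q (Z q) (D q (X q) W))"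
    by (rule tangent_cong[OF v])
  then show ?thesis
    by (simp add: tangent_add[OF v] D_metric[OF v] g_smooth vf_D X Z W)
qed

text \<open>The commutator of second derivatives of \<open>g(Z, W)\<close> is its derivative along the Lie bracket.\<close>

lemma curvature_skew:
  assumes "x \<in> T p" "y \<in> T p" "z \<in> T p" "w \<in> T p"
  shows "g p (R p x y z) w = - g p (R p x y w) z"
proof -
  note X = extension_at(1)[OF assms(1)] and Y = extension_at(1)[OF assms(2)]
    and Z = extension_at(1)[OF assms(3)] and W = extension_at(1)[OF assms(4)]
  let ?X = "extension_at p x" and ?Y = "extension_at p y" and ?Z = "extension_at p z" and ?W = "extension_at p w"
  have ev: "?X p = x" "?Y p = y" "?Z p = z" "?W p = w" using extension_at(2) assms by auto
  have L: "lb ?X ?Y p \<in> T p" by (rule vfield_tangent[OF vfield_lie_bracket[OF X Y]])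
  have t: "D p x (\<lambda>q. D q (?Y q) V) \<in> T p" "D p y (\<lambda>q. D q (?X q) V) \<in> T p" "D p (lb ?X ?Y p) V \<in> T p"
    "D p x V \<in> T p" "D p y V \<in> T p" if "vf p V" for V
    using that by (auto intro!: D_tangent vf_D X Y assms L)
  have "lb ?X ?Y p (\<lambda>q. g q (?Z q) (?W q)) =
      ?X p (\<lambda>q. ?Y q (\<lambda>r. g r (?Z r) (?W r))) - ?Y p (\<lambda>q. ?X q (\<lambda>r. g r (?Z r) (?W r)))"
    by (rule lie_bracket_smooth) (intro g_smooth Z W)
  then have "g p (cf ?X ?Y ?Z p) w + g p (cf ?X ?Y ?W p) z = 0"
    unfolding D_metric[OF L Z W] ev second_deriv_g[OF assms(1) Y Z W] second_deriv_g[OF assms(2) X Z W] cf_eq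
    using t[OF Z] t[OF W] assms g_sym[of z p] by (simp add: g_bilinear tangent_closed)
  then show ?thesis using curvature_eq[OF X Y Z] curvature_eq[OF X Y W] unfolding ev by simp
qed

lemma lie_bracket_jacobi:
  assumes X: "vf p X" and Y: "vf p Y" and Z: "vf p Z"
  shows "lb X (lb Y Z) p + lb Y (lb Z X) p + lb Z (lb X Y) p = 0"
proof
  fix h
  show "(lb X (lb Y Z) p + lb Y (lb Z X) p + lb Z (lb X Y) p) h = 0 h"
  proof (cases "smooth_at A p h")
    case h: True
    have *: "V p (\<lambda>q. lb U W q h) = V p (\<lambda>q. U q (\<lambda>r. W r h)) - V p (\<lambda>q. W q (\<lambda>r. U r h))"
      if V: "vf p V" and U: "vf p U" and W: "vf p W" for U V W
    proof -
      have "\<forall>\<^sub>F q in nhds p. lb U W q h = U q (\<lambda>r. W r h) - W q (\<lambda>r. U r h)"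
        using smooth_at_eventually[OF h] by eventually_elim (rule lie_bracket_smooth)
      from tangent_cong[OF vfield_tangent[OF V] this] show ?thesis
        by (simp add: tangent_diff[OF vfield_tangent[OF V]] vfield_smooth[OF U] vfield_smooth[OF W] h)
    qed
    show ?thesis
      by (simp add: lie_bracket_smooth[of p] h * X Y Z vfield_smooth[OF X] vfield_smooth[OF Y] vfield_smooth[OF Z])
  qed (simp add: lie_bracket_def)
qed

text \<open>For fields that are parallel at \<open>p\<close> the cyclic sum of curvatures is the cyclic sum of double brackets.\<close>

lemma curvature_bianchi:
  assumes "x \<in> T p" "y \<in> T p" "z \<in> T p"
  shows "R p x y z + R p y z x + R p z x y = 0"
proof -
  obtain X where X': "extends_vec A p X x" and DX: "\<And>v. v \<in> T p \<Longrightarrow> D p v X = 0"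
    by (rule ex_parallel_extension[OF assms(1)]) (rule that)
  obtain Y where Y': "extends_vec A p Y y" and DY: "\<And>v. v \<in> T p \<Longrightarrow> D p v Y = 0"
    by (rule ex_parallel_extension[OF assms(2)]) (rule that)
  obtain Z where Z': "extends_vec A p Z z" and DZ: "\<And>v. v \<in> T p \<Longrightarrow> D p v Z = 0"
    by (rule ex_parallel_extension[OF assms(3)]) (rule that)
  have X: "vf p X" and Y: "vf p Y" and Z: "vf p Z" and ev: "X p = x" "Y p = y" "Z p = z"
    using X' Y' Z' by (auto simp: extends_vec_def)
  have lb0: "lb V W p = 0" if "vf p V" "vf p W" "\<And>v. v \<in> T p \<Longrightarrow> D p v V = 0" "\<And>v. v \<in> T p \<Longrightarrow> D p v W = 0" for V W
    using D_torsion[OF that(1,2)] that(3)[OF vfield_tangent[OF that(2)]] that(4)[OF vfield_tangent[OF that(1)]] by simp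
  have D0: "D p 0 V = 0" if "vf p V" for V using D_scale_dir[OF tangent_closed(6) that, of 0] by simp
  have *: "D p (U p) (\<lambda>q. D q (V q) W) - D p (U p) (\<lambda>q. D q (W q) V) = lb U (lb V W) p"
    if U: "vf p U" and V: "vf p V" and W: "vf p W" and DU: "\<And>v. v \<in> T p \<Longrightarrow> D p v U = 0" for U V W
  proof -
    have "\<forall>\<^sub>F q in nhds p. lb V W q = D q (V q) W - D q (W q) V"
      using vfield_eventually[OF V] vfield_eventually[OF W] by eventually_elim (rule D_torsion)
    from D_cong[OF vfield_tangent[OF U] vfield_lie_bracket[OF V W] this]
    have "D p (U p) (lb V W) = D p (U p) (\<lambda>q. D q (V q) W) - D p (U p) (\<lambda>q. D q (W q) V)"
      by (simp add: D_diff vfield_tangent[OF U] vf_D V W)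
    then show ?thesis
      using D_torsion[OF U vfield_lie_bracket[OF V W]] DU[OF vfield_tangent[OF vfield_lie_bracket[OF V W]]] by simp
  qed
  have "cf X Y Z p + cf Y Z X p + cf Z X Y p = lb X (lb Y Z) p + lb Y (lb Z X) p + lb Z (lb X Y) p"
  proof -
    have "D p (X p) (\<lambda>q. D q (Y q) Z) - D p (X p) (\<lambda>q. D q (Z q) Y) = lb X (lb Y Z) p" by (rule *[OF X Y Z DX])
    moreover have "D p (Y p) (\<lambda>q. D q (Z q) X) - D p (Y p) (\<lambda>q. D q (X q) Z) = lb Y (lb Z X) p" by (rule *[OF Y Z X DY])
    moreover have "D p (Z p) (\<lambda>q. D q (X q) Y) - D p (Z p) (\<lambda>q. D q (Y q) X) = lb Z (lb X Y) p" by (rule *[OF Z X Y DZ])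
    moreover have "lb X Y p = 0" "lb Y Z p = 0" "lb Z X p = 0" by (simp_all add: lb0 X Y Z DX DY DZ)
    ultimately show ?thesis unfolding cf_eq by (simp only: D0 X Y Z) (simp add: algebra_simps)
  qed
  then show ?thesis
    using lie_bracket_jacobi[OF X Y Z] curvature_eq[OF X Y Z] curvature_eq[OF Y Z X] curvature_eq[OF Z X Y]
    unfolding ev by simp
qed

section \<open>Traces and the Schouten tensor\<close>

definition bilin_at :: "'a \<Rightarrow> ('a tvec \<Rightarrow> 'a tvec \<Rightarrow> real) \<Rightarrow> bool"
  where "bilin_at p b \<longleftrightarrow> (\<forall>u\<in>T p. lin_at p (b u) \<and> lin_at p (\<lambda>v. b v u))"

lemma bilin_left: "bilin_at p b \<Longrightarrow> v \<in> T p \<Longrightarrow> lin_at p (\<lambda>u. b u v)"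
  and bilin_right: "bilin_at p b \<Longrightarrow> u \<in> T p \<Longrightarrow> lin_at p (b u)"
  unfolding bilin_at_def by blast+

lemma bilin_at_g: "bilin_at p (g p)"
  unfolding bilin_at_def lin_at_def by (simp add: g_bilinear)

text \<open>For a basis \<open>B\<close> expand \<open>S i\<close> in \<open>B\<close> and \<open>L b\<close> in \<open>S\<close>: both traces become the same double sum.\<close>

lemma trace_on_onf:
  assumes L: "lin_at p L" "\<And>u. u \<in> T p \<Longrightarrow> L u \<in> T p" and S: "orthonormal_frame A g p S"
  shows "trace_on (T p) L = (\<Sum>i\<in>UNIV. g p (L (S i)) (S i))"
  unfolding trace_on_def
proof (rule the_equality)
  note SA = onf_tangent[OF S]
  have main: "(\<Sum>i\<in>UNIV. g p (L (S i)) (S i)) = (\<Sum>b\<in>B. representation B (L b) b)"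
    if B: "independent B" "span B = T p" for B
  proof -
    have BT: "b \<in> T p" if "b \<in> B" for b using that B(2) span_base[of b B] by simp
    then have fin: "finite B" using tangent_independent_bound[OF B(1), of p] by blast
    have 1: "g p (L (S i)) (S i) = (\<Sum>b\<in>B. representation B (S i) b * g p (L b) (S i))" for i
    proof -
      have "S i = (\<Sum>b\<in>B. representation B (S i) b *\<^sub>R b)"
        using sum_representation_eq[OF B(1) _ fin, of "S i"] SA B(2) by simp
      then have "L (S i) = L (\<Sum>b\<in>B. representation B (S i) b *\<^sub>R b)" by simp
      also have "\<dots> = (\<Sum>b\<in>B. representation B (S i) b *\<^sub>R L b)"
        by (simp add: lin_at_sum[OF L(1)] BT tangent_closed(2) lin_at_scale[OF L(1)])
      finally show ?thesis
        by (simp add: g_sum_left BT L(2) tangent_closed(2) SA g_scale_left)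
    qed
    have 2: "representation B (L b) b = (\<Sum>i\<in>UNIV. g p (L b) (S i) * representation B (S i) b)" if "b \<in> B" for b
    proof -
      have "representation B (L b) b = representation B (\<Sum>i\<in>UNIV. g p (L b) (S i) *\<^sub>R S i) b"
        using onf_expand[OF S L(2)[OF BT[OF that]]] by simp
      also have "\<dots> = (\<Sum>i\<in>UNIV. g p (L b) (S i) * representation B (S i) b)"
        using SA B(2) by (simp add: representation_sum[OF B(1)] representation_scale[OF B(1)] tangent_closed(2))
      finally show ?thesis .
    qed
    show ?thesis unfolding 1 by (subst sum.swap) (simp add: 2 mult.commute)
  qed
  then show "\<forall>B. independent B \<and> span B = T p \<longrightarrow>
      (\<Sum>i\<in>UNIV. g p (L (S i)) (S i)) = (\<Sum>b\<in>B. representation B (L b) b)" by blast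
  obtain B where B: "B \<subseteq> T p" "independent B" "T p \<subseteq> span B" using basis_exists[of "T p"] by metis
  then have "span B = T p" using span_minimal[OF B(1) subspace_tangent] by auto
  then show "t = (\<Sum>i\<in>UNIV. g p (L (S i)) (S i))"
    if "\<forall>B. independent B \<and> span B = T p \<longrightarrow> t = (\<Sum>b\<in>B. representation B (L b) b)" for t
    using that main B(2) by simp
qed

lemma metric_trace_onf:
  assumes b: "bilin_at p (b p)" and S: "orthonormal_frame A g p S"
  shows "metric_trace A g b p = (\<Sum>i\<in>UNIV. b p (S i) (S i))"
  unfolding metric_trace_def
proof (rule the_equality)
  have main: "(\<Sum>i\<in>UNIV. b p (S i) (S i)) = (\<Sum>i\<in>UNIV. b p (S' i) (S' i))"
    if S': "orthonormal_frame A g p S'" for S'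
  proof -
    note t = onf_tangent[OF S] and t' = onf_tangent[OF S']
    have "(\<Sum>i\<in>UNIV. b p (S' i) (S' i)) = (\<Sum>i\<in>UNIV. \<Sum>j\<in>UNIV. g p (S' i) (S j) * b p (S j) (S' i))"
      by (simp add: lin_at_expand[OF bilin_left[OF b t'] S t'] del: sum.swap)
    also have "\<dots> = (\<Sum>j\<in>UNIV. \<Sum>i\<in>UNIV. g p (S j) (S' i) * b p (S j) (S' i))"
      by (subst sum.swap) (simp add: g_sym[OF t t'])
    also have "\<dots> = (\<Sum>j\<in>UNIV. b p (S j) (S j))"
    proof (intro sum.cong refl)
      show "(\<Sum>i\<in>UNIV. g p (S j) (S' i) * b p (S j) (S' i)) = b p (S j) (S j)" for j
        using lin_at_expand[OF bilin_right[OF b t] S' t, of j j] by simp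
    qed
    finally show ?thesis by simp
  qed
  then show "\<forall>S'. orthonormal_frame A g p S' \<longrightarrow>
      (\<Sum>i\<in>UNIV. b p (S i) (S i)) = (\<Sum>i\<in>UNIV. b p (S' i) (S' i))" by blast
  show "t = (\<Sum>i\<in>UNIV. b p (S i) (S i))"
    if "\<forall>S. orthonormal_frame A g p S \<longrightarrow> t = (\<Sum>i\<in>UNIV. b p (S i) (S i))" for t
    using that S by blast
qed

lemma ricci_onf:
  assumes S: "orthonormal_frame A g p S" and u: "u \<in> T p" and v: "v \<in> T p"
  shows "ricci A g p u v = (\<Sum>i\<in>UNIV. g p (R p (S i) u v) (S i))"
  unfolding ricci_def by (rule trace_on_onf[OF curvature_lin1[OF u v] curvature_tangent[OF _ u v] S])

lemma bilin_at_ricci: "bilin_at p (ricci A g p)"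
proof -
  obtain S where S: "orthonormal_frame A g p S" by (rule ex_onf)
  note t = onf_tangent[OF S] and l2 = curvature_lin2[OF onf_tangent[OF S]] and l3 = curvature_lin3[OF onf_tangent[OF S]]
  show ?thesis unfolding bilin_at_def lin_at_def
    by (simp add: ricci_onf[OF S] tangent_closed lin_at_add[OF l2] lin_at_scale[OF l2]
        lin_at_add[OF l3] lin_at_scale[OF l3] curvature_tangent t g_bilinear sum.distrib sum_distrib_left)
qed

text \<open>In the Bianchi identity for \<open>S i, u, v\<close>, paired with \<open>S i\<close>, the term with \<open>R p u v\<close> vanishes by skewness.\<close>

lemma ricci_sym:
  assumes u: "u \<in> T p" and v: "v \<in> T p"
  shows "ricci A g p u v = ricci A g p v u"
proof -
  obtain S where S: "orthonormal_frame A g p S" by (rule ex_onf)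
  have "g p (R p (S i) u v) (S i) = g p (R p (S i) v u) (S i)" for i
  proof -
    note s = onf_tangent[OF S, of i]
    have "g p (R p (S i) u v + R p u v (S i) + R p v (S i) u) (S i) = 0"
      using curvature_bianchi[OF s u v] g_zero(1)[OF s] by simp
    moreover have "g p (R p u v (S i)) (S i) = 0" using curvature_skew[OF u v s s] by simp
    moreover have "g p (R p v (S i) u) (S i) = - g p (R p (S i) v u) (S i)"
      unfolding curvature_swap[OF v s u] by (rule g_minus_left) (intro curvature_tangent s u v)+
    ultimately show ?thesis using u v s by (simp add: g_add_left curvature_tangent tangent_closed(1))
  qed
  then show ?thesis by (simp add: ricci_onf[OF S] u v)
qed

lemma scal_onf: "orthonormal_frame A g p S \<Longrightarrow> scal A g p = (\<Sum>i\<in>UNIV. ricci A g p (S i) (S i))"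
  unfolding scal_def by (rule metric_trace_onf[OF bilin_at_ricci])

lemma bilin_at_schouten: "bilin_at p (schouten A g p)"
  using bilin_at_ricci[of p] bilin_at_g[of p] unfolding bilin_at_def lin_at_def schouten_def
  by (simp add: algebra_simps)

lemma schouten_sym: "u \<in> T p \<Longrightarrow> v \<in> T p \<Longrightarrow> schouten A g p u v = schouten A g p v u"
  by (simp add: schouten_def ricci_sym[of u p v] g_sym[of u p v])

lemma ricci_smooth:
  assumes Y: "vf p Y" and Z: "vf p Z"
  shows "smooth_at A p (\<lambda>q. ricci A g q (Y q) (Z q))"
proof -
  obtain E where E: "local_frame p E" by (rule ex_local_frame)
  note Ev = local_frame_vf[OF E]
  have "\<forall>\<^sub>F q in nhds p. \<forall>i. vf q (E i)"
    unfolding forall_3 by (intro eventually_conj vfield_eventually Ev)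
  moreover have "\<forall>\<^sub>F q in nhds p. orthonormal_frame A g q (\<lambda>i. E i q)" using E by (simp add: local_frame_def)
  ultimately have "\<forall>\<^sub>F q in nhds p. (\<Sum>i\<in>UNIV. g q (cf (E i) Y Z q) (E i q)) = ricci A g q (Y q) (Z q)"
    using vfield_eventually[OF Y] vfield_eventually[OF Z]
    by eventually_elim (simp add: ricci_onf vfield_tangent curvature_eq)
  then show ?thesis
    by (rule smooth_at_cong) (intro smooth_at_sum g_smooth vf_cf Ev Y Z)
qed

lemma scal_smooth: "smooth_at A p (scal A g)"
proof -
  obtain E where E: "local_frame p E" by (rule ex_local_frame)
  have "\<forall>\<^sub>F q in nhds p. orthonormal_frame A g q (\<lambda>i. E i q)" using E by (simp add: local_frame_def)
  then have "\<forall>\<^sub>F q in nhds p. (\<Sum>i\<in>UNIV. ricci A g q (E i q) (E i q)) = scal A g q"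
    by eventually_elim (simp add: scal_onf)
  then show ?thesis by (rule smooth_at_cong) (intro smooth_at_sum ricci_smooth local_frame_vf[OF E])
qed

lemma schouten_smooth:
  assumes "vf p Y" "vf p Z"
  shows "smooth_at A p (\<lambda>q. schouten A g q (Y q) (Z q))"
proof -
  have "smooth_at A p (\<lambda>q. ricci A g q (Y q) (Z q) - 1/4 * scal A g q * g q (Y q) (Z q))"
    by (intro smooth_at_diff smooth_at_mult smooth_at_const ricci_smooth scal_smooth g_smooth assms)
  then show ?thesis by (simp add: schouten_def)
qed

text \<open>The Kulkarni--Nomizu product of \<open>g\<close> and \<open>b\<close>; the order of the arguments of \<open>b\<close> is such that the product
  is skew in \<open>x, y\<close> and in \<open>z, w\<close> even if \<open>b\<close> is not symmetric.\<close>

definition kn :: "'a \<Rightarrow> ('a tvec \<Rightarrow> 'a tvec \<Rightarrow> real) \<Rightarrow> 'a tvec \<Rightarrow> 'a tvec \<Rightarrow> 'a tvec \<Rightarrow> 'a tvec \<Rightarrow> real"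
  where "kn p b x y z w = g p y z * b x w - g p x z * b y w + b y z * g p x w - b x z * g p y w"

end

text \<open>By the two skew symmetries \<open>r\<close> is given by the nine numbers \<open>r i j k l\<close> with \<open>i < j\<close> and \<open>k < l\<close>.
  The off-diagonal entries of \<open>P\<close> are, up to sign, six of them, and the diagonal entries are an invertible
  linear image of the other three, so \<open>P\<close> determines \<open>r\<close>.\<close>

lemma three_dim_curvature_components:
  fixes r :: "3 \<Rightarrow> 3 \<Rightarrow> 3 \<Rightarrow> 3 \<Rightarrow> real"
  assumes skew1: "\<And>i j k l. r i j k l = - r j i k l" and skew2: "\<And>i j k l. r i j k l = - r i j l k"
  defines "Rc \<equiv> \<lambda>j k. \<Sum>i\<in>UNIV. r i j k i"
  defines "\<delta> \<equiv> \<lambda>i j. if i = j then 1 else 0 :: real"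
  defines "P \<equiv> \<lambda>j k. Rc j k - (\<Sum>m\<in>UNIV. Rc m m) / 4 * \<delta> j k"
  shows "r i j k l = \<delta> j k * P i l - \<delta> i k * P j l + P j k * \<delta> i l - P i k * \<delta> j l"
proof -
  have z: "r i i k l = 0" "r i j k k = 0" for i j k l using skew1[of i i k l] skew2[of i j k k] by auto
  have s: "r 2 1 k l = - r 1 2 k l" "r 3 1 k l = - r 1 3 k l" "r 3 2 k l = - r 2 3 k l"
    "r i j 2 1 = - r i j 1 2" "r i j 3 1 = - r i j 1 3" "r i j 3 2 = - r i j 2 3" for i j k l
    using skew1 skew2 by blast+
  have P: "P 1 1 = (r 2 3 2 3 - r 1 2 1 2 - r 1 3 1 3) / 2" "P 2 2 = (r 1 3 1 3 - r 1 2 1 2 - r 2 3 2 3) / 2"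
    "P 3 3 = (r 1 2 1 2 - r 1 3 1 3 - r 2 3 2 3) / 2"
    "P 1 2 = - r 1 3 2 3" "P 2 1 = - r 2 3 1 3" "P 1 3 = r 1 2 2 3" "P 3 1 = r 2 3 1 2"
    "P 2 3 = - r 1 2 1 3" "P 3 2 = - r 1 3 1 2"
    by (simp_all add: P_def Rc_def \<delta>_def sum_3 z s field_simps)
  have "\<forall>i j k l. r i j k l = \<delta> j k * P i l - \<delta> i k * P j l + P j k * \<delta> i l - P i k * \<delta> j l"
    unfolding forall_3 by (simp add: P \<delta>_def z s field_simps)
  then show ?thesis by blast
qed

context riemannian_manifold
begin

lemma lin_at_eqI:
  assumes "lin_at p L" "lin_at p M" "orthonormal_frame A g p S" "\<And>i. L (S i) = M (S i)" "u \<in> T p"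
  shows "L u = M u"
  using lin_at_expand[OF assms(1,3,5)] lin_at_expand[OF assms(2,3,5)] assms(4) by simp

lemma kn_lin:
  assumes b: "bilin_at p b"
  shows "y \<in> T p \<Longrightarrow> z \<in> T p \<Longrightarrow> w \<in> T p \<Longrightarrow> lin_at p (\<lambda>x. kn p b x y z w)"
    and "x \<in> T p \<Longrightarrow> z \<in> T p \<Longrightarrow> w \<in> T p \<Longrightarrow> lin_at p (\<lambda>y. kn p b x y z w)"
    and "x \<in> T p \<Longrightarrow> y \<in> T p \<Longrightarrow> w \<in> T p \<Longrightarrow> lin_at p (\<lambda>z. kn p b x y z w)"
    and "x \<in> T p \<Longrightarrow> y \<in> T p \<Longrightarrow> z \<in> T p \<Longrightarrow> lin_at p (kn p b x y z)"
  using b bilin_at_g[of p] unfolding bilin_at_def lin_at_def kn_def by (simp_all add: algebra_simps)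

text \<open>Both sides are linear in each argument, so it suffices to compare components in an orthonormal frame.\<close>

lemma curvature_kn:
  assumes "x \<in> T p" "y \<in> T p" "z \<in> T p" "w \<in> T p"
  shows "g p (R p x y z) w = kn p (schouten A g p) x y z w"
proof -
  obtain S where S: "orthonormal_frame A g p S" by (rule ex_onf)
  note t = onf_tangent[OF S] and Rt = curvature_tangent and knl = kn_lin[OF bilin_at_schouten]
  have gl: "lin_at p (\<lambda>u. g p (l u) v)" if "lin_at p l" "\<And>u. u \<in> T p \<Longrightarrow> l u \<in> T p" "v \<in> T p" for l v
    using that by (simp add: lin_at_def g_bilinear)
  have gr: "lin_at p (\<lambda>v. g p u v)" if "u \<in> T p" for u using that by (simp add: lin_at_def g_bilinear)
  define r where "r i j k l = g p (R p (S i) (S j) (S k)) (S l)" for i j k l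
  have r1: "r i j k l = - r j i k l" for i j k l
    unfolding r_def curvature_swap[OF t t t, of i j k] by (intro g_minus_left Rt t)
  have r2: "r i j k l = - r i j l k" for i j k l unfolding r_def by (intro curvature_skew t)
  have rc: "(\<Sum>i\<in>UNIV. r i j k i) = ricci A g p (S j) (S k)" for j k
    by (simp add: ricci_onf[OF S] t r_def)
  have comp: "g p (R p (S i) (S j) (S k)) (S l) = kn p (schouten A g p) (S i) (S j) (S k) (S l)" for i j k l
    using three_dim_curvature_components[of r i j k l, OF r1 r2]
    unfolding rc kn_def schouten_def onf_g[OF S] scal_onf[OF S] unfolding r_def .
  have 1: "g p (R p (S i) (S j) (S k)) w = kn p (schouten A g p) (S i) (S j) (S k) w" for i j k
    by (rule lin_at_eqI[of p "g p (R p (S i) (S j) (S k))" "kn p (schouten A g p) (S i) (S j) (S k)" S])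
      (simp_all add: gr Rt t knl S comp assms)
  have 2: "g p (R p (S i) (S j) z) w = kn p (schouten A g p) (S i) (S j) z w" for i j
    by (rule lin_at_eqI[of p "\<lambda>z. g p (R p (S i) (S j) z) w" "\<lambda>z. kn p (schouten A g p) (S i) (S j) z w" S])
      (simp_all add: gl curvature_lin3 Rt t knl S 1 assms)
  have 3: "g p (R p (S i) y z) w = kn p (schouten A g p) (S i) y z w" for i
    by (rule lin_at_eqI[of p "\<lambda>y. g p (R p (S i) y z) w" "\<lambda>y. kn p (schouten A g p) (S i) y z w" S])
      (simp_all add: gl curvature_lin2 Rt t knl S 2 assms)
  show ?thesis
    by (rule lin_at_eqI[of p "\<lambda>x. g p (R p x y z) w" "\<lambda>x. kn p (schouten A g p) x y z w" S])
      (simp_all add: gl curvature_lin1 Rt t knl S 3 assms)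
qed

text \<open>Contracting \<open>kn p b\<close> gives \<open>b + (tr b) g\<close>, from which \<open>b\<close> is recovered.\<close>

lemma schouten_unique:
  assumes b: "bilin_at p b"
    and kn: "\<And>x y z w. x \<in> T p \<Longrightarrow> y \<in> T p \<Longrightarrow> z \<in> T p \<Longrightarrow> w \<in> T p \<Longrightarrow> g p (R p x y z) w = kn p b x y z w"
    and u: "u \<in> T p" and v: "v \<in> T p"
  shows "schouten A g p u v = b u v"
proof -
  obtain S where S: "orthonormal_frame A g p S" by (rule ex_onf)
  note t = onf_tangent[OF S]
  define tr where "tr = (\<Sum>i\<in>UNIV. b (S i) (S i))"
  have ric: "ricci A g p u v = b u v + tr * g p u v" if u: "u \<in> T p" and v: "v \<in> T p" for u v
  proof -
    have "ricci A g p u v = (\<Sum>i\<in>UNIV. b (S i) (S i) * g p u v - g p v (S i) * b u (S i) + b u v - g p u (S i) * b (S i) v)"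
      unfolding ricci_onf[OF S u v]
      by (intro sum.cong refl) (simp add: kn t u v kn_def onf_g[OF S] g_sym[OF t v])
    also have "\<dots> = tr * g p u v - (\<Sum>i\<in>UNIV. g p v (S i) * b u (S i)) + 3 * b u v - (\<Sum>i\<in>UNIV. g p u (S i) * b (S i) v)"
      by (simp add: sum.distrib sum_subtractf tr_def sum_distrib_right)
    also have "(\<Sum>i\<in>UNIV. g p v (S i) * b u (S i)) = b u v"
      using lin_at_expand[OF bilin_right[OF b u] S v] by simp
    also have "(\<Sum>i\<in>UNIV. g p u (S i) * b (S i) v) = b u v"
      using lin_at_expand[OF bilin_left[OF b v] S u] by simp
    finally show ?thesis by simp
  qed
  have "scal A g p = 4 * tr" by (simp add: scal_onf[OF S] ric t onf_g[OF S] sum.distrib tr_def)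
  then show ?thesis by (simp add: schouten_def ric u v)
qed

section \<open>Covariant derivatives of bilinear forms\<close>

text \<open>The expression that defines the covariant derivative of a bilinear form, before passing to values at \<open>p\<close>.\<close>

definition cov_deriv_fields :: "'a bform \<Rightarrow> 'a \<Rightarrow> 'a tvec \<Rightarrow> 'a vfield \<Rightarrow> 'a vfield \<Rightarrow> real"
  where "cov_deriv_fields b p x Y Z =
    x (\<lambda>q. b q (Y q) (Z q)) - b p (D p x Y) (Z p) - b p (Y p) (D p x Z)"

definition smooth_bform :: "'a bform \<Rightarrow> bool"
  where "smooth_bform b \<longleftrightarrow> (\<forall>p. bilin_at p (b p)) \<and>
    (\<forall>p Y Z. vf p Y \<and> vf p Z \<longrightarrow> smooth_at A p (\<lambda>q. b q (Y q) (Z q)))"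

lemma smooth_bform_schouten: "smooth_bform (schouten A g)"
  unfolding smooth_bform_def using bilin_at_schouten schouten_smooth by blast

lemma cov_deriv_tensorial1:
  assumes b: "smooth_bform b" and x: "x \<in> T p" and Z: "vf p Z"
  shows "tensorial_at p (\<lambda>Y. cov_deriv_fields b p x Y Z)"
proof (rule tensorial_atI)
  have bb: "bilin_at q (b q)" for q using b by (simp add: smooth_bform_def)
  have sm: "smooth_at A p (\<lambda>q. b q (Y q) (Z q))" if "vf p Y" "vf p Z" for Y Z
    using b that by (simp add: smooth_bform_def)
  note lin = lin_at_add[OF bilin_left[OF bb]] lin_at_scale[OF bilin_left[OF bb]]
  {
    fix Y Y' assume Y: "vf p Y" and Y': "vf p Y'"
    have "\<forall>\<^sub>F q in nhds p. b q (Y q + Y' q) (Z q) = b q (Y q) (Z q) + b q (Y' q) (Z q)"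
      using vfield_eventually[OF Y] vfield_eventually[OF Y'] vfield_eventually[OF Z]
      by eventually_elim (simp add: lin vfield_tangent)
    from tangent_cong[OF x this]
    show "cov_deriv_fields b p x (\<lambda>q. Y q + Y' q) Z = cov_deriv_fields b p x Y Z + cov_deriv_fields b p x Y' Z"
      by (simp add: cov_deriv_fields_def tangent_add[OF x] sm Y Y' Z D_add x lin D_tangent vfield_tangent)
  next
    fix k Y assume k: "smooth_at A p k" and Y: "vf p Y"
    have "\<forall>\<^sub>F q in nhds p. b q (k q *\<^sub>R Y q) (Z q) = k q * b q (Y q) (Z q)"
      using vfield_eventually[OF Y] vfield_eventually[OF Z]
      by eventually_elim (simp add: lin vfield_tangent)
    from tangent_cong[OF x this]
    show "cov_deriv_fields b p x (\<lambda>q. k q *\<^sub>R Y q) Z = k p *\<^sub>R cov_deriv_fields b p x Y Z"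
      by (simp add: cov_deriv_fields_def tangent_mult[OF x] sm Y Z k D_scale x lin D_tangent vfield_tangent
          tangent_closed algebra_simps)
  }
qed

lemma cov_deriv_fields_transpose:
  "cov_deriv_fields b p x Y Z = cov_deriv_fields (\<lambda>q u v. b q v u) p x Z Y"
  by (simp add: cov_deriv_fields_def)

lemma cov_deriv_tensorial2:
  assumes b: "smooth_bform b" and x: "x \<in> T p" and Y: "vf p Y"
  shows "tensorial_at p (\<lambda>Z. cov_deriv_fields b p x Y Z)"
proof -
  have "smooth_bform (\<lambda>q u v. b q v u)" using b unfolding smooth_bform_def bilin_at_def by simp
  from cov_deriv_tensorial1[OF this x Y] show ?thesis by (simp add: cov_deriv_fields_transpose[of b])
qed

lemma cov_deriv_form_eq:
  assumes b: "smooth_bform b" and x: "x \<in> T p" and Y: "vf p Y" and Z: "vf p Z"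
  shows "cov_deriv_form A g b p x (Y p) (Z p) = cov_deriv_fields b p x Y Z"
proof -
  let ?F = "cov_deriv_fields b p x"
  have "cov_deriv_form A g b p x (Y p) (Z p) = ?F Y Z"
    unfolding cov_deriv_form_def
  proof (rule the_equality)
    show "\<forall>Y' Z'. extends_vec A p Y' (Y p) \<and> extends_vec A p Z' (Z p) \<longrightarrow>
      ?F Y Z = x (\<lambda>q. b q (Y' q) (Z' q)) - b p (D p x Y') (Z p) - b p (Y p) (D p x Z')"
    proof (intro allI impI)
      fix Y' Z' assume "extends_vec A p Y' (Y p) \<and> extends_vec A p Z' (Z p)"
      then have v: "vf p Y'" "vf p Z'" and eq: "Y p = Y' p" "Z p = Z' p" by (auto simp: extends_vec_def)
      have "?F Y Z = ?F Y' Z" by (rule tensorial_pointwise[OF cov_deriv_tensorial1[OF b x Z] Y v(1) eq(1)])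
      also have "\<dots> = ?F Y' Z'" by (rule tensorial_pointwise[OF cov_deriv_tensorial2[OF b x v(1)] Z v(2) eq(2)])
      finally show "?F Y Z = x (\<lambda>q. b q (Y' q) (Z' q)) - b p (D p x Y') (Z p) - b p (Y p) (D p x Z')"
        by (simp add: cov_deriv_fields_def eq)
    qed
    show "r = ?F Y Z" if "\<forall>Y' Z'. extends_vec A p Y' (Y p) \<and> extends_vec A p Z' (Z p) \<longrightarrow>
      r = x (\<lambda>q. b q (Y' q) (Z' q)) - b p (D p x Y') (Z p) - b p (Y p) (D p x Z')" for r
      using that Y Z unfolding cov_deriv_fields_def extends_vec_def by blast
  qed
  then show ?thesis .
qed

lemma cov_deriv_lin_dir:
  assumes Y: "vf p Y" and Z: "vf p Z" and b: "smooth_bform b"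
  shows "lin_at p (\<lambda>x. cov_deriv_fields b p x Y Z)"
proof -
  have bb: "bilin_at p (b p)" using b by (simp add: smooth_bform_def)
  note lin = lin_at_add[OF bilin_left[OF bb]] lin_at_scale[OF bilin_left[OF bb]]
    lin_at_add[OF bilin_right[OF bb]] lin_at_scale[OF bilin_right[OF bb]]
  show ?thesis unfolding lin_at_def
    by (simp add: cov_deriv_fields_def D_add_dir D_scale_dir lin D_tangent vfield_tangent Y Z algebra_simps)
qed

lemma bilin_cotton_form:
  assumes z: "z \<in> T p"
  shows "bilin_at p (\<lambda>x y. cotton_form A g p x y z)"
proof -
  let ?N = "cov_deriv_form A g (schouten A g) p"
  note Z = extension_at(1)[OF z] and b = smooth_bform_schouten
  have eq: "?N x (Y p) z = cov_deriv_fields (schouten A g) p x Y (extension_at p z)" if "x \<in> T p" "vf p Y" for x Y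
    using cov_deriv_form_eq[OF b that Z] by (simp add: extension_at(2)[OF z])
  have 1: "lin_at p (\<lambda>x. ?N x y z)" if "y \<in> T p" for y
    using cov_deriv_lin_dir[OF extension_at(1)[OF that] Z b] eq[OF _ extension_at(1)[OF that]]
    by (simp add: lin_at_def extension_at(2)[OF that] tangent_closed)
  have 2: "lin_at p (\<lambda>y. ?N x y z)" if "x \<in> T p" for x
    by (rule tensorial_lin_at[OF cov_deriv_tensorial1[OF b that Z]]) (rule eq[OF that])
  show ?thesis
    using 1 2 unfolding bilin_at_def lin_at_def cotton_form_def by (simp add: algebra_simps)
qed

end

section \<open>The Hodge star\<close>

context smooth_manifold
begin

definition chart_matrix :: "'a chart \<Rightarrow> (3 \<Rightarrow> 'a tvec) \<Rightarrow> real^3^3"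
  where "chart_matrix c S = (\<chi> i j. S i (\<lambda>q. snd c q $ j))"

text \<open>Expand the frame in the coordinate fields of the first chart: the coefficients of its components in the
  second chart are the partial derivatives of the transition map.\<close>

lemma chart_matrix_change:
  assumes c: "(U, \<phi>) \<in> A" "p \<in> U" and d: "(V, \<psi>) \<in> A" "p \<in> V" and S: "\<And>i. S i \<in> tangent_space A p"
  shows "chart_matrix (V, \<psi>) S = chart_matrix (U, \<phi>) S **
    transpose (matrix (frechet_derivative (transition (U, \<phi>) (V, \<psi>)) (at (\<phi> p))))"
proof -
  let ?t = "transition (U, \<phi>) (V, \<psi>)"
  let ?L = "\<lambda>v. \<chi> j. \<Sum>l\<in>UNIV. v $ l * partial_deriv l (\<lambda>x. ?t x $ j) (\<phi> p)"
  have "(?t has_derivative ?L) (at (\<phi> p))"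
  proof (rule has_derivative_vecI)
    fix j
    have "(\<lambda>x. ?t x $ j) differentiable (at (\<phi> p))"
      by (rule smooth_on_differentiable[OF smooth_transition[OF c(1) d(1)]]) (use c d in auto)
    then show "((\<lambda>x. ?t x $ j) has_derivative (\<lambda>v. ?L v $ j)) (at (\<phi> p))"
      using has_derivative_partial by simp
  qed
  then have L: "frechet_derivative ?t (at (\<phi> p)) = ?L" by (rule frechet_derivative_at[symmetric])
  have m: "matrix (frechet_derivative ?t (at (\<phi> p))) $ j $ k = coord_vec (U, \<phi>) k p (\<lambda>q. \<psi> q $ j)" for j k
  proof -
    have "matrix (frechet_derivative ?t (at (\<phi> p))) $ j $ k = ?L (axis k 1) $ j"
      by (simp only: L matrix_def vec_lambda_beta)
    also have "\<dots> = partial_deriv k (\<lambda>x. ?t x $ j) (\<phi> p)"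
      by (simp add: axis_def if_distrib[of "\<lambda>z. z * _"] cong: if_cong)
    also have "\<dots> = coord_vec (U, \<phi>) k p (\<lambda>q. \<psi> q $ j)"
      using smooth_at_coordinate[OF d] by (simp add: coord_vec_def transition_def o_def)
    finally show ?thesis .
  qed
  have e: "S i (\<lambda>q. \<psi> q $ j) = (\<Sum>k\<in>UNIV. S i (\<lambda>q. \<phi> q $ k) * coord_vec (U, \<phi>) k p (\<lambda>q. \<psi> q $ j))" for i j
  proof -
    have "S i (\<lambda>q. \<psi> q $ j) = (\<Sum>k\<in>UNIV. S i (\<lambda>q. \<phi> q $ k) *\<^sub>R coord_vec (U, \<phi>) k p) (\<lambda>q. \<psi> q $ j)"
      using tangent_coord_expansion[OF c S[of i]] by simp
    then show ?thesis by (simp add: sum_fun_apply)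
  qed
  show ?thesis
    by (simp add: vec_eq_iff chart_matrix_def matrix_matrix_mult_def transpose_def m e)
qed

text \<open>The transition maps of an oriented atlas have positive Jacobian, so the sign is the same in all charts.\<close>

lemma positively_oriented_iff:
  assumes o: "oriented_atlas A" and c: "(U, \<phi>) \<in> A" "p \<in> U" and S: "\<And>i. S i \<in> tangent_space A p"
  shows "positively_oriented A p S \<longleftrightarrow> det (chart_matrix (U, \<phi>) S) > 0"
proof
  assume "positively_oriented A p S"
  then show "det (chart_matrix (U, \<phi>) S) > 0"
    using c unfolding positively_oriented_def chart_matrix_def by fastforce
next
  assume pos: "det (chart_matrix (U, \<phi>) S) > 0"
  show "positively_oriented A p S" unfolding positively_oriented_def
  proof safe
    fix V \<psi> assume d: "(V, \<psi>) \<in> A" "p \<in> V"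
    have "\<forall>x \<in> snd (U, \<phi>) ` (fst (U, \<phi>) \<inter> fst (V, \<psi>)).
        det (matrix (frechet_derivative (transition (U, \<phi>) (V, \<psi>)) (at x))) > 0"
      using o c d unfolding oriented_atlas_def by blast
    then have "det (matrix (frechet_derivative (transition (U, \<phi>) (V, \<psi>)) (at (\<phi> p)))) > 0"
      using c d by simp
    then have "det (chart_matrix (V, \<psi>) S) > 0"
      unfolding chart_matrix_change[OF c d S] det_mul det_transpose using pos by simp
    then show "det (\<chi> i j. S i (\<lambda>q. \<psi> q $ j)) > 0" by (simp add: chart_matrix_def)
  qed
qed

end

context riemannian_manifold
begin

lemma chart_matrix_onf_change:
  assumes S: "orthonormal_frame A g p S" and S': "\<And>i. S' i \<in> T p"
  shows "chart_matrix c S' = (\<chi> i j. g p (S' i) (S j)) ** chart_matrix c S"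
proof -
  have "S' i (\<lambda>q. snd c q $ j) = (\<Sum>k\<in>UNIV. g p (S' i) (S k) * S k (\<lambda>q. snd c q $ j))" for i j
  proof -
    have "S' i (\<lambda>q. snd c q $ j) = (\<Sum>k\<in>UNIV. g p (S' i) (S k) *\<^sub>R S k) (\<lambda>q. snd c q $ j)"
      using onf_expand[OF S S'[of i]] by simp
    then show ?thesis by (simp add: sum_fun_apply)
  qed
  then show ?thesis by (simp add: vec_eq_iff chart_matrix_def matrix_matrix_mult_def)
qed

text \<open>In the odd dimension three, passing from \<open>S\<close> to \<open>- S\<close> reverses the orientation.\<close>

lemma ex_oriented_onf:
  assumes o: "oriented_atlas A"
  obtains S where "orthonormal_frame A g p S" "positively_oriented A p S"
proof -
  obtain U \<phi> where c: "(U, \<phi>) \<in> A" "p \<in> U" by (rule ex_chart)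
  obtain S where S: "orthonormal_frame A g p S" by (rule ex_onf)
  note t = onf_tangent[OF S]
  have C: "coord_vec (U, \<phi>) i p \<in> T p" for i by (rule coord_vec_tangent[OF c])
  have "chart_matrix (U, \<phi>) (\<lambda>i. coord_vec (U, \<phi>) i p) = mat 1"
    by (simp add: vec_eq_iff chart_matrix_def mat_def coord_vec_coordinate[OF c])
  then have "mat 1 = (\<chi> i j. g p (coord_vec (U, \<phi>) i p) (S j)) ** chart_matrix (U, \<phi>) S"
    using chart_matrix_onf_change[OF S C, of "(U, \<phi>)"] by simp
  from arg_cong[OF this, of det]
  have "det (\<chi> i j. g p (coord_vec (U, \<phi>) i p) (S j)) * det (chart_matrix (U, \<phi>) S) = 1"
    by (simp add: det_mul)
  then have ne: "det (chart_matrix (U, \<phi>) S) \<noteq> 0" by auto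
  show ?thesis
  proof (cases "det (chart_matrix (U, \<phi>) S) > 0")
    case True
    then show ?thesis using that[OF S] positively_oriented_iff[OF o c t] by simp
  next
    case False
    let ?N = "\<lambda>i. - S i"
    have N: "?N i \<in> T p" for i by (intro tangent_closed t)
    have "orthonormal_frame A g p ?N"
      unfolding orthonormal_frame_def using N t by (simp add: g_bilinear tangent_closed onf_g[OF S])
    moreover have "det (chart_matrix (U, \<phi>) ?N) = - det (chart_matrix (U, \<phi>) S)"
      by (simp add: chart_matrix_def det_3)
    ultimately show ?thesis using that[of ?N] positively_oriented_iff[OF o c N] False ne by simp
  qed
qed

end

lemma index3_add: "(1::3) + 1 = 2" "(2::3) + 1 = 3" "(3::3) + 1 = 1" "(1::3) + 2 = 3" "(2::3) + 2 = 1" "(3::3) + 2 = 2"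
  by simp_all

text \<open>As \<open>w\<close> is skew, the inner double sum pairs \<open>w\<close> with the two-by-two minors of \<open>Q\<close> from the two rows
  other than \<open>i\<close>.  Multiplying by row \<open>i\<close> and summing over \<open>i\<close> gives the entries of the adjugate of \<open>Q\<close>
  times \<open>Q\<close>, which is \<open>det Q\<close> times the identity.\<close>

lemma hodge_sum_matrix:
  fixes w :: "3 \<Rightarrow> 3 \<Rightarrow> real" and u :: "3 \<Rightarrow> real" and Q :: "real^3^3"
  assumes "\<And>i j. w i j = - w j i"
  shows "(\<Sum>i\<in>UNIV. (\<Sum>j\<in>UNIV. \<Sum>k\<in>UNIV. Q$(i + 1)$j * Q$(i + 2)$k * w j k) * (\<Sum>l\<in>UNIV. Q$i$l * u l))
    = det Q * (\<Sum>i\<in>UNIV. w (i + 1) (i + 2) * u i)"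
proof -
  have s: "w 2 1 = - w 1 2" "w 1 3 = - w 3 1" "w 3 2 = - w 2 3" using assms by blast+
  have z: "w i i = 0" for i using assms[of i i] by simp
  show ?thesis unfolding sum_3 index3_add det_3 s z by (simp add: algebra_simps)
qed

context riemannian_manifold
begin

text \<open>Two positively oriented orthonormal frames differ by an orthogonal matrix of positive determinant, hence of
  determinant one.\<close>

lemma hodge_star_onf:
  assumes o: "oriented_atlas A" and w: "bilin_at p w" and alt: "\<And>x y. w x y = - w y x"
    and u: "u \<in> T p" and S: "orthonormal_frame A g p S" "positively_oriented A p S"
  shows "hodge_star A g p w u = (\<Sum>i\<in>UNIV. w (S (i + 1)) (S (i + 2)) * g p u (S i))"
  unfolding hodge_star_def
proof (rule the_equality)
  note t = onf_tangent[OF S(1)]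
  have main: "(\<Sum>i\<in>UNIV. w (S (i + 1)) (S (i + 2)) * g p u (S i)) =
      (\<Sum>i\<in>UNIV. w (S' (i + 1)) (S' (i + 2)) * g p u (S' i))"
    if S': "orthonormal_frame A g p S'" "positively_oriented A p S'" for S'
  proof -
    note t' = onf_tangent[OF S'(1)]
    define Q where "Q = (\<chi> i j. g p (S' i) (S j))"
    obtain U \<phi> where c: "(U, \<phi>) \<in> A" "p \<in> U" by (rule ex_chart)
    have "det (chart_matrix (U, \<phi>) S') = det Q * det (chart_matrix (U, \<phi>) S)"
      using chart_matrix_onf_change[OF S(1) t', of "(U, \<phi>)"] by (simp add: det_mul Q_def)
    moreover have "det (chart_matrix (U, \<phi>) S') > 0" "det (chart_matrix (U, \<phi>) S) > 0"
      using positively_oriented_iff[OF o c t] positively_oriented_iff[OF o c t'] S(2) S'(2) by auto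
    ultimately have pos: "det Q > 0" by (simp add: zero_less_mult_iff)
    have "Q ** transpose Q = mat 1"
      using onf_parseval[OF S(1) t' t'] onf_g[OF S'(1)]
      by (simp add: vec_eq_iff Q_def matrix_matrix_mult_def transpose_def mat_def)
    then have "det Q * det Q = 1" by (metis det_mul det_transpose det_I)
    then have det1: "det Q = 1" using pos by (simp add: square_eq_1_iff)
    have e: "w (S' i) (S' k) = (\<Sum>j\<in>UNIV. \<Sum>l\<in>UNIV. Q$i$j * Q$k$l * w (S j) (S l))" for i k
    proof -
      have "w (S' i) (S' k) = (\<Sum>j\<in>UNIV. Q$i$j * w (S j) (S' k))"
        using lin_at_expand[OF bilin_left[OF w t'] S(1) t', of i k] by (simp add: Q_def)
      also have "\<dots> = (\<Sum>j\<in>UNIV. Q$i$j * (\<Sum>l\<in>UNIV. Q$k$l * w (S j) (S l)))"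
        using lin_at_expand[OF bilin_right[OF w t] S(1) t', of _ k] by (simp add: Q_def)
      finally show ?thesis by (simp add: sum_distrib_left mult.assoc)
    qed
    have gu: "g p u (S' i) = (\<Sum>l\<in>UNIV. Q$i$l * g p u (S l))" for i
      using onf_parseval[OF S(1) u t', of i] by (simp add: Q_def mult.commute)
    have "(\<Sum>i\<in>UNIV. w (S' (i + 1)) (S' (i + 2)) * g p u (S' i)) =
        det Q * (\<Sum>i\<in>UNIV. w (S (i + 1)) (S (i + 2)) * g p u (S i))"
      unfolding e gu by (rule hodge_sum_matrix) (rule alt)
    then show ?thesis using det1 by simp
  qed
  then show "\<forall>S'. orthonormal_frame A g p S' \<and> positively_oriented A p S' \<longrightarrow>
      (\<Sum>i\<in>UNIV. w (S (i + 1)) (S (i + 2)) * g p u (S i)) =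
      (\<Sum>i\<in>UNIV. w (S' (i + 1)) (S' (i + 2)) * g p u (S' i))" by blast
  show "r = (\<Sum>i\<in>UNIV. w (S (i + 1)) (S (i + 2)) * g p u (S i))"
    if "\<forall>S. orthonormal_frame A g p S \<and> positively_oriented A p S \<longrightarrow>
      r = (\<Sum>i\<in>UNIV. w (S (i + 1)) (S (i + 2)) * g p u (S i))" for r
    using that S by blast
qed

lemma cotton_tensor_onf:
  assumes "oriented_atlas A" "u \<in> T p" "z \<in> T p" "orthonormal_frame A g p S" "positively_oriented A p S"
  shows "cotton_tensor A g p u z = (\<Sum>i\<in>UNIV. cotton_form A g p (S (i + 1)) (S (i + 2)) z * g p u (S i))"
  unfolding cotton_tensor_def
  by (rule hodge_star_onf[OF assms(1) bilin_cotton_form[OF assms(3)] _ assms(2,4,5)]) (simp add: cotton_form_def)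

end

section \<open>Conformal change\<close>

context smooth_manifold
begin

text \<open>The Leibniz rule alone gives the chain rule only for polynomials; for the exponential, expand \<open>v\<close> in
  partial derivatives.\<close>

lemma tangent_exp:
  assumes v: "v \<in> tangent_space A p" and k: "smooth_at A p k"
  shows "v (\<lambda>q. exp (k q)) = exp (k p) * v k"
proof -
  obtain U \<phi> where c: "(U, \<phi>) \<in> A" "p \<in> U" by (rule ex_chart)
  obtain O' where O': "open O'" "\<phi> p \<in> O'" "O' \<subseteq> \<phi> ` U" "smooth_on O' (k \<circ> inv_into U \<phi>)"
    by (rule smooth_at_chartE[OF c k])
  have "((k \<circ> inv_into U \<phi>) has_derivative frechet_derivative (k \<circ> inv_into U \<phi>) (at (\<phi> p))) (at (\<phi> p))"
    using smooth_on_differentiable[OF O'(4,2)] by (simp add: frechet_derivative_works)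
  from partial_deriv_eq[OF has_derivative_exp[OF this]]
  have 1: "coord_vec (U, \<phi>) i p (\<lambda>q. exp (k q)) = exp (k p) * coord_vec (U, \<phi>) i p k" for i
    using chartD(3)[OF c(1)] c(2)
    by (simp add: coord_vec_def k smooth_at_exp o_def inv_into_f_f flip: partial_deriv_def)
  have 2: "v h = (\<Sum>i\<in>UNIV. v (\<lambda>q. \<phi> q $ i) * coord_vec (U, \<phi>) i p h)" for h
  proof -
    have "v h = (\<Sum>i\<in>UNIV. v (\<lambda>q. \<phi> q $ i) *\<^sub>R coord_vec (U, \<phi>) i p) h"
      using tangent_coord_expansion[OF c v] by simp
    then show ?thesis by (simp add: sum_fun_apply)
  qed
  show ?thesis unfolding 2[of "\<lambda>q. exp (k q)"] 2[of k] by (simp add: 1 sum_distrib_left mult_ac)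
qed

end

lemma (in riemannian_manifold) riemannian_conformal_metric:
  assumes "\<And>p. smooth_at A p f"
  shows "riemannian_metric A (conformal_metric f g)"
proof -
  have "smooth_at A p (\<lambda>q. exp (2 * f q) * g q (X q) (Y q))" if "vf p X" "vf p Y" for p X Y
    by (intro smooth_at_mult[OF smooth_at_exp[OF smooth_at_cmult]] g_smooth assms that)
  then show ?thesis
    unfolding riemannian_metric_def conformal_metric_def
    by (auto simp: g_bilinear tangent_closed algebra_simps g_pos intro: g_sym)
qed

locale conformal_change = riemannian_manifold A g
  for A :: "'a::topological_space chart set" and g :: "'a bform" +
  fixes f :: "'a \<Rightarrow> real"
  assumes f_smooth: "smooth_at A p f"

sublocale conformal_change \<subseteq> c: riemannian_manifold A "conformal_metric f g"
  by unfold_locales (rule riemannian_conformal_metric[OF f_smooth])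

context conformal_change
begin

text \<open>The value at each point is computed in a frame chosen for that point; \<open>g_grad\<close> shows that the choice
  does not matter, and then a frame defined near \<open>p\<close> gives smoothness.\<close>

definition grad :: "'a vfield"
  where "grad p = (\<Sum>i\<in>UNIV. frame_at p i p f *\<^sub>R frame_at p i p)"

lemma grad_tangent: "grad p \<in> T p"
  unfolding grad_def by (intro tangent_closed(5) tangent_closed(2) vfield_tangent local_frame_vf[OF local_frame_at])

lemma g_grad:
  assumes "u \<in> T p" shows "g p (grad p) u = u f"
proof -
  note S = local_frame_onf[OF local_frame_at, of p]
  note t = onf_tangent[OF S]
  have "g p (grad p) u = (\<Sum>i\<in>UNIV. frame_at p i p f * g p (frame_at p i p) u)"
    unfolding grad_def by (simp add: g_sum_left tangent_closed(2) t assms g_scale_left)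
  also have "\<dots> = (\<Sum>i\<in>UNIV. g p u (frame_at p i p) *\<^sub>R frame_at p i p) f"
    by (simp add: sum_fun_apply g_sym[OF t assms] mult.commute)
  also have "\<dots> = u f" using onf_expand[OF S assms] by simp
  finally show ?thesis .
qed

lemma g_grad_right: "u \<in> T p \<Longrightarrow> g p u (grad p) = u f"
  using g_grad[of u p] g_sym[OF grad_tangent, of u p] by simp

lemma vf_grad: "vf p grad"
proof -
  obtain E where E: "local_frame p E" by (rule ex_local_frame)
  note Ev = local_frame_vf[OF E]
  have v: "vf p (\<lambda>q. \<Sum>i\<in>UNIV. E i q f *\<^sub>R E i q)"
    by (rule vfield_sum) (rule vfield_scale[OF vfield_smooth[OF Ev f_smooth] Ev])
  have "\<forall>\<^sub>F q in nhds p. orthonormal_frame A g q (\<lambda>i. E i q)" using E by (simp add: local_frame_def)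
  then have "\<forall>\<^sub>F q in nhds p. (\<Sum>i\<in>UNIV. E i q f *\<^sub>R E i q) = grad q"
  proof eventually_elim
    case (elim q)
    then show ?case using onf_expand[OF elim grad_tangent] g_grad[OF onf_tangent[OF elim]] by simp
  qed
  then show ?thesis using v by (rule vfield_cong)
qed

text \<open>The factor \<open>exp (2 * f)\<close> is differentiated in the three derivative terms; half of its logarithmic derivative
  \<open>2 df\<close> accounts for the coefficient one.\<close>

lemma koszul_conformal:
  assumes X: "vf p X" and Y: "vf p Y" and Z: "vf p Z"
  shows "c.koszul p X Y Z = exp (2 * f p) *
    (koszul p X Y Z + X p f * g p (Y p) (Z p) + Y p f * g p (X p) (Z p) - Z p f * g p (X p) (Y p))"
proof -
  have d: "v (\<lambda>q. conformal_metric f g q (V q) (W q)) =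
      exp (2 * f p) * (2 * v f * g p (V p) (W p) + v (\<lambda>q. g q (V q) (W q)))"
    if v: "v \<in> T p" and V: "vf p V" and W: "vf p W" for v V W
    unfolding conformal_metric_def tangent_mult[OF v smooth_at_exp[OF smooth_at_cmult[OF f_smooth]] g_smooth[OF V W]]
      tangent_exp[OF v smooth_at_cmult[OF f_smooth]] tangent_scale[OF v f_smooth]
    by (simp add: algebra_simps)
  show ?thesis
    unfolding c.koszul_def koszul_def d[OF vfield_tangent[OF X] Y Z] d[OF vfield_tangent[OF Y] X Z]
      d[OF vfield_tangent[OF Z] X Y]
    by (simp add: conformal_metric_def field_simps)
qed

lemma D_conformal:
  assumes X: "vf p X" and Y: "vf p Y"
  shows "c.D p (X p) Y = D p (X p) Y + X p f *\<^sub>R Y p + Y p f *\<^sub>R X p - g p (X p) (Y p) *\<^sub>R grad p"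
proof -
  note t = vfield_tangent[OF X] vfield_tangent[OF Y]
  have "g p (c.D p (X p) Y) (Z p) =
      g p (D p (X p) Y + X p f *\<^sub>R Y p + Y p f *\<^sub>R X p - g p (X p) (Y p) *\<^sub>R grad p) (Z p)"
    if Z: "vf p Z" for Z
  proof -
    have "exp (2 * f p) * g p (c.D p (X p) Y) (Z p) = exp (2 * f p) *
      (koszul p X Y Z + X p f * g p (Y p) (Z p) + Y p f * g p (X p) (Z p) - Z p f * g p (X p) (Y p))"
      using c.D_koszul[OF X Y Z] koszul_conformal[OF X Y Z] by (simp add: conformal_metric_def)
    then show ?thesis
      using D_koszul[OF X Y Z] t vfield_tangent[OF Z]
      by (simp add: g_bilinear tangent_closed D_tangent Y grad_tangent g_grad)
  qed
  moreover have "D p (X p) Y + X p f *\<^sub>R Y p + Y p f *\<^sub>R X p - g p (X p) (Y p) *\<^sub>R grad p \<in> T p"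
    by (intro tangent_closed D_tangent grad_tangent t Y)
  ultimately show ?thesis by (intro g_nondegenerate_fields[OF c.D_tangent[OF t(1) Y]])
qed

abbreviation hess :: "'a \<Rightarrow> 'a tvec \<Rightarrow> 'a tvec \<Rightarrow> real"
  where "hess p u v \<equiv> g p (D p u grad) v"

lemma deriv_parallel_f:
  assumes x: "x \<in> T p" and Z: "vf p Z" and par: "D p x Z = 0"
  shows "x (\<lambda>q. Z q f) = hess p x (Z p)"
proof -
  have "\<forall>\<^sub>F q in nhds p. g q (grad q) (Z q) = Z q f"
    using vfield_eventually[OF Z] by eventually_elim (intro g_grad vfield_tangent)
  from tangent_cong[OF x this] D_metric[OF x vf_grad Z] show ?thesis
    by (simp add: par g_zero grad_tangent)
qed

text \<open>For fields that are parallel at \<open>p\<close> the Hessian is a second derivative of \<open>f\<close>, and their bracket vanishes at \<open>p\<close>.\<close>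

lemma hess_sym:
  assumes x: "x \<in> T p" and y: "y \<in> T p"
  shows "hess p x y = hess p y x"
proof -
  obtain X where X: "extends_vec A p X x" and DX: "\<And>v. v \<in> T p \<Longrightarrow> D p v X = 0"
    by (rule ex_parallel_extension[OF x]) (rule that)
  obtain Y where Y: "extends_vec A p Y y" and DY: "\<And>v. v \<in> T p \<Longrightarrow> D p v Y = 0"
    by (rule ex_parallel_extension[OF y]) (rule that)
  have v: "vf p X" "vf p Y" and ev: "X p = x" "Y p = y" using X Y by (auto simp: extends_vec_def)
  have "lb X Y p = 0" using D_torsion[OF v] DX[OF y] DY[OF x] ev by simp
  then have "x (\<lambda>q. Y q f) = y (\<lambda>q. X q f)"
    using lie_bracket_smooth[OF f_smooth, of X Y p] ev by simp
  then show ?thesis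
    using deriv_parallel_f[OF x v(2) DY[OF x]] deriv_parallel_f[OF y v(1) DX[OF y]] ev by simp
qed

text \<open>The candidate for the Schouten tensor of \<open>e^(2f) g\<close>.\<close>

definition conformal_schouten :: "'a bform"
  where "conformal_schouten p u v =
    schouten A g p u v - hess p u v + u f * v f - 1/2 * g p (grad p) (grad p) * g p u v"

lemma bilin_conformal_schouten: "bilin_at p (conformal_schouten p)"
  using bilin_at_schouten[of p] unfolding bilin_at_def lin_at_def conformal_schouten_def
  by (simp add: g_bilinear D_tangent vf_grad D_add_dir D_scale_dir algebra_simps)

text \<open>Extend the vectors to fields that are parallel at \<open>p\<close> for \<open>D\<close>.  Then \<open>D' D' Z\<close> at \<open>p\<close> consists of
  \<open>D D Z\<close>, of Hessian terms from differentiating the coefficients of \<open>D' - D\<close>, and of quadratic terms from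
  applying \<open>D' - D\<close> twice.  Its skew part is \<open>R\<close> plus a Kulkarni--Nomizu product.\<close>

lemma curvature_conformal:
  assumes x: "x \<in> T p" and y: "y \<in> T p" and z: "z \<in> T p" and w: "w \<in> T p"
  shows "g p (c.R p x y z) w = kn p (conformal_schouten p) x y z w"
proof -
  obtain X where X': "extends_vec A p X x" and DX: "\<And>v. v \<in> T p \<Longrightarrow> D p v X = 0"
    by (rule ex_parallel_extension[OF x]) (rule that)
  obtain Y where Y': "extends_vec A p Y y" and DY: "\<And>v. v \<in> T p \<Longrightarrow> D p v Y = 0"
    by (rule ex_parallel_extension[OF y]) (rule that)
  obtain Z where Z': "extends_vec A p Z z" and DZ: "\<And>v. v \<in> T p \<Longrightarrow> D p v Z = 0"
    by (rule ex_parallel_extension[OF z]) (rule that)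
  have X: "vf p X" and Y: "vf p Y" and Z: "vf p Z" and ev: "X p = x" "Y p = y" "Z p = z"
    using X' Y' Z' by (auto simp: extends_vec_def)
  have lb0: "lb X Y p = 0" using D_torsion[OF X Y] DX[OF y] DY[OF x] ev by simp
  let ?F = "grad p"
  note tF = grad_tangent[of p]
  have second: "g p (c.D p u (\<lambda>q. c.D q (V q) Z)) w =
      g p (D p u (\<lambda>q. D q (V q) Z)) w + hess p u v * g p z w + hess p u z * g p v w - g p v z * hess p u w
      + u f * (v f * g p z w + z f * g p v w - g p v z * w f)
      + (2 * v f * z f - g p v z * g p ?F ?F) * g p u w
      - (v f * g p u z + z f * g p u v - g p v z * u f) * w f"
    if U: "vf p U" "U p = u" and V: "vf p V" "V p = v" and DV: "D p u V = 0" for U V u v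
  proof -
    have u: "u \<in> T p" and v: "v \<in> T p" using vfield_tangent[OF U(1)] vfield_tangent[OF V(1)] U V by auto
    \<comment> \<open>\<open>N\<close> is \<open>D'\<^sub>V Z\<close> near \<open>p\<close>.  In its derivative at \<open>p\<close> the term with the derivative of \<open>g(V, Z)\<close>
      drops out, because \<open>V\<close> and \<open>Z\<close> are parallel there.\<close>
    define N where "N q = D q (V q) Z + V q f *\<^sub>R Z q + Z q f *\<^sub>R V q - g q (V q) (Z q) *\<^sub>R grad q" for q
    have N1: "vf p (\<lambda>q. V q f *\<^sub>R Z q)" by (rule vfield_scale[OF vfield_smooth[OF V(1) f_smooth] Z])
    have N2: "vf p (\<lambda>q. Z q f *\<^sub>R V q)" by (rule vfield_scale[OF vfield_smooth[OF Z f_smooth] V(1)])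
    have N3: "vf p (\<lambda>q. g q (V q) (Z q) *\<^sub>R grad q)" by (intro vfield_scale g_smooth V Z vf_grad)
    have N0: "vf p (\<lambda>q. D q (V q) Z)" by (intro vf_D V Z)
    have N: "vf p N" unfolding N_def[abs_def] by (intro vfield_diff vfield_add N0 N1 N2 N3)
    have Np: "N p = v f *\<^sub>R z + z f *\<^sub>R v - g p v z *\<^sub>R ?F" using DZ[OF v] by (simp add: N_def V(2) ev)
    have Npf: "N p f = 2 * v f * z f - g p v z * g p ?F ?F"
      using g_grad[OF tF] by (simp add: Np)
    have uV: "u (\<lambda>q. V q f) = hess p u v" using deriv_parallel_f[OF u V(1) DV] V(2) by simp
    have uZ: "u (\<lambda>q. Z q f) = hess p u z" using deriv_parallel_f[OF u Z DZ[OF u]] ev by simp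
    have "\<forall>\<^sub>F q in nhds p. c.D q (V q) Z = N q"
      using vfield_eventually[OF V(1)] vfield_eventually[OF Z]
      by eventually_elim (simp add: D_conformal N_def)
    then have "c.D p u (\<lambda>q. c.D q (V q) Z) = c.D p u N"
      by (rule c.D_cong[OF u c.vf_D[OF V(1) Z]])
    also have "\<dots> = D p u N + u f *\<^sub>R N p + N p f *\<^sub>R u - g p u (N p) *\<^sub>R ?F"
      using D_conformal[OF U(1) N] U(2) by simp
    finally have cD: "c.D p u (\<lambda>q. c.D q (V q) Z) = D p u N + u f *\<^sub>R N p + N p f *\<^sub>R u - g p u (N p) *\<^sub>R ?F" .
    have DN: "D p u N = D p u (\<lambda>q. D q (V q) Z) + hess p u v *\<^sub>R z + hess p u z *\<^sub>R v
        - g p v z *\<^sub>R D p u grad"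
      using D_metric[OF u V(1) Z] DZ[OF u] DV z v
      unfolding N_def[abs_def] D_diff[OF u vfield_add[OF vfield_add[OF N0 N1] N2] N3]
        D_add[OF u vfield_add[OF N0 N1] N2] D_add[OF u N0 N1]
        D_scale[OF u Z vfield_smooth[OF V(1) f_smooth]] D_scale[OF u V(1) vfield_smooth[OF Z f_smooth]]
        D_scale[OF u vf_grad g_smooth[OF V(1) Z]]
      by (simp add: ev V(2) g_zero uV uZ)
    show ?thesis
      unfolding cD DN Npf using u v w z tF D_tangent[OF u N0] D_tangent[OF u vf_grad]
      by (simp add: Np g_bilinear tangent_closed g_grad g_grad_right)
  qed
  have D0: "D p 0 Z = 0" "c.D p 0 Z = 0"
    using D_scale_dir[OF tangent_closed(6) Z, of 0] c.D_scale_dir[OF tangent_closed(6) Z, of 0] by simp_all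
  have cT: "c.D p u (\<lambda>q. c.D q (V q) Z) \<in> T p" if "u \<in> T p" "vf p V" for u V
    using that by (intro c.D_tangent c.vf_D Z)
  have DT: "D p u (\<lambda>q. D q (V q) Z) \<in> T p" if "u \<in> T p" "vf p V" for u V
    using that by (intro D_tangent vf_D Z)
  have "g p (c.R p x y z) w = g p (c.D p x (\<lambda>q. c.D q (Y q) Z)) w - g p (c.D p y (\<lambda>q. c.D q (X q) Z)) w"
    using c.curvature_eq[OF X Y Z] cT[OF x Y] cT[OF y X] w
    by (simp add: c.cf_eq lb0 D0 ev g_bilinear tangent_closed)
  moreover have "g p (R p x y z) w = g p (D p x (\<lambda>q. D q (Y q) Z)) w - g p (D p y (\<lambda>q. D q (X q) Z)) w"
    using curvature_eq[OF X Y Z] DT[OF x Y] DT[OF y X] w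
    by (simp add: cf_eq lb0 D0 ev g_bilinear tangent_closed)
  ultimately show ?thesis
    using curvature_kn[OF x y z w] hess_sym[OF y x] g_sym[OF y x]
    unfolding second[OF X ev(1) Y ev(2) DY[OF x]] second[OF Y ev(2) X ev(1) DX[OF y]]
    by (simp add: kn_def conformal_schouten_def algebra_simps)
qed

text \<open>The curvature of \<open>e^(2f) g\<close>, lowered with that metric, is the Kulkarni--Nomizu product of that metric with
  \<open>conformal_schouten\<close>, since both sides of \<open>curvature_conformal\<close> are multiplied by \<open>e^(2f)\<close>.\<close>

lemma schouten_conformal:
  assumes "u \<in> T p" "v \<in> T p"
  shows "schouten A (conformal_metric f g) p u v = conformal_schouten p u v"
proof (rule c.schouten_unique)
  show "c.bilin_at p (conformal_schouten p)"
    using bilin_conformal_schouten by (simp add: c.bilin_at_def bilin_at_def)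
  show "conformal_metric f g p (c.R p x y z) w = c.kn p (conformal_schouten p) x y z w"
    if "x \<in> T p" "y \<in> T p" "z \<in> T p" "w \<in> T p" for x y z w
  proof -
    have "c.kn p (conformal_schouten p) x y z w = exp (2 * f p) * kn p (conformal_schouten p) x y z w"
      by (simp add: conformal_metric_def kn_def c.kn_def algebra_simps)
    then show ?thesis using curvature_conformal[OF that] by (simp add: conformal_metric_def)
  qed
qed (rule assms)+

text \<open>For extensions that are parallel at \<open>p\<close> for \<open>D\<close>, the covariant derivative of \<open>P\<close> is a plain derivative
  of a function, while that of \<open>conformal_schouten\<close> for \<open>D'\<close> has the additional terms of \<open>N'\<close> below.
  Their skew part in \<open>x, y\<close> is zero: the second derivatives of the gradient form the curvature, which
  \<open>curvature_kn\<close> turns into terms in \<open>P\<close>, and the symmetries of \<open>P\<close> and of the Hessian do the rest.\<close>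

theorem cotton_form_conformal:
  assumes x: "x \<in> T p" and y: "y \<in> T p" and z: "z \<in> T p"
  shows "cotton_form A (conformal_metric f g) p x y z = cotton_form A g p x y z"
proof -
  obtain X where X': "extends_vec A p X x" and DX: "\<And>v. v \<in> T p \<Longrightarrow> D p v X = 0"
    by (rule ex_parallel_extension[OF x]) (rule that)
  obtain Y where Y': "extends_vec A p Y y" and DY: "\<And>v. v \<in> T p \<Longrightarrow> D p v Y = 0"
    by (rule ex_parallel_extension[OF y]) (rule that)
  obtain Z where Z': "extends_vec A p Z z" and DZ: "\<And>v. v \<in> T p \<Longrightarrow> D p v Z = 0"
    by (rule ex_parallel_extension[OF z]) (rule that)
  have X: "vf p X" and Y: "vf p Y" and Z: "vf p Z" and ev: "X p = x" "Y p = y" "Z p = z"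
    using X' Y' Z' by (auto simp: extends_vec_def)
  have lb0: "lb X Y p = 0" using D_torsion[OF X Y] DX[OF y] DY[OF x] ev by simp
  let ?F = "grad p" and ?P = "schouten A g" and ?P' = "schouten A (conformal_metric f g)" and ?Q = "conformal_schouten"
  note tF = grad_tangent[of p] and bQ = bilin_conformal_schouten[of p]
  note linQ = lin_at_add[OF bilin_left[OF bQ]] lin_at_scale[OF bilin_left[OF bQ]]
    lin_at_add[OF bilin_right[OF bQ]] lin_at_scale[OF bilin_right[OF bQ]]
  have diffQ: "?Q p (u - v) a = ?Q p u a - ?Q p v a" "?Q p a (u - v) = ?Q p a u - ?Q p a v"
    if "u \<in> T p" "v \<in> T p" "a \<in> T p" for u v a
    using linQ(1)[of a u "- v"] linQ(3)[of a u "- v"] linQ(2)[of a v "-1"] linQ(4)[of a v "-1"] that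
    by (simp_all add: tangent_closed)
  have zero: "schouten A g p 0 a = 0" "schouten A g p a 0 = 0" if "a \<in> T p" for a
    using lin_at_scale[OF bilin_left[OF bilin_at_schouten that] tangent_closed(6), of 0]
      lin_at_scale[OF bilin_right[OF bilin_at_schouten that] tangent_closed(6), of 0] by simp_all
  have N: "cov_deriv_form A g ?P p u v z = u (\<lambda>q. ?P q (V q) (Z q))"
    if u: "u \<in> T p" and V: "vf p V" "V p = v" and DV: "D p u V = 0" for u v V
    using cov_deriv_form_eq[OF smooth_bform_schouten u V(1) Z] V(2) ev DV DZ[OF u] zero z vfield_tangent[OF V(1)]
    by (simp add: cov_deriv_fields_def)
  have N': "cov_deriv_form A (conformal_metric f g) ?P' p u v z =
      u (\<lambda>q. ?P q (V q) (Z q)) - g p (D p u (\<lambda>q. D q (V q) grad)) z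
      + hess p u v * z f + v f * hess p u z - hess p u ?F * g p v z
      - (u f * ?Q p v z + v f * ?Q p u z - g p u v * ?Q p ?F z)
      - (u f * ?Q p v z + z f * ?Q p v u - g p u z * ?Q p v ?F)"
    if U: "vf p U" "U p = u" and V: "vf p V" "V p = v" and DV: "D p u V = 0" for U V u v
  proof -
    have u: "u \<in> T p" and v: "v \<in> T p" using vfield_tangent[OF U(1)] vfield_tangent[OF V(1)] U V by auto
    have DuF: "D p u grad \<in> T p" by (rule D_tangent[OF u vf_grad])
    have N0: "cov_deriv_form A (conformal_metric f g) ?P' p u v z =
        u (\<lambda>q. ?P' q (V q) (Z q)) - ?P' p (c.D p u V) z - ?P' p v (c.D p u Z)"
      using c.cov_deriv_form_eq[OF c.smooth_bform_schouten u V(1) Z] V(2) ev by (simp add: c.cov_deriv_fields_def)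
    have N1: "?P' p (c.D p u V) z = u f * ?Q p v z + v f * ?Q p u z - g p u v * ?Q p ?F z"
      unfolding schouten_conformal[OF c.D_tangent[OF u V(1)] z]
      using D_conformal[OF U(1) V(1)] U(2) V(2) DV u v z tF by (simp add: linQ diffQ tangent_closed)
    have N2: "?P' p v (c.D p u Z) = u f * ?Q p v z + z f * ?Q p v u - g p u z * ?Q p v ?F"
      unfolding schouten_conformal[OF v c.D_tangent[OF u Z]]
      using D_conformal[OF U(1) Z] U(2) ev DZ[OF u] u v z tF by (simp add: linQ diffQ tangent_closed)
    have s: "smooth_at A p (\<lambda>q. ?P q (V q) (Z q))" "smooth_at A p (\<lambda>q. g q (D q (V q) grad) (Z q))"
      "smooth_at A p (\<lambda>q. V q f)" "smooth_at A p (\<lambda>q. Z q f)"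
      "smooth_at A p (\<lambda>q. g q (grad q) (grad q))" "smooth_at A p (\<lambda>q. g q (V q) (Z q))"
      by (rule schouten_smooth g_smooth vfield_smooth[OF V(1)] vfield_smooth[OF Z] vf_D vf_grad f_smooth V(1) Z)+
    have d1: "u (\<lambda>q. g q (D q (V q) grad) (Z q)) = g p (D p u (\<lambda>q. D q (V q) grad)) z"
      using D_metric[OF u vf_D[OF V(1) vf_grad] Z] DZ[OF u] D_tangent[OF v vf_grad] ev V(2) by (simp add: g_zero)
    have d2: "u (\<lambda>q. V q f) = hess p u v" using deriv_parallel_f[OF u V(1) DV] V(2) by simp
    have d3: "u (\<lambda>q. Z q f) = hess p u z" using deriv_parallel_f[OF u Z DZ[OF u]] ev by simp
    have d4: "u (\<lambda>q. g q (grad q) (grad q)) = 2 * hess p u ?F"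
      using D_metric[OF u vf_grad vf_grad] g_sym[OF DuF tF] by simp
    have d5: "u (\<lambda>q. g q (V q) (Z q)) = 0"
      using D_metric[OF u V(1) Z] DV DZ[OF u] z v ev V(2) by (simp add: g_zero)
    have "\<forall>\<^sub>F q in nhds p. ?P' q (V q) (Z q) = ?P q (V q) (Z q) - g q (D q (V q) grad) (Z q)
        + V q f * Z q f - 1/2 * (g q (grad q) (grad q) * g q (V q) (Z q))"
      using vfield_eventually[OF V(1)] vfield_eventually[OF Z]
      by eventually_elim (simp add: schouten_conformal vfield_tangent conformal_schouten_def)
    from tangent_cong[OF u this]
    have "u (\<lambda>q. ?P' q (V q) (Z q)) = u (\<lambda>q. ?P q (V q) (Z q)) - g p (D p u (\<lambda>q. D q (V q) grad)) z
        + hess p u v * z f + v f * hess p u z - hess p u ?F * g p v z"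
      unfolding tangent_diff[OF u smooth_at_add[OF smooth_at_diff[OF s(1,2)] smooth_at_mult[OF s(3,4)]]
          smooth_at_cmult[OF smooth_at_mult[OF s(5,6)]]]
        tangent_add[OF u smooth_at_diff[OF s(1,2)] smooth_at_mult[OF s(3,4)]] tangent_diff[OF u s(1,2)]
        tangent_scale[OF u smooth_at_mult[OF s(5,6)]] tangent_mult[OF u s(3,4)] tangent_mult[OF u s(5,6)]
        d1 d2 d3 d4 d5
      by (simp add: V(2) ev)
    then show ?thesis unfolding N0 N1 N2 by simp
  qed
  have "g p (R p x y ?F) z = g p (D p x (\<lambda>q. D q (Y q) grad)) z - g p (D p y (\<lambda>q. D q (X q) grad)) z"
    using curvature_eq[OF X Y vf_grad] D_scale_dir[OF tangent_closed(6) vf_grad, of p 0] x y z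
      D_tangent[OF x vf_D[OF Y vf_grad]] D_tangent[OF y vf_D[OF X vf_grad]]
    by (simp add: cf_eq lb0 ev g_bilinear)
  then have Ric: "g p (D p x (\<lambda>q. D q (Y q) grad)) z =
      g p (D p y (\<lambda>q. D q (X q) grad)) z + kn p (?P p) x y ?F z"
    using curvature_kn[OF x y tF z] by simp
  show ?thesis
    unfolding cotton_form_def N[OF x Y ev(2) DY[OF x]] N[OF y X ev(1) DX[OF y]]
      N'[OF X ev(1) Y ev(2) DY[OF x]] N'[OF Y ev(2) X ev(1) DX[OF y]] Ric
    using hess_sym[OF y x] g_sym[OF y x] schouten_sym[OF y x] hess_sym[OF tF x] hess_sym[OF tF y]
    by (simp add: kn_def conformal_schouten_def g_grad g_grad_right x y z tF algebra_simps)
qed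

lemma onf_conformal:
  assumes "orthonormal_frame A g p S"
  shows "orthonormal_frame A (conformal_metric f g) p (\<lambda>i. exp (- f p) *\<^sub>R S i)"
proof -
  have "exp (2 * f p) * (exp (- f p) * (exp (- f p) * r)) = r" for r :: real
    by (simp add: exp_add[symmetric] mult.assoc[symmetric])
  then show ?thesis
    using onf_tangent[OF assms] onf_g[OF assms] unfolding orthonormal_frame_def conformal_metric_def
    by (simp add: g_bilinear tangent_closed)
qed

text \<open>Rescaling by a positive factor keeps a frame positively oriented, so a frame for \<open>g\<close> rescaled by
  \<open>e^(-f)\<close> computes the Hodge star of \<open>e^(2f) g\<close>.\<close>

theorem cotton_tensor_conformal:
  assumes o: "oriented_atlas A" and u: "u \<in> T p" and z: "z \<in> T p"
  shows "cotton_tensor A (conformal_metric f g) p u z = exp (- f p) * cotton_tensor A g p u z"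
proof -
  obtain S where S: "orthonormal_frame A g p S" "positively_oriented A p S" by (rule ex_oriented_onf[OF o])
  note t = onf_tangent[OF S(1)]
  let ?e = "exp (- f p)"
  let ?S = "\<lambda>i. ?e *\<^sub>R S i"
  have t': "?S i \<in> T p" for i by (intro tangent_closed t)
  obtain U \<phi> where c: "(U, \<phi>) \<in> A" "p \<in> U" by (rule ex_chart)
  have "det (chart_matrix (U, \<phi>) ?S) = ?e * ?e * ?e * det (chart_matrix (U, \<phi>) S)"
    by (simp add: chart_matrix_def det_3 algebra_simps)
  then have S': "positively_oriented A p ?S"
    using S(2) positively_oriented_iff[OF o c t] positively_oriented_iff[OF o c t'] by simp
  note b = bilin_cotton_form[OF z]
  note lin = lin_at_scale[OF bilin_left[OF b]] lin_at_scale[OF bilin_right[OF b]]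
  have e: "exp (2 * f p) * (?e * ?e) = 1" by (simp flip: exp_add)
  have "cotton_tensor A (conformal_metric f g) p u z =
      (\<Sum>i\<in>UNIV. cotton_form A g p (?S (i + 1)) (?S (i + 2)) z * conformal_metric f g p u (?S i))"
    by (simp add: c.cotton_tensor_onf[OF o u z onf_conformal[OF S(1)] S'] cotton_form_conformal t' z)
  also have "\<dots> = (\<Sum>i\<in>UNIV. (exp (2 * f p) * (?e * ?e)) * ?e *
      (cotton_form A g p (S (i + 1)) (S (i + 2)) z * g p u (S i)))"
    by (intro sum.cong refl) (simp add: lin t t' conformal_metric_def g_scale_right u mult_ac)
  also have "\<dots> = ?e * cotton_tensor A g p u z"
    unfolding e cotton_tensor_onf[OF o u z S] by (simp add: sum_distrib_left)
  finally show ?thesis .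
qed

end

theorem proposition15:
  fixes A :: "'a::{t2_space, second_countable_topology} chart set"
    and g :: "'a bform"
    and f :: "'a \<Rightarrow> real"
  assumes "oriented_atlas A"
    and "riemannian_metric A g"
    and "smooth_fun_on A UNIV f"
  shows "(\<forall>p. \<forall>u\<in>tangent_space A p. \<forall>v\<in>tangent_space A p.
            cotton_tensor A (conformal_metric f g) p u v = exp (- f p) * cotton_tensor A g p u v)
       \<and> (\<forall>p. \<forall>x\<in>tangent_space A p. \<forall>y\<in>tangent_space A p. \<forall>z\<in>tangent_space A p.
            cotton_form A (conformal_metric f g) p x y z = cotton_form A g p x y z)"
proof -
  have "smooth_at A p f" for p
    using assms(3) unfolding smooth_at_def by (intro exI[of _ UNIV]) simp
  moreover have "smooth_atlas A" using assms(1) by (simp add: oriented_atlas_def)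
  ultimately interpret conformal_change A g f
    using assms(2) by unfold_locales
  show ?thesis using cotton_tensor_conformal[OF assms(1)] cotton_form_conformal by blast
qed

end
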